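(* Let $0<R_0<R_1<R_2$ and let $\mathcal{M}$ be the closed annulus $\{x\in\mathbb{R}^2: R_0\le|x|\le R_2\}$, $S=\{|x|=R_1\}$, $\Omega_-=\{R_0<|x|<R_1\}$, $\Omega_+=\{R_1<|x|<R_2\}$. Let $c=\mathbf{1}_{\Omega_-}c_-+\mathbf{1}_{\Omega_+}c_+$ with constants $0<c_-<c_+$, and suppose that $$\frac{c_-}{R_1^2}<\frac{c_+}{R_2^2}.$$ Then there exist sequences $(\lambda_n)_{n\in\mathbb{N}}\in\mathbb{R}^{\mathbb{N}}$, $(u_n)_{n\in\mathbb{N}}\in\mathcal{A}^{\mathbb{N}}$ and $E_0>0$ such that for all measurable $\omega\subset\mathcal{M}$ with $\mathrm{dist}(\overline{\omega},S)>0$ there exist $C,d>0$ satisfying $$-\Delta_c u_n=\lambda_n u_n,\qquad \lambda_n\underset{n\to+\infty}{\sim}E_0n^2,\qquad \|u_n\|_{L^2(\mathcal{M})}=1,\qquad \|u_n\|_{L^2(\omega)}\le Ce^{-dn},$$ for all $n\in\mathbb{N}$.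
   Context: $-\Delta_c:=-\mathrm{div}(c\nabla\,\cdot)$ with domain $$\mathcal{A}=\{u\in H^1_0(\mathcal{M}) : u|_{\Omega_-}\in H^2(\Omega_-),\ u|_{\Omega_+}\in H^2(\Omega_+),\ c_-\partial_\nu(u|_{\Omega_-})|_S=c_+\partial_\nu(u|_{\Omega_+})|_S\},$$ where $\nu$ is the unit normal to $S$ pointing into $\Omega_+$. *)

theory Defs
  imports "HOL-Analysis.Analysis" "HOL-Library.Landau_Symbols"
begin

section \<open>Square-integrable functions\<close>

text \<open>
  Elements of Lebesgue and Sobolev spaces on a set \<open>U\<close> are represented by total functions. Only
  their values on \<open>U\<close>, up to null sets, matter.
\<close>

definition L2_fun :: "'a measure \<Rightarrow> ('a \<Rightarrow> real) \<Rightarrow> bool" where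
  "L2_fun M f \<longleftrightarrow> f \<in> borel_measurable M \<and> integrable M (\<lambda>x. (f x)\<^sup>2)"

definition L2_norm :: "'a measure \<Rightarrow> ('a \<Rightarrow> real) \<Rightarrow> real" where
  "L2_norm M f = sqrt (\<integral>x. (f x)\<^sup>2 \<partial>M)"

definition L2_tendsto :: "'a measure \<Rightarrow> (nat \<Rightarrow> 'a \<Rightarrow> real) \<Rightarrow> ('a \<Rightarrow> real) \<Rightarrow> bool" where
  "L2_tendsto M f g \<longleftrightarrow>
     (\<forall>k. L2_fun M (f k)) \<and> L2_fun M g \<and>
     (\<lambda>k. L2_norm M (\<lambda>x. f k x - g x)) \<longlonglongrightarrow> 0"


section \<open>Test functions, weak derivatives and Sobolev spaces\<close>

primrec C_k :: "nat \<Rightarrow> ('a::euclidean_space \<Rightarrow> real) \<Rightarrow> bool" where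
  "C_k 0 f \<longleftrightarrow> continuous_on UNIV f"
| "C_k (Suc k) f \<longleftrightarrow>
     f differentiable_on UNIV \<and> (\<forall>b\<in>Basis. C_k k (\<lambda>x. frechet_derivative f (at x) b))"

text \<open>The space of smooth functions with compact support contained in \<open>U\<close>.\<close>

definition test_fun :: "'a::euclidean_space set \<Rightarrow> ('a \<Rightarrow> real) \<Rightarrow> bool" where
  "test_fun U \<phi> \<longleftrightarrow>
     (\<forall>k. C_k k \<phi>) \<and> compact (closure {x. \<phi> x \<noteq> 0}) \<and> closure {x. \<phi> x \<noteq> 0} \<subseteq> U"

definition weak_deriv ::
    "'a::euclidean_space set \<Rightarrow> 'a \<Rightarrow> ('a \<Rightarrow> real) \<Rightarrow> ('a \<Rightarrow> real) \<Rightarrow> bool" where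
  "weak_deriv U b u v \<longleftrightarrow>
     L2_fun (lebesgue_on U) u \<and> L2_fun (lebesgue_on U) v \<and>
     (\<forall>\<phi>. test_fun U \<phi> \<longrightarrow>
        (\<integral>x. u x * frechet_derivative \<phi> (at x) b \<partial>lebesgue_on U)
          = - (\<integral>x. v x * \<phi> x \<partial>lebesgue_on U))"

definition weak_grad ::
    "'a::euclidean_space set \<Rightarrow> ('a \<Rightarrow> real) \<Rightarrow> ('a \<Rightarrow> 'a) \<Rightarrow> bool" where
  "weak_grad U u G \<longleftrightarrow> (\<forall>b\<in>Basis. weak_deriv U b u (\<lambda>x. G x \<bullet> b))"

text \<open>
  \<open>div F = f\<close> in the sense of distributions on \<open>U\<close>; note that
  \<open>frechet_derivative \<phi> (at x) (F x)\<close> is the inner product of \<open>F x\<close> with the gradient of \<open>\<phi>\<close>.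
\<close>

definition weak_div ::
    "'a::euclidean_space set \<Rightarrow> ('a \<Rightarrow> 'a) \<Rightarrow> ('a \<Rightarrow> real) \<Rightarrow> bool" where
  "weak_div U F f \<longleftrightarrow>
     (\<forall>b\<in>Basis. L2_fun (lebesgue_on U) (\<lambda>x. F x \<bullet> b)) \<and> L2_fun (lebesgue_on U) f \<and>
     (\<forall>\<phi>. test_fun U \<phi> \<longrightarrow>
        (\<integral>x. frechet_derivative \<phi> (at x) (F x) \<partial>lebesgue_on U)
          = - (\<integral>x. f x * \<phi> x \<partial>lebesgue_on U))"

text \<open>\<open>sobolev k U\<close> is the space \<open>H\<^sup>k(U)\<close>, for \<open>U\<close> open.\<close>

primrec sobolev :: "nat \<Rightarrow> 'a::euclidean_space set \<Rightarrow> ('a \<Rightarrow> real) set" where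
  "sobolev 0 U = {u. L2_fun (lebesgue_on U) u}"
| "sobolev (Suc k) U =
     {u. L2_fun (lebesgue_on U) u \<and> (\<forall>b\<in>Basis. \<exists>v. weak_deriv U b u v \<and> v \<in> sobolev k U)}"

text \<open>
  Convergence in the norm of \<open>H\<^sup>1(U)\<close>. Weak gradients are unique up to null sets, so it does not
  matter which ones are chosen.
\<close>

definition H1_tendsto ::
    "'a::euclidean_space set \<Rightarrow> (nat \<Rightarrow> 'a \<Rightarrow> real) \<Rightarrow> ('a \<Rightarrow> real) \<Rightarrow> bool" where
  "H1_tendsto U f u \<longleftrightarrow>
     L2_tendsto (lebesgue_on U) f u \<and>
     (\<exists>F G. (\<forall>k. weak_grad U (f k) (F k)) \<and> weak_grad U u G \<and>
        (\<forall>b\<in>Basis. L2_tendsto (lebesgue_on U) (\<lambda>k x. F k x \<bullet> b) (\<lambda>x. G x \<bullet> b)))"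

text \<open>The closure of the test functions in \<open>H\<^sup>1(U)\<close>.\<close>

definition H1_0 :: "'a::euclidean_space set \<Rightarrow> ('a \<Rightarrow> real) set" where
  "H1_0 U = {u. \<exists>\<phi>. (\<forall>k. test_fun U (\<phi> k)) \<and> H1_tendsto U \<phi> u}"

text \<open>
  \<open>g\<close> is the trace of \<open>w \<in> H\<^sup>1(\<Omega>)\<close> on a part of the boundary of \<open>\<Omega>\<close> with surface measure \<open>\<sigma>\<close>.
  The trace operator is the continuous extension to \<open>H\<^sup>1(\<Omega>)\<close> of the restriction map, with values
  in \<open>L\<^sup>2(\<sigma>)\<close>, defined on the \<open>H\<^sup>1\<close> functions that are continuous up to the boundary; its graph is
  the closure of the graph of that restriction map.
\<close>

definition has_trace ::
    "'a::euclidean_space set \<Rightarrow> 'a measure \<Rightarrow> ('a \<Rightarrow> real) \<Rightarrow> ('a \<Rightarrow> real) \<Rightarrow> bool" where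
  "has_trace \<Omega> \<sigma> w g \<longleftrightarrow>
     (\<exists>\<phi>. (\<forall>k. continuous_on (closure \<Omega>) (\<phi> k)) \<and> H1_tendsto \<Omega> \<phi> w \<and> L2_tendsto \<sigma> \<phi> g)"

text \<open>\<open>g\<close> is the normal derivative of \<open>u \<in> H\<^sup>2(\<Omega>)\<close> along the unit normal field \<open>\<nu>\<close>.\<close>

definition has_normal_deriv ::
    "'a::euclidean_space set \<Rightarrow> 'a measure \<Rightarrow> ('a \<Rightarrow> 'a) \<Rightarrow> ('a \<Rightarrow> real) \<Rightarrow> ('a \<Rightarrow> real) \<Rightarrow> bool" where
  "has_normal_deriv \<Omega> \<sigma> \<nu> u g \<longleftrightarrow>
     (\<exists>G T. weak_grad \<Omega> u G \<and>
        (\<forall>b\<in>Basis. has_trace \<Omega> \<sigma> (\<lambda>x. G x \<bullet> b) (\<lambda>x. T x \<bullet> b)) \<and>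
        (AE x in \<sigma>. g x = T x \<bullet> \<nu> x))"


section \<open>The operator with a jump across a circle\<close>

definition open_annulus :: "real \<Rightarrow> real \<Rightarrow> (real^2) set" where
  "open_annulus a b = {x. a < norm x \<and> norm x < b}"

definition closed_annulus :: "real \<Rightarrow> real \<Rightarrow> (real^2) set" where
  "closed_annulus a b = {x. a \<le> norm x \<and> norm x \<le> b}"

text \<open>Arc length on the circle of radius \<open>r > 0\<close> around the origin.\<close>

definition circle_measure :: "real \<Rightarrow> (real^2) measure" where
  "circle_measure r =
     distr (density lborel (\<lambda>\<theta>. ennreal (r * indicator {0..2 * pi} \<theta>)))
       (restrict_space borel (sphere 0 r)) (\<lambda>\<theta>. vector [r * cos \<theta>, r * sin \<theta>])"

definition jump_coeff :: "real \<Rightarrow> real \<Rightarrow> real \<Rightarrow> real \<Rightarrow> real \<Rightarrow> real^2 \<Rightarrow> real" where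
  "jump_coeff R\<^sub>0 R\<^sub>1 R\<^sub>2 c\<^sub>m c\<^sub>p x =
     indicator (open_annulus R\<^sub>0 R\<^sub>1) x * c\<^sub>m + indicator (open_annulus R\<^sub>1 R\<^sub>2) x * c\<^sub>p"

text \<open>
  The domain of the operator. On the circle of radius \<open>R\<^sub>1\<close>, \<open>sgn x = x / norm x\<close> is the unit normal
  pointing into the outer annulus.
\<close>

definition op_domain ::
    "real \<Rightarrow> real \<Rightarrow> real \<Rightarrow> real \<Rightarrow> real \<Rightarrow> (real^2 \<Rightarrow> real) set" where
  "op_domain R\<^sub>0 R\<^sub>1 R\<^sub>2 c\<^sub>m c\<^sub>p =
     {u. u \<in> H1_0 (interior (closed_annulus R\<^sub>0 R\<^sub>2)) \<and>
         u \<in> sobolev 2 (open_annulus R\<^sub>0 R\<^sub>1) \<and>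
         u \<in> sobolev 2 (open_annulus R\<^sub>1 R\<^sub>2) \<and>
         (\<exists>g\<^sub>m g\<^sub>p.
            has_normal_deriv (open_annulus R\<^sub>0 R\<^sub>1) (circle_measure R\<^sub>1) sgn u g\<^sub>m \<and>
            has_normal_deriv (open_annulus R\<^sub>1 R\<^sub>2) (circle_measure R\<^sub>1) sgn u g\<^sub>p \<and>
            (AE x in circle_measure R\<^sub>1. c\<^sub>m * g\<^sub>m x = c\<^sub>p * g\<^sub>p x))}"

text \<open>\<open>- div (c grad u) = f\<close> on \<open>U\<close>.\<close>

definition neg_div_grad ::
    "'a::euclidean_space set \<Rightarrow> ('a \<Rightarrow> real) \<Rightarrow> ('a \<Rightarrow> real) \<Rightarrow> ('a \<Rightarrow> real) \<Rightarrow> bool" where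
  "neg_div_grad U c u f \<longleftrightarrow>
     (\<exists>G. weak_grad U u G \<and> weak_div U (\<lambda>x. c x *\<^sub>R G x) (\<lambda>x. - f x))"

end

theory Submission
  imports Defs
begin

text \<open>
  The eigenfunctions are sought in separated form \<open>u x = F (ln (norm x)) * cos (n \<theta>)\<close>. In the
  variable \<open>t = ln (norm x)\<close> the eigenvalue equation becomes \<open>F'' = (n\<^sup>2 - (\<lambda> / c) * exp (2 * t)) * F\<close>
  on either side of \<open>t = ln R\<^sub>1\<close>, and the domain of the operator requires \<open>F\<close> and \<open>c * F'\<close> to be
  continuous there and \<open>F\<close> to vanish at \<open>ln R\<^sub>0\<close> and \<open>ln R\<^sub>2\<close>. The coefficient is negative exactly
  where the effective potential \<open>c * n\<^sup>2 / r\<^sup>2\<close> lies below \<open>\<lambda>\<close>. This potential decreases on each side.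
  Its infimum over the inner annulus is \<open>E * n\<^sup>2\<close> with \<open>E = c\<^sub>m / R\<^sub>1\<^sup>2\<close>, approached only at the
  interface, and by assumption its infimum over the outer annulus, \<open>c\<^sub>p * n\<^sup>2 / R\<^sub>2\<^sup>2\<close>, is strictly larger.
  A solution whose eigenvalue is only slightly above \<open>E * n\<^sup>2\<close> is therefore confined to a thin layer
  at the inner side of the interface and decays exponentially, at a rate proportional to \<open>n\<close>,
  everywhere else.

  Existence of such eigenvalues (\<open>eigenpair_near_bottom\<close>) is a shooting argument. The solution that
  starts at \<open>ln R\<^sub>0\<close> with value \<open>0\<close> and slope \<open>1\<close> depends continuously on \<open>\<lambda>\<close>. For \<open>\<lambda> = E * n\<^sup>2\<close> the
  coefficient is nonnegative throughout, so the solution is positive up to \<open>ln R\<^sub>2\<close>. For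
  \<open>\<lambda> = E * (1 + \<epsilon>) * n\<^sup>2\<close> and large \<open>n\<close> the coefficient is very negative on a fixed interval ending at the
  interface, and Sturm comparison with a sine forces a zero. At the smallest \<open>\<lambda>\<close> for which there is a
  zero beyond the starting point, it sits at the end point \<open>ln R\<^sub>2\<close>, because an earlier one would be a
  double zero.

  Exponential decay (\<open>eigenpair_decay\<close>) follows from two monotone quantities: \<open>F * F'\<close> grows where
  the coefficient is nonnegative, and then \<open>F'\<^sup>2 - m\<^sup>2 * F\<^sup>2\<close> grows where the coefficient is at least \<open>m\<^sup>2\<close>.
  To turn the pointwise bound into one relative to the norm of \<open>u\<close>, a rotation by a quarter of an
  angular period exchanges \<open>cos\<^sup>2\<close> and \<open>sin\<^sup>2\<close>; hence the mass of \<open>u\<close> is half of that of the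
  radial factor (\<open>mass_of_mode\<close>).

  The other half of the work is to see that \<open>u\<close> is an eigenfunction in the weak sense
  (\<open>eigenpair_in_op_domain\<close>). Green's formula against test functions reduces to the statement that a
  derivative of a compactly supported function has integral zero, which is translation invariance of
  Lebesgue measure. It is applied to smooth functions only: glued functions are bounded pointwise
  limits of smooth ones, obtained by blending the two pieces with a steep smooth step, and all the weak
  identities survive bounded pointwise limits. Only the radial part of the flux is differentiated
  across the interface, and it is continuous there; the tangential part may jump, since the step is
  constant along circles.
\<close>

section \<open>Smooth functions on open sets\<close>

text \<open>
  The version of \<^const>\<open>C_k\<close> on an open set. It is needed because the building blocks, such as
  \<open>\<lambda>x. ln (norm x)\<close>, are smooth only away from the origin.
\<close>

primrec C_k_on :: "nat \<Rightarrow> 'a::euclidean_space set \<Rightarrow> ('a \<Rightarrow> real) \<Rightarrow> bool" where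
  "C_k_on 0 S f \<longleftrightarrow> continuous_on S f"
| "C_k_on (Suc k) S f \<longleftrightarrow>
     f differentiable_on S \<and> (\<forall>b\<in>Basis. C_k_on k S (\<lambda>x. frechet_derivative f (at x) b))"

lemma C_k_on_UNIV: "C_k_on k UNIV f \<longleftrightarrow> C_k k f"
  by (induction k arbitrary: f) auto

lemma C_k_on_has_derivative:
  assumes "C_k_on (Suc k) S f" "open S" "x \<in> S"
  shows "(f has_derivative frechet_derivative f (at x)) (at x)"
proof -
  have "f differentiable (at x within S)" using assms by (simp add: differentiable_on_def)
  then show ?thesis using at_within_open[OF assms(3,2)] frechet_derivative_works by metis
qed

lemma C_k_on_cong:
  assumes "open S" "\<And>x. x \<in> S \<Longrightarrow> f x = g x" "C_k_on k S f"
  shows "C_k_on k S g"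
  using assms(2,3)
proof (induction k arbitrary: f g)
  case 0
  then show ?case by (simp cong: continuous_on_cong)
next
  case (Suc k)
  have d: "(g has_derivative frechet_derivative f (at x)) (at x)" if "x \<in> S" for x
    by (rule has_derivative_transform_within_open[OF C_k_on_has_derivative[OF Suc.prems(2) assms(1) that] assms(1)
        that])
       (use Suc.prems in auto)
  then have "g differentiable_on S"
    by (auto simp: differentiable_on_def differentiable_def intro: has_derivative_at_withinI)
  moreover have "C_k_on k S (\<lambda>x. frechet_derivative g (at x) b)" if "b \<in> Basis" for b
  proof (rule Suc.IH)
    show "C_k_on k S (\<lambda>x. frechet_derivative f (at x) b)" using Suc.prems that by auto
    show "frechet_derivative f (at x) b = frechet_derivative g (at x) b" if "x \<in> S" for x
      using frechet_derivative_at[OF d[OF that]] by simp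
  qed
  ultimately show ?case by simp
qed

lemma C_k_on_SucI:
  assumes "open S" "\<And>x. x \<in> S \<Longrightarrow> (f has_derivative f' x) (at x)"
    and "\<And>b. b \<in> Basis \<Longrightarrow> C_k_on k S (\<lambda>x. f' x b)"
  shows "C_k_on (Suc k) S f"
proof -
  have "f differentiable_on S"
    using assms(2) by (auto simp: differentiable_on_def differentiable_def intro: has_derivative_at_withinI)
  moreover have "C_k_on k S (\<lambda>x. frechet_derivative f (at x) b)" if "b \<in> Basis" for b
    by (rule C_k_on_cong[OF assms(1) _ assms(3)[OF that]]) (simp add: frechet_derivative_at[OF assms(2)])
  ultimately show ?thesis by simp
qed

lemma C_k_on_imp_continuous: "C_k_on k S f \<Longrightarrow> continuous_on S f"
  by (cases k) (auto intro: differentiable_imp_continuous_on)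

lemma C_k_on_Suc_D: "open S \<Longrightarrow> C_k_on (Suc k) S f \<Longrightarrow> C_k_on k S f"
proof (induction k arbitrary: f)
  case 0
  then show ?case using C_k_on_imp_continuous[OF 0(2)] by simp
next
  case (Suc k)
  show ?case
    by (rule C_k_on_SucI[OF Suc.prems(1) C_k_on_has_derivative[OF Suc.prems(2,1)]])
       (use Suc in \<open>auto simp del: C_k_on.simps(2) simp: C_k_on.simps(2)[of "Suc k" S f]\<close>)
qed

lemma C_k_on_subset:
  assumes "open S" "open T" "T \<subseteq> S" "C_k_on k S f" shows "C_k_on k T f"
  using assms(4)
proof (induction k arbitrary: f)
  case 0 then show ?case using assms continuous_on_subset by auto
next
  case (Suc k)
  show ?case
    by (rule C_k_on_SucI[OF assms(2) C_k_on_has_derivative[OF Suc.prems assms(1)]]) (use Suc assms in auto)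
qed

text \<open>
  Used to recognise a function supported in an annulus as smooth on the whole plane: it is smooth
  away from the origin and vanishes near the origin.
\<close>

lemma C_k_on_Un:
  assumes "open S" "open T" "C_k_on k S f" "C_k_on k T f" shows "C_k_on k (S \<union> T) f"
  using assms(3,4)
proof (induction k arbitrary: f)
  case 0 then show ?case using assms by (auto intro: continuous_on_open_Un)
next
  case (Suc k)
  have "(f has_derivative frechet_derivative f (at x)) (at x)" if "x \<in> S \<union> T" for x
    using that C_k_on_has_derivative[OF Suc.prems(1) assms(1)] C_k_on_has_derivative[OF Suc.prems(2) assms(2)] by auto
  then show ?case
    using assms Suc by (intro C_k_on_SucI[of _ _ "\<lambda>x. frechet_derivative f (at x)"]) auto
qed

lemma C_k_on_const: "open S \<Longrightarrow> C_k_on k S (\<lambda>x. c)"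
proof (induction k arbitrary: c)
  case (Suc k)
  show ?case by (rule C_k_on_SucI[OF Suc.prems has_derivative_const]) (use Suc in auto)
qed auto

lemma C_k_on_add:
  assumes "open S" "C_k_on k S f" "C_k_on k S g" shows "C_k_on k S (\<lambda>x. f x + g x)"
  using assms(2,3)
proof (induction k arbitrary: f g)
  case 0 then show ?case by (auto intro: continuous_intros)
next
  case (Suc k)
  show ?case
    by (rule C_k_on_SucI[OF assms(1) has_derivative_add[OF C_k_on_has_derivative[OF Suc.prems(1) assms(1)]
           C_k_on_has_derivative[OF Suc.prems(2) assms(1)]]])
       (use Suc in auto)
qed

lemma C_k_on_mult:
  assumes "open S" "C_k_on k S f" "C_k_on k S g" shows "C_k_on k S (\<lambda>x. f x * g x)"
  using assms(2,3)
proof (induction k arbitrary: f g)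
  case 0 then show ?case by (auto intro: continuous_intros)
next
  case (Suc k)
  show ?case
    by (rule C_k_on_SucI[OF assms(1) has_derivative_mult[OF C_k_on_has_derivative[OF Suc.prems(1) assms(1)]
           C_k_on_has_derivative[OF Suc.prems(2) assms(1)]]])
       (use Suc.prems C_k_on_Suc_D[OF assms(1) Suc.prems(1)] C_k_on_Suc_D[OF assms(1) Suc.prems(2)]
         in \<open>auto intro!: C_k_on_add assms(1) Suc.IH\<close>)
qed

lemma C_k_on_cmult: "open S \<Longrightarrow> C_k_on k S f \<Longrightarrow> C_k_on k S (\<lambda>x. c * f x)"
  by (intro C_k_on_mult C_k_on_const)

lemma C_k_on_minus: "open S \<Longrightarrow> C_k_on k S f \<Longrightarrow> C_k_on k S (\<lambda>x. - f x)"
  using C_k_on_cmult[of S k f "-1"] by simp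

lemma C_k_on_diff: "open S \<Longrightarrow> C_k_on k S f \<Longrightarrow> C_k_on k S g \<Longrightarrow> C_k_on k S (\<lambda>x. f x - g x)"
  using C_k_on_add[OF _ _ C_k_on_minus, of S k f g] by simp

lemma C_k_on_inner: "open S \<Longrightarrow> C_k_on k S (\<lambda>x. x \<bullet> b)"
proof (cases k)
  case (Suc n)
  assume "open S"
  then show ?thesis unfolding Suc
    by (rule C_k_on_SucI[where f' = "\<lambda>_ h. h \<bullet> b"]) (auto intro!: derivative_eq_intros C_k_on_const \<open>open S\<close>)
qed (auto intro: continuous_intros)

lemma C_k_on_norm_square: "open S \<Longrightarrow> C_k_on k S (\<lambda>x. x \<bullet> x)"
proof (cases k)
  case (Suc n)
  assume S: "open S"
  show ?thesis unfolding Suc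
  proof (rule C_k_on_SucI[OF S, where f' = "\<lambda>x h. 2 * (x \<bullet> h)"])
    show "((\<lambda>x. x \<bullet> x) has_derivative (\<lambda>h. 2 * (x \<bullet> h))) (at x)" for x
      by (auto intro!: derivative_eq_intros simp: inner_commute)
  qed (intro C_k_on_cmult C_k_on_inner S)
qed (auto intro: continuous_intros)

lemma C_k_on_real_SucI:
  fixes f :: "real \<Rightarrow> real"
  assumes "open S" "\<And>x. x \<in> S \<Longrightarrow> (f has_real_derivative f' x) (at x)" "C_k_on k S f'"
  shows "C_k_on (Suc k) S f"
  by (rule C_k_on_SucI[OF assms(1) assms(2)[unfolded has_field_derivative_def]]) (use assms(3) in auto)

lemma C_k_on_real_has_derivative:
  fixes f :: "real \<Rightarrow> real"
  assumes "C_k_on (Suc k) S f" "open S" "x \<in> S"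
  shows "(f has_real_derivative frechet_derivative f (at x) 1) (at x)"
proof -
  note d = C_k_on_has_derivative[OF assms]
  have "frechet_derivative f (at x) = (*) (frechet_derivative f (at x) 1)"
  proof (rule ext)
    fix v
    show "frechet_derivative f (at x) v = frechet_derivative f (at x) 1 * v"
      using linear_cmul[OF has_derivative_linear[OF d], of v 1] by (simp add: mult.commute del: mult_cancel_left1)
  qed
  with d show ?thesis unfolding has_field_derivative_def by simp
qed

lemma C_k_on_compose:
  fixes g :: "real \<Rightarrow> real"
  assumes "open I" "open S" "C_k_on k I g" "C_k_on k S h" "\<And>x. x \<in> S \<Longrightarrow> h x \<in> I"
  shows "C_k_on k S (\<lambda>x. g (h x))"
  using assms(3,4)
proof (induction k arbitrary: g)
  case 0 then show ?case using assms(5) by (auto intro!: continuous_on_compose2[of I g])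
next
  case (Suc k)
  have d: "((\<lambda>x. g (h x)) has_derivative
      (\<lambda>v. frechet_derivative g (at (h x)) 1 * frechet_derivative h (at x) v)) (at x)" if "x \<in> S" for x
    by (rule has_derivative_compose[OF C_k_on_has_derivative[OF Suc.prems(2) assms(2) that]
         C_k_on_real_has_derivative[OF Suc.prems(1) assms(1) assms(5)[OF that], unfolded has_field_derivative_def]])
  have "C_k_on k S (\<lambda>x. frechet_derivative g (at (h x)) 1)"
    by (rule Suc.IH) (use Suc.prems C_k_on_Suc_D[OF assms(2) Suc.prems(2)] in auto)
  then show ?case
    by (intro C_k_on_SucI[OF assms(2) d] C_k_on_mult assms(2)) (use Suc.prems in auto)
qed

text \<open>
  The derivative \<open>- (inverse x)\<^sup>2\<close> is a product of inverses, so the order of differentiability can be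
  raised one step at a time.
\<close>

lemma C_k_on_inverse: "C_k_on k (- {0}) (inverse :: real \<Rightarrow> real)"
proof (induction k)
  case 0 show ?case by (auto intro: continuous_intros)
next
  case (Suc k)
  have "C_k_on k (- {0}) (\<lambda>x::real. - (inverse x * inverse x))"
    by (intro C_k_on_minus C_k_on_mult Suc) auto
  then show ?case
    by (intro C_k_on_real_SucI[where f' = "\<lambda>x. - (inverse x * inverse x)"]) (auto intro!: derivative_eq_intros)
qed

lemma C_k_on_exp: "C_k_on k UNIV (exp :: real \<Rightarrow> real)"
  by (induction k) (auto intro!: continuous_intros C_k_on_real_SucI DERIV_exp simp del: C_k_on.simps(2))

lemma C_k_on_ln: "C_k_on k {0<..} (ln :: real \<Rightarrow> real)"
proof (cases k)
  case (Suc n)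
  show ?thesis unfolding Suc
    by (rule C_k_on_real_SucI[where f' = inverse])
       (auto intro!: C_k_on_subset[OF _ _ _ C_k_on_inverse] derivative_eq_intros simp: inverse_eq_divide)
qed (auto intro!: continuous_intros)

lemma C_k_on_ln_norm: "C_k_on k (- {0}) (\<lambda>x. ln (norm x))"
proof -
  have smooth: "C_k_on k (- {0}) (\<lambda>x::'a. (1/2) * ln (x \<bullet> x))"
    by (intro C_k_on_cmult C_k_on_compose[OF _ _ C_k_on_ln] C_k_on_norm_square) auto
  have eq: "(1/2) * ln (x \<bullet> x) = ln (norm x)" if "x \<in> - {0}" for x :: 'a
    using that by (simp add: norm_eq_sqrt_inner ln_sqrt)
  show ?thesis by (rule C_k_on_cong[OF _ eq smooth]) auto
qed

lemma ln_norm_has_derivative: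
  fixes x :: "'a::euclidean_space"
  assumes "x \<noteq> 0"
  shows "((\<lambda>x. ln (norm x)) has_derivative (\<lambda>h. (x \<bullet> h) / (norm x)\<^sup>2)) (at x)"
proof -
  have "(norm has_derivative (\<lambda>h. h \<bullet> sgn x)) (at x)" by (rule has_derivative_norm[OF assms])
  from has_derivative_ln[OF _ this] assms
  have "((\<lambda>x. ln (norm x)) has_derivative (\<lambda>h. (h \<bullet> sgn x) * inverse (norm x))) (at x)" by simp
  moreover have "(h \<bullet> sgn x) * inverse (norm x) = (x \<bullet> h) / (norm x)\<^sup>2" for h
    by (simp add: sgn_div_norm power2_eq_square divide_inverse inner_commute)
  ultimately show ?thesis by simp
qed

section \<open>A smooth step function\<close>

text \<open>
  The functions \<open>exp (- 1 / t) / t ^ m\<close> extended by zero. The derivative of one of them is a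
  combination of two others, which is why the whole family is introduced.
\<close>

definition flat :: "nat \<Rightarrow> real \<Rightarrow> real" where
  "flat m t = (if t > 0 then exp (- inverse t) * inverse t ^ m else 0)"

text \<open>
  At the origin the difference quotient from the right is \<open>s ^ (m + 1) / exp s\<close> with \<open>s = 1 / t\<close>, and
  the exponential wins.
\<close>

lemma flat_has_derivative: "(flat m has_real_derivative flat (m + 2) t - real m * flat (m + 1) t) (at t)"
proof -
  consider "t > 0" | "t < 0" | "t = 0" by linarith
  then show ?thesis
  proof cases
    case 1
    have p: "((\<lambda>t. inverse t ^ m) has_real_derivative - real m * inverse t ^ (m + 1)) (at t)"
    proof -
      have "((\<lambda>t. inverse t ^ m) has_real_derivative
          real m * (- (inverse t ^ Suc (Suc 0)) * inverse t ^ (m - Suc 0))) (at t)"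
        using 1 by (intro DERIV_power DERIV_inverse) auto
      moreover have "real m * (- (inverse t ^ Suc (Suc 0)) * inverse t ^ (m - Suc 0))
          = - real m * inverse t ^ (m + 1)"
        by (cases m) (auto simp: algebra_simps)
      ultimately show ?thesis by (simp only:)
    qed
    have "((\<lambda>t. exp (- inverse t) * inverse t ^ m) has_real_derivative flat (m + 2) t - real m * flat (m
        + 1) t) (at t)"
    proof -
      have "((\<lambda>t. exp (- inverse t)) has_real_derivative exp (- inverse t) * inverse t ^ 2) (at t)"
        using 1 by (auto intro!: derivative_eq_intros simp: power2_eq_square)
      from DERIV_mult[OF this p] show ?thesis
        using 1 by (simp add: flat_def algebra_simps power2_eq_square)
    qed
    then show ?thesis
      by (rule has_field_derivative_transform_within_open[where S = "{0<..}"]) (use 1 in \<open>auto simp: flat_def\<close>)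
  next
    case 2
    have "((\<lambda>t. 0) has_real_derivative flat (m + 2) t - real m * flat (m + 1) t) (at t)"
      using 2 by (auto simp: flat_def)
    then show ?thesis
      by (rule has_field_derivative_transform_within_open[where S = "{..<0}"]) (use 2 in \<open>auto simp: flat_def\<close>)
  next
    case 3
    have right: "((\<lambda>y. (flat m y - flat m 0) / (y - 0)) \<longlongrightarrow> 0) (at_right 0)"
    proof -
      have "((\<lambda>y::real. inverse y ^ Suc m / exp (inverse y)) \<longlongrightarrow> 0) (at_right 0)"
        by (rule filterlim_compose[OF tendsto_power_div_exp_0 filterlim_inverse_at_top_right])
      moreover have "\<forall>\<^sub>F y::real in at_right 0. inverse y ^ Suc m / exp (inverse y) = (flat m y - flat m 0) / (y - 0)"
        by (rule eventually_at_rightI[of 0 1]) (auto simp: flat_def exp_minus field_simps)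
      ultimately show ?thesis by (rule Lim_transform_eventually)
    qed
    have left: "((\<lambda>y. (flat m y - flat m 0) / (y - 0)) \<longlongrightarrow> 0) (at_left 0)"
    proof (rule Lim_transform_eventually[OF tendsto_const])
      show "\<forall>\<^sub>F y::real in at_left 0. 0 = (flat m y - flat m 0) / (y - 0)"
        by (rule eventually_at_leftI[of "-1"]) (auto simp: flat_def)
    qed
    from filterlim_split_at[OF left right]
    have "((\<lambda>y. (flat m y - flat m 0) / (y - 0)) \<longlongrightarrow> 0) (at 0)" .
    then show ?thesis using 3 by (simp add: has_field_derivative_iff flat_def)
  qed
qed

lemma C_k_on_flat: "C_k_on k UNIV (flat m)"
proof (induction k arbitrary: m)
  case 0
  show ?case using DERIV_isCont[OF flat_has_derivative] by (simp add: continuous_on_eq_continuous_at)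
next
  case (Suc k)
  show ?case by (rule C_k_on_real_SucI[OF _ flat_has_derivative]) (auto intro!: C_k_on_diff C_k_on_cmult Suc)
qed

text \<open>
  The usual quotient of flat functions. The derivative vanishes outside \<open>{1..2}\<close> because there the step
  attains its minimum or maximum.
\<close>

lemma smooth_step:
  obtains \<sigma> \<sigma>' :: "real \<Rightarrow> real" and B where
    "\<And>k. C_k_on k UNIV \<sigma>" "\<And>t. (\<sigma> has_real_derivative \<sigma>' t) (at t)"
    "\<And>t. 0 \<le> \<sigma> t" "\<And>t. \<sigma> t \<le> 1" "\<And>t. t \<le> 1 \<Longrightarrow> \<sigma> t = 0" "\<And>t. t \<ge> 2 \<Longrightarrow> \<sigma> t = 1"
    "\<And>t. t \<le> 1 \<or> t \<ge> 2 \<Longrightarrow> \<sigma>' t = 0" "\<And>t. \<bar>\<sigma>' t\<bar> \<le> B"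
proof -
  define \<sigma> where "\<sigma> t = flat 0 (t - 1) * inverse (flat 0 (t - 1) + flat 0 (2 - t))" for t
  define \<sigma>' where "\<sigma>' t = frechet_derivative \<sigma> (at t) 1" for t
  have pos: "flat 0 (t - 1) + flat 0 (2 - t) > 0" for t by (auto simp: flat_def intro: add_pos_pos)
  have nn: "flat 0 t \<ge> 0" for t by (auto simp: flat_def)
  have sh: "C_k_on k UNIV (\<lambda>t. flat 0 (t - 1))" "C_k_on k UNIV (\<lambda>t. flat 0 (2 - t))" for k
    using C_k_on_inner[of UNIV k "1::real"]
    by (auto intro!: C_k_on_compose[OF _ _ C_k_on_flat] C_k_on_diff C_k_on_const)
  have smooth: "C_k_on k UNIV \<sigma>" for k
    unfolding \<sigma>_def
    by (intro C_k_on_mult C_k_on_compose[OF _ _ C_k_on_inverse] C_k_on_add sh) (use pos in \<open>auto simp: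
        less_imp_neq[THEN not_sym]\<close>)
  have d: "(\<sigma> has_real_derivative \<sigma>' t) (at t)" for t
    unfolding \<sigma>'_def by (rule C_k_on_real_has_derivative[OF smooth[of "Suc 0"]]) auto
  have s0: "0 \<le> \<sigma> t" and s1: "\<sigma> t \<le> 1" for t
    using nn[of "t - 1"] nn[of "2 - t"] pos[of t] by (auto simp: \<sigma>_def divide_simps)
  have e0: "\<sigma> t = 0" if "t \<le> 1" for t using that by (simp add: \<sigma>_def flat_def)
  have e1: "\<sigma> t = 1" if "t \<ge> 2" for t using that by (simp add: \<sigma>_def flat_def)
  have z: "\<sigma>' t = 0" if "t \<le> 1 \<or> t \<ge> 2" for t
    using that
  proof
    assume "t \<le> 1" then show ?thesis using DERIV_local_min[OF d, of 1 t] s0 e0 by simp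
  next
    assume "t \<ge> 2" then show ?thesis using DERIV_local_max[OF d, of 1 t] s1 e1 by simp
  qed
  have "continuous_on {1..2} \<sigma>'"
  proof -
    have "C_k_on 0 UNIV \<sigma>'" using smooth[of "Suc 0"] by (simp add: \<sigma>'_def)
    then show ?thesis by (auto intro: continuous_on_subset)
  qed
  from compact_imp_bounded[OF compact_continuous_image[OF this compact_Icc]]
  obtain B where B: "\<forall>t\<in>{1..2}. \<bar>\<sigma>' t\<bar> \<le> B" by (auto simp: bounded_iff)
  have "\<bar>\<sigma>' t\<bar> \<le> max B 0" for t
    using z[of t] B by (cases "t \<le> 1 \<or> t \<ge> 2") (auto simp: le_max_iff_disj)
  from that[OF smooth d s0 s1 e0 e1 z this] show ?thesis by blast
qed

section \<open>Weak derivatives of smooth functions and of their limits\<close>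

text \<open>
  Translations preserve the integral of \<open>\<psi>\<close>, so all its difference quotients have integral zero. They are
  dominated by the bound of the derivative on a ball, and the limit can be taken under the integral.
\<close>

lemma integral_directional_derivative_zero:
  fixes \<psi> D :: "'a::euclidean_space \<Rightarrow> real"
  assumes cont: "continuous_on UNIV \<psi>"
    and deriv: "\<And>x. ((\<lambda>h. \<psi> (x + h *\<^sub>R b)) has_real_derivative D x) (at 0)"
    and bnd: "\<And>x. \<bar>D x\<bar> \<le> B" and supp: "\<And>x. x \<notin> cball 0 R \<Longrightarrow> \<psi> x = 0"
  shows "(\<integral>x. D x \<partial>lborel) = 0"
proof -
  define h where "h k = inverse (real (Suc k))" for k
  define g where "g k x = (\<psi> (x + h k *\<^sub>R b) - \<psi> x) / h k" for k x
  have h: "h k > 0" "h k \<le> 1" "h \<longlonglongrightarrow> 0" for k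
    unfolding h_def using LIMSEQ_inverse_real_of_nat by (auto simp del: of_nat_Suc simp: inverse_le_1_iff)
  have meas: "\<psi> \<in> borel_measurable borel" using cont by (rule borel_measurable_continuous_onI)
  have int: "integrable lborel \<psi>"
  proof -
    have "integrable lborel (\<lambda>x. indicator (cball 0 R) x *\<^sub>R \<psi> x)"
      by (rule borel_integrable_compact) (auto intro: continuous_on_subset[OF cont])
    moreover have "(\<lambda>x. indicator (cball 0 R) x *\<^sub>R \<psi> x) = \<psi>"
      using supp by (auto simp: indicator_def fun_eq_iff simp del: mem_cball)
    ultimately show ?thesis by simp
  qed
  have shift: "integrable lborel (\<lambda>x. \<psi> (x + c))" "(\<integral>x. \<psi> (x + c) \<partial>lborel) = (\<integral>x. \<psi> x \<partial>lborel)" for c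
  proof -
    have *: "lborel = distr lborel borel ((+) c)" by (rule lborel_distr_plus[symmetric])
    show "integrable lborel (\<lambda>x. \<psi> (x + c))"
      using int by (subst (asm) *) (simp add: integrable_distr_eq meas add.commute)
    show "(\<integral>x. \<psi> (x + c) \<partial>lborel) = (\<integral>x. \<psi> x \<partial>lborel)"
      by (subst (2) *) (simp add: integral_distr meas add.commute)
  qed
  have gint: "(\<integral>x. g k x \<partial>lborel) = 0" for k
    unfolding g_def using shift int by simp
  have "(\<lambda>k. \<integral>x. g k x \<partial>lborel) \<longlonglongrightarrow> (\<integral>x. D x \<partial>lborel)"
  proof (rule integral_dominated_convergence)
    have gm: "g k \<in> borel_measurable borel" for k
      unfolding g_def by (intro borel_measurable_continuous_onI continuous_intros continuous_on_compose2[OF cont])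
          (use h in \<open>auto simp: less_imp_neq[THEN not_sym]\<close>)
    then show "g k \<in> borel_measurable lborel" for k by simp
    have lim: "(\<lambda>k. g k x) \<longlonglongrightarrow> D x" for x
    proof -
      have "((\<lambda>h. (\<psi> (x + h *\<^sub>R b) - \<psi> x) / h) \<longlongrightarrow> D x) (at 0)"
        using deriv[of x] by (simp add: DERIV_def)
      moreover have "filterlim h (at 0) sequentially"
        using h by (auto simp: filterlim_at less_imp_neq[THEN not_sym] intro!: always_eventually)
      ultimately show ?thesis unfolding g_def by (rule filterlim_compose)
    qed
    then show "AE x in lborel. (\<lambda>k. g k x) \<longlonglongrightarrow> D x" by simp
    have "D \<in> borel_measurable borel" by (rule borel_measurable_LIMSEQ_real[OF lim gm])
    then show "D \<in> borel_measurable lborel" by simp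
    show "integrable lborel (\<lambda>x::'a. indicator (cball 0 (R + norm b)) x *\<^sub>R B)"
      by (rule borel_integrable_compact) auto
    have "norm (g k x) \<le> indicator (cball 0 (R + norm b)) x *\<^sub>R B" for k x
    proof (cases "x \<in> cball 0 (R + norm b)")
      case True
      have "((\<lambda>t. \<psi> (x + t *\<^sub>R b)) has_real_derivative D (x + t *\<^sub>R b)) (at t)" for t
        using deriv[of "x + t *\<^sub>R b"] DERIV_shift[of "\<lambda>t. \<psi> (x + t *\<^sub>R b)" _ 0 t]
        by (simp add: scaleR_left_distrib add_ac)
      then obtain z where "\<psi> (x + h k *\<^sub>R b) - \<psi> (x + 0 *\<^sub>R b) = (h k - 0) * D (x + z *\<^sub>R b)"
        using MVT2[of 0 "h k" "\<lambda>t. \<psi> (x + t *\<^sub>R b)" "\<lambda>t. D (x + t *\<^sub>R b)"] h(1)[of k] by blast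
      then have "g k x = D (x + z *\<^sub>R b)" using h(1)[of k] by (simp add: g_def)
      then show ?thesis using bnd True by simp
    next
      case False
      have "norm x \<le> norm (x + h k *\<^sub>R b) + norm (h k *\<^sub>R b)"
        using norm_triangle_ineq4[of "x + h k *\<^sub>R b" "h k *\<^sub>R b"] by simp
      also have "norm (h k *\<^sub>R b) \<le> norm b" using h(1,2)[of k] by (simp add: mult_left_le_one_le)
      finally have "x + h k *\<^sub>R b \<notin> cball 0 R" using False by auto
      then have "\<psi> (x + h k *\<^sub>R b) = 0" by (rule supp)
      moreover have "x \<notin> cball 0 R"
      proof
        assume "x \<in> cball 0 R"
        then have "norm x \<le> R + norm b" using norm_ge_zero[of b] unfolding mem_cball_0 by linarith
        then show False using False unfolding mem_cball_0 by blast
      qed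
      then have "\<psi> x = 0" by (rule supp)
      ultimately have "g k x = 0" unfolding g_def by simp
      then show ?thesis using False by (simp only: indicator_simps) simp
    qed
    then show "AE x in lborel. norm (g k x) \<le> indicator (cball 0 (R + norm b)) x *\<^sub>R B" for k by simp
  qed
  then have "(\<lambda>k. 0) \<longlonglongrightarrow> (\<integral>x. D x \<partial>lborel)" unfolding gint .
  from LIMSEQ_unique[OF this tendsto_const] show ?thesis .
qed

lemma integrable_bounded_lebesgue_on:
  fixes f :: "'a::euclidean_space \<Rightarrow> real"
  assumes "U \<in> lmeasurable" "f \<in> borel_measurable (lebesgue_on U)" "\<And>x. x \<in> U \<Longrightarrow> \<bar>f x\<bar> \<le> B"
  shows "integrable (lebesgue_on U) f"
proof -
  interpret finite_measure "lebesgue_on U" by (rule finite_measure_lebesgue_on[OF assms(1)])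
  show ?thesis by (rule integrable_const_bound[of _ B]) (use assms in auto)
qed

lemma L2_fun_bounded:
  fixes f :: "'a::euclidean_space \<Rightarrow> real"
  assumes "U \<in> lmeasurable" "f \<in> borel_measurable (lebesgue_on U)" "\<And>x. x \<in> U \<Longrightarrow> \<bar>f x\<bar> \<le> B"
  shows "L2_fun (lebesgue_on U) f"
proof -
  have "\<bar>(f x)\<^sup>2\<bar> \<le> B\<^sup>2" if "x \<in> U" for x using assms(3)[OF that]
      by (simp add: abs_le_square_iff power2_le_iff_abs_le)
  then show ?thesis unfolding L2_fun_def
    using assms by (auto intro!: integrable_bounded_lebesgue_on[of U _ "B\<^sup>2"])
qed

lemma L2_fun_mult_bounded:
  fixes f g :: "'a::euclidean_space \<Rightarrow> real"
  assumes "U \<in> lmeasurable" "L2_fun (lebesgue_on U) f" "g \<in> borel_measurable (lebesgue_on U)" "\<And>x. x \<in> U \<Longrightarrow> \<bar>g x\<bar> \<le> B"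
  shows "integrable (lebesgue_on U) (\<lambda>x. f x * g x)"
proof (rule Bochner_Integration.integrable_bound)
  interpret finite_measure "lebesgue_on U" by (rule finite_measure_lebesgue_on[OF assms(1)])
  show "integrable (lebesgue_on U) (\<lambda>x. ((f x)\<^sup>2 + 1) * B)" using assms(2) by (auto simp: L2_fun_def)
  show "(\<lambda>x. f x * g x) \<in> borel_measurable (lebesgue_on U)" using assms by (auto simp: L2_fun_def)
  have "\<bar>f x * g x\<bar> \<le> \<bar>((f x)\<^sup>2 + 1) * B\<bar>" if "x \<in> U" for x
  proof -
    have "\<bar>f x\<bar> \<le> (f x)\<^sup>2 + 1"
    proof (cases "\<bar>f x\<bar> \<le> 1")
      case False
      then have "\<bar>f x\<bar> * 1 \<le> \<bar>f x\<bar> * \<bar>f x\<bar>" by (intro mult_left_mono) auto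
      then show ?thesis by (simp add: power2_eq_square)
    qed (simp add: add_increasing)
    then have "\<bar>f x * g x\<bar> \<le> ((f x)\<^sup>2 + 1) * B"
      using assms(4)[OF that] unfolding abs_mult by (intro mult_mono) auto
    then show ?thesis by linarith
  qed
  then show "AE x in lebesgue_on U. norm (f x * g x) \<le> norm (((f x)\<^sup>2 + 1) * B)" by auto
qed

text \<open>
  On a set of finite measure, bounded pointwise convergence is all that is needed for passing to the limit
  in the weak identities.
\<close>

lemma bounded_convergence_lebesgue_on:
  fixes f :: "nat \<Rightarrow> 'a::euclidean_space \<Rightarrow> real"
  assumes "U \<in> lmeasurable" "\<And>k. f k \<in> borel_measurable (lebesgue_on U)"
    "\<And>k x. x \<in> U \<Longrightarrow> \<bar>f k x\<bar> \<le> B" "\<And>x. x \<in> U \<Longrightarrow> (\<lambda>k. f k x) \<longlonglongrightarrow> g x"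
  shows "g \<in> borel_measurable (lebesgue_on U)" "\<And>x. x \<in> U \<Longrightarrow> \<bar>g x\<bar> \<le> B"
    "(\<lambda>k. \<integral>x. f k x \<partial>lebesgue_on U) \<longlonglongrightarrow> (\<integral>x. g x \<partial>lebesgue_on U)"
proof -
  interpret finite_measure "lebesgue_on U" by (rule finite_measure_lebesgue_on[OF assms(1)])
  show g: "g \<in> borel_measurable (lebesgue_on U)"
    by (rule borel_measurable_LIMSEQ_real[OF _ assms(2)]) (use assms(4) in auto)
  show "\<bar>g x\<bar> \<le> B" if "x \<in> U" for x
    by (rule tendsto_upperbound[OF tendsto_rabs[OF assms(4)[OF that]]]) (use assms(3)[OF that] in auto)
  show "(\<lambda>k. \<integral>x. f k x \<partial>lebesgue_on U) \<longlonglongrightarrow> (\<integral>x. g x \<partial>lebesgue_on U)"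
    by (rule integral_dominated_convergence[where w = "\<lambda>_. B"]) (use assms g in auto)
qed

lemma L2_tendsto_bounded:
  fixes f :: "nat \<Rightarrow> 'a::euclidean_space \<Rightarrow> real"
  assumes "U \<in> lmeasurable" "\<And>k. f k \<in> borel_measurable (lebesgue_on U)"
    "\<And>k x. x \<in> U \<Longrightarrow> \<bar>f k x\<bar> \<le> B" "\<And>x. x \<in> U \<Longrightarrow> (\<lambda>k. f k x) \<longlonglongrightarrow> g x"
  shows "L2_tendsto (lebesgue_on U) f g"
proof -
  have g: "g \<in> borel_measurable (lebesgue_on U)" "\<And>x. x \<in> U \<Longrightarrow> \<bar>g x\<bar> \<le> B"
    by (rule bounded_convergence_lebesgue_on(1,2)[where f = f and U = U], use assms in auto)+
  have "\<bar>(f k x - g x)\<^sup>2\<bar> \<le> (2 * B)\<^sup>2" if "x \<in> U" for k x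
  proof -
    have "\<bar>f k x - g x\<bar> \<le> 2 * B" using assms(3)[OF that, of k] g(2)[OF that] by linarith
    then show ?thesis by (metis abs_le_square_iff abs_of_nonneg abs_power2 abs_ge_zero order_trans)
  qed
  moreover have "(\<lambda>k. (f k x - g x)\<^sup>2) \<longlonglongrightarrow> 0" if "x \<in> U" for x
    using tendsto_power[OF tendsto_diff[OF assms(4)[OF that] tendsto_const[of "g x"]], of 2] by simp
  ultimately have "(\<lambda>k. \<integral>x. (f k x - g x)\<^sup>2 \<partial>lebesgue_on U) \<longlonglongrightarrow> (\<integral>x. 0 \<partial>lebesgue_on U)"
    using assms(2) g(1) by (intro bounded_convergence_lebesgue_on(3)[OF assms(1)]) auto
  then have "(\<lambda>k. L2_norm (lebesgue_on U) (\<lambda>x. f k x - g x)) \<longlonglongrightarrow> sqrt 0"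
    unfolding L2_norm_def by (intro tendsto_real_sqrt) simp
  moreover have "L2_fun (lebesgue_on U) (f k)" for k
    by (rule L2_fun_bounded[of U _ B]) (use assms in auto)
  moreover have "L2_fun (lebesgue_on U) g"
    by (rule L2_fun_bounded[of U _ B]) (use assms(1) g in auto)
  ultimately show ?thesis unfolding L2_tendsto_def by simp
qed

lemma L2_fun_cong:
  assumes "\<And>x. x \<in> U \<Longrightarrow> f x = g x"
  shows "L2_fun (lebesgue_on U) f \<longleftrightarrow> L2_fun (lebesgue_on U) g"
proof -
  have "f \<in> borel_measurable (lebesgue_on U) \<longleftrightarrow> g \<in> borel_measurable (lebesgue_on U)"
    by (rule measurable_cong) (use assms in simp)
  moreover have "integrable (lebesgue_on U) (\<lambda>x. (f x)\<^sup>2) \<longleftrightarrow> integrable (lebesgue_on U) (\<lambda>x. (g x)\<^sup>2)"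
    by (rule Bochner_Integration.integrable_cong) (use assms in simp_all)
  ultimately show ?thesis by (simp add: L2_fun_def)
qed

lemma test_fun_zero: "test_fun U \<phi> \<Longrightarrow> x \<notin> closure {x. \<phi> x \<noteq> 0} \<Longrightarrow> \<phi> x = 0"
  using closure_subset[of "{x. \<phi> x \<noteq> 0}"] by auto

lemma test_fun_has_derivative:
  assumes "test_fun U \<phi>" shows "(\<phi> has_derivative frechet_derivative \<phi> (at x)) (at x)"
  using assms C_k_on_has_derivative[of 0 UNIV \<phi> x] unfolding C_k_on_UNIV by (auto simp: test_fun_def)

lemma test_fun_derivative_coordinates:
  assumes "test_fun U \<phi>"
  shows "frechet_derivative \<phi> (at x) v = (\<Sum>b\<in>Basis. v \<bullet> b * frechet_derivative \<phi> (at x) b)"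
proof -
  have lin: "linear (frechet_derivative \<phi> (at x))"
      by (rule has_derivative_linear[OF test_fun_has_derivative[OF assms]])
  have "frechet_derivative \<phi> (at x) (\<Sum>b\<in>Basis. (v \<bullet> b) *\<^sub>R b) = (\<Sum>b\<in>Basis. v \<bullet> b * frechet_derivative \<phi> (at x) b)"
    by (simp add: linear_sum[OF lin] linear_cmul[OF lin])
  then show ?thesis by (simp add: euclidean_representation)
qed

lemma test_fun_derivative_zero:
  assumes "test_fun U \<phi>" "x \<notin> closure {x. \<phi> x \<noteq> 0}" shows "frechet_derivative \<phi> (at x) b = 0"
proof -
  have "((\<lambda>x. 0) has_derivative frechet_derivative \<phi> (at x)) (at x)"
    by (rule has_derivative_transform_within_open[OF test_fun_has_derivative[OF assms(1)], of "- closure {x. \<phi> x \<noteq>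
        0}"])
       (use assms test_fun_zero in auto)
  then have "frechet_derivative \<phi> (at x) = (\<lambda>h. 0)"
    using has_derivative_unique has_derivative_const by blast
  then show ?thesis by simp
qed

lemma test_fun_continuous:
  assumes "test_fun U \<phi>" "b \<in> Basis"
  shows "continuous_on S \<phi>" "continuous_on S (\<lambda>x. frechet_derivative \<phi> (at x) b)"
proof -
  have "C_k 0 \<phi>" "C_k (Suc 0) \<phi>" using assms unfolding test_fun_def by blast+
  then show "continuous_on S \<phi>" "continuous_on S (\<lambda>x. frechet_derivative \<phi> (at x) b)"
    using assms(2) by (auto intro: continuous_on_subset)
qed

lemma bounded_if_compact_support:
  fixes f :: "'a::topological_space \<Rightarrow> real"
  assumes "compact K" "continuous_on K f" "\<And>x. x \<notin> K \<Longrightarrow> f x = 0"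
  obtains C where "\<And>x. \<bar>f x\<bar> \<le> C"
proof -
  obtain C where C: "\<forall>x\<in>K. \<bar>f x\<bar> \<le> C"
    using compact_imp_bounded[OF compact_continuous_image[OF assms(2,1)]] by (auto simp: bounded_iff)
  have "\<bar>f x\<bar> \<le> max C 0" for x using C assms(3)[of x] by (cases "x \<in> K") (auto simp: le_max_iff_disj)
  then show ?thesis by (rule that)
qed

lemma test_fun_bounded:
  assumes "test_fun U \<phi>" "b \<in> Basis"
  obtains C where "\<And>x. \<bar>\<phi> x\<bar> \<le> C" "\<And>x. \<bar>frechet_derivative \<phi> (at x) b\<bar> \<le> C"
proof -
  let ?K = "closure {x. \<phi> x \<noteq> 0}"
  have K: "compact ?K" using assms by (simp add: test_fun_def)
  obtain C1 where C1: "\<And>x. \<bar>\<phi> x\<bar> \<le> C1"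
    using bounded_if_compact_support[OF K test_fun_continuous(1)[OF assms] test_fun_zero[OF assms(1)]] by blast
  obtain C2 where C2: "\<And>x. \<bar>frechet_derivative \<phi> (at x) b\<bar> \<le> C2"
    using bounded_if_compact_support[OF K test_fun_continuous(2)[OF assms] test_fun_derivative_zero[OF assms(1)]]
        by blast
  show ?thesis by (rule that[of "max C1 C2"]) (auto simp: le_max_iff_disj C1 C2)
qed

lemma test_fun_measurable:
  assumes "test_fun U \<phi>" "b \<in> Basis" "S \<in> sets lebesgue"
  shows "\<phi> \<in> borel_measurable (lebesgue_on S)" "(\<lambda>x. frechet_derivative \<phi> (at x) b) \<in> borel_measurable (lebesgue_on
      S)"
  using test_fun_continuous[OF assms(1,2)] assms(3) by (auto intro!: continuous_imp_measurable_on_sets_lebesgue)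

text \<open>
  Green's formula without boundary: the product \<open>w * \<phi>\<close>, extended by zero, is differentiable on the whole
  space and compactly supported, so that its derivative has integral zero.
\<close>

lemma weak_deriv_C1:
  fixes w :: "'a::euclidean_space \<Rightarrow> real"
  assumes U: "open U" "bounded U" and V: "open V" "closure U \<subseteq> V" and w: "C_k_on (Suc 0) V w" and b: "b \<in> Basis"
  shows "weak_deriv U b w (\<lambda>x. frechet_derivative w (at x) b)"
proof -
  let ?w' = "\<lambda>x. frechet_derivative w (at x) b"
  have Um: "U \<in> lmeasurable" using U by (simp add: bounded_set_imp_lmeasurable)
  have UV: "U \<subseteq> V" using V(2) closure_subset by blast
  have cw: "continuous_on V w" "continuous_on V ?w'" using w b C_k_on_imp_continuous[OF w] by auto
  have "compact (closure U)" using U by simp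
  then obtain Bw Bw' where Bw: "\<And>x. x \<in> U \<Longrightarrow> \<bar>w x\<bar> \<le> Bw" "\<And>x. x \<in> U \<Longrightarrow> \<bar>?w' x\<bar> \<le> Bw'"
    using compact_imp_bounded[OF compact_continuous_image[OF continuous_on_subset[OF cw(1) V(2)]]]
      compact_imp_bounded[OF compact_continuous_image[OF continuous_on_subset[OF cw(2) V(2)]]] closure_subset[of U]
    by (auto simp: bounded_iff) (meson in_mono)
  have m: "w \<in> borel_measurable (lebesgue_on U)" "?w' \<in> borel_measurable (lebesgue_on U)"
    using cw UV Um by (auto intro!: continuous_imp_measurable_on_sets_lebesgue intro: continuous_on_subset)
  have L2: "L2_fun (lebesgue_on U) w" "L2_fun (lebesgue_on U) ?w'"
    using L2_fun_bounded[OF Um m(1) Bw(1)] L2_fun_bounded[OF Um m(2) Bw(2)] by auto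
  have "(\<integral>x. w x * frechet_derivative \<phi> (at x) b \<partial>lebesgue_on U) = - (\<integral>x. ?w' x * \<phi> x \<partial>lebesgue_on U)"
    if \<phi>: "test_fun U \<phi>" for \<phi>
  proof -
    let ?K = "closure {x. \<phi> x \<noteq> 0}"
    let ?p = "\<lambda>x. frechet_derivative \<phi> (at x) b"
    have K: "compact ?K" "?K \<subseteq> U" using \<phi> by (auto simp: test_fun_def)
    define \<psi> where "\<psi> x = w x * \<phi> x" for x
    define D where "D x = indicator U x *\<^sub>R (w x * ?p x + ?w' x * \<phi> x)" for x
    have zero: "\<psi> x = 0" "D x = 0" if "x \<notin> ?K" for x
      using test_fun_zero[OF \<phi> that] test_fun_derivative_zero[OF \<phi> that] by (auto simp: \<psi>_def D_def)
    have cover: "U \<union> - ?K = UNIV" using K(2) by blast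
    have glue: "continuous_on UNIV f" if "continuous_on U f" "\<And>x. x \<notin> ?K \<Longrightarrow> f x = 0" for f :: "'a \<Rightarrow> real"
    proof -
      have "continuous_on (- ?K) f \<longleftrightarrow> continuous_on (- ?K) (\<lambda>x. 0::real)"
          by (rule continuous_on_cong) (use that(2) in auto)
      then have "continuous_on (- ?K) f" by simp
      then show ?thesis using continuous_on_open_Un[of U "- ?K" f] U that(1) cover by (simp add: open_Compl)
    qed
    have "continuous_on U (\<lambda>x. w x * ?p x + ?w' x * \<phi> x)"
      by (intro continuous_intros continuous_on_subset[OF cw(1) UV] continuous_on_subset[OF cw(2) UV]
          test_fun_continuous[OF \<phi> b])
    then have "continuous_on U D" by (rule continuous_on_eq) (simp add: D_def)
    then have cD: "continuous_on UNIV D" by (rule glue) (rule zero(2))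
    obtain B where B: "\<And>x. \<bar>D x\<bar> \<le> B"
      using bounded_if_compact_support[OF K(1) continuous_on_subset[OF cD] zero(2)] by blast
    obtain R where R: "?K \<subseteq> cball 0 R" using bounded_subset_ballD[OF compact_imp_bounded[OF K(1)], of 0]
        ball_subset_cball by blast
    have "(\<integral>x. D x \<partial>lborel) = 0"
    proof (rule integral_directional_derivative_zero[OF _ _ B])
      show "continuous_on UNIV \<psi>"
      proof (rule glue)
        show "continuous_on U \<psi>" unfolding \<psi>_def
          by (intro continuous_intros continuous_on_subset[OF cw(1) UV] test_fun_continuous(1)[OF \<phi> b])
      qed (rule zero(1))
      show "\<psi> x = 0" if "x \<notin> cball 0 R" for x using zero(1) R that by blast
      show "((\<lambda>h. \<psi> (x + h *\<^sub>R b)) has_real_derivative D x) (at 0)" for x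
      proof -
        have d: "(\<psi> has_derivative (\<lambda>h. if x \<in> U then w x * frechet_derivative \<phi> (at x) h
            + frechet_derivative w (at x) h * \<phi> x else 0)) (at x)"
        proof (cases "x \<in> U")
          case True
          then show ?thesis unfolding \<psi>_def
            using has_derivative_mult[OF C_k_on_has_derivative[OF w V(1)] test_fun_has_derivative[OF \<phi>], of x] UV
                by auto
        next
          case False
          then have x: "x \<in> - ?K" using K(2) by auto
          have "(\<psi> has_derivative (\<lambda>h. 0)) (at x)"
            by (rule has_derivative_transform_within_open[OF has_derivative_const _ x]) (auto simp: zero(1)
                open_Compl)
          then show ?thesis using False by simp
        qed
        have "((\<lambda>h. x + h *\<^sub>R b) has_derivative (\<lambda>h. h *\<^sub>R b)) (at 0)" by (auto intro!: derivative_eq_intros)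
        from has_derivative_compose[OF this] d
        have "((\<lambda>h. \<psi> (x + h *\<^sub>R b)) has_derivative (\<lambda>h.
            if x \<in> U then w x * frechet_derivative \<phi> (at x) (h *\<^sub>R b)
            + frechet_derivative w (at x) (h *\<^sub>R b) * \<phi> x else 0)) (at 0)"
          by simp
        moreover have "(if x \<in> U then w x * frechet_derivative \<phi> (at x) (h *\<^sub>R b)
            + frechet_derivative w (at x) (h *\<^sub>R b) * \<phi> x else 0) = D x * h" for h
        proof (cases "x \<in> U")
          case True
          have "linear (frechet_derivative \<phi> (at x))" "linear (frechet_derivative w (at x))"
            using has_derivative_linear[OF test_fun_has_derivative[OF \<phi>]] has_derivative_linear[OF
                C_k_on_has_derivative[OF w V(1)]] True UV by auto
          then show ?thesis using True by (simp add: D_def linear_cmul algebra_simps)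
        qed (simp add: D_def)
        ultimately show ?thesis unfolding has_field_derivative_def by simp
      qed
    qed
    moreover have "(\<integral>x. D x \<partial>lborel) = (\<integral>x. D x \<partial>lebesgue)"
      by (rule integral_completion[symmetric]) (use borel_measurable_continuous_onI[OF cD] in simp)
    moreover have "\<dots> = (\<integral>x. w x * ?p x + ?w' x * \<phi> x \<partial>lebesgue_on U)"
      unfolding D_def using Um by (intro integral_restrict_space[symmetric]) auto
    moreover obtain C where C: "\<And>x. \<bar>\<phi> x\<bar> \<le> C" "\<And>x. \<bar>?p x\<bar> \<le> C" using test_fun_bounded[OF \<phi> b] by blast
    have Us: "U \<in> sets lebesgue" using Um by auto
    moreover have "integrable (lebesgue_on U) (\<lambda>x. w x * ?p x)"
      by (rule L2_fun_mult_bounded[OF Um L2(1) test_fun_measurable(2)[OF \<phi> b Us] C(2)])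
    moreover have "integrable (lebesgue_on U) (\<lambda>x. ?w' x * \<phi> x)"
      by (rule L2_fun_mult_bounded[OF Um L2(2) test_fun_measurable(1)[OF \<phi> b Us] C(1)])
    ultimately show ?thesis by simp
  qed
  then show ?thesis using L2 by (simp add: weak_deriv_def)
qed

lemma weak_deriv_cong:
  assumes "\<And>x. x \<in> U \<Longrightarrow> u x = u' x" "\<And>x. x \<in> U \<Longrightarrow> v x = v' x" "weak_deriv U b u v"
  shows "weak_deriv U b u' v'"
proof -
  have "(\<integral>x. u x * p x \<partial>lebesgue_on U) = (\<integral>x. u' x * p x \<partial>lebesgue_on U)"
    "(\<integral>x. v x * p x \<partial>lebesgue_on U) = (\<integral>x. v' x * p x \<partial>lebesgue_on U)" for p
    by (rule Bochner_Integration.integral_cong[OF refl], simp add: assms(1,2))+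
  then show ?thesis using assms(3) L2_fun_cong[of U u u', OF assms(1)] L2_fun_cong[of U v v', OF assms(2)]
    unfolding weak_deriv_def by simp
qed

text \<open>
  Test functions and their derivatives are bounded, so both sides of the defining identity converge.
\<close>

lemma weak_deriv_limit:
  assumes "U \<in> lmeasurable" "b \<in> Basis" "\<And>k. weak_deriv U b (w k) (v k)"
    "\<And>k x. x \<in> U \<Longrightarrow> \<bar>w k x\<bar> \<le> B" "\<And>k x. x \<in> U \<Longrightarrow> \<bar>v k x\<bar> \<le> B"
    "\<And>x. x \<in> U \<Longrightarrow> (\<lambda>k. w k x) \<longlonglongrightarrow> u x" "\<And>x. x \<in> U \<Longrightarrow> (\<lambda>k. v k x) \<longlonglongrightarrow> u' x"
  shows "weak_deriv U b u u'"
proof -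
  have m: "w k \<in> borel_measurable (lebesgue_on U)" "v k \<in> borel_measurable (lebesgue_on U)" for k
    using assms(3) by (auto simp: weak_deriv_def L2_fun_def)
  have lim: "(\<lambda>k. \<integral>x. f k x * p x \<partial>lebesgue_on U) \<longlonglongrightarrow> (\<integral>x. g x * p x \<partial>lebesgue_on U)"
    if hyps: "\<And>k. f k \<in> borel_measurable (lebesgue_on U)" "p \<in> borel_measurable (lebesgue_on U)"
      "\<And>k x. x \<in> U \<Longrightarrow> \<bar>f k x\<bar> \<le> B" "\<And>x. x \<in> U \<Longrightarrow> (\<lambda>k. f k x) \<longlonglongrightarrow> g x" "\<And>x. \<bar>p x\<bar> \<le> C" for f g p C
  proof (rule bounded_convergence_lebesgue_on(3)[OF assms(1), where B = "B * C"])
    show "\<bar>f k x * p x\<bar> \<le> B * C" if "x \<in> U" for k x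
      unfolding abs_mult by (intro mult_mono hyps(3)[OF that] hyps(5) order_trans[OF abs_ge_zero hyps(3)[OF that]])
          auto
  qed (use hyps in \<open>auto intro!: tendsto_intros\<close>)
  have "(\<integral>x. u x * frechet_derivative \<phi> (at x) b \<partial>lebesgue_on U) = - (\<integral>x. u' x * \<phi> x \<partial>lebesgue_on U)"
    if \<phi>: "test_fun U \<phi>" for \<phi>
  proof -
    obtain C where C: "\<And>x. \<bar>\<phi> x\<bar> \<le> C" "\<And>x. \<bar>frechet_derivative \<phi> (at x) b\<bar> \<le> C" using test_fun_bounded[OF \<phi> assms(2)]
        by blast
    have Us: "U \<in> sets lebesgue" using assms(1) by auto
    have "(\<lambda>k. \<integral>x. w k x * frechet_derivative \<phi> (at x) b \<partial>lebesgue_on U)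
        \<longlonglongrightarrow> (\<integral>x. u x * frechet_derivative \<phi> (at x) b \<partial>lebesgue_on U)"
      by (rule lim[OF m(1) test_fun_measurable(2)[OF \<phi> assms(2) Us] assms(4,6) C(2)])
    moreover have "(\<lambda>k. - (\<integral>x. v k x * \<phi> x \<partial>lebesgue_on U)) \<longlonglongrightarrow> - (\<integral>x. u' x * \<phi> x \<partial>lebesgue_on U)"
      by (intro tendsto_minus lim[OF m(2) test_fun_measurable(1)[OF \<phi> assms(2) Us] assms(5,7) C(1)])
    moreover have "(\<integral>x. w k x * frechet_derivative \<phi> (at x) b \<partial>lebesgue_on U) = - (\<integral>x. v k x * \<phi> x \<partial>lebesgue_on U)"
        for k
      using assms(3) \<phi> by (simp add: weak_deriv_def)
    ultimately show ?thesis using LIMSEQ_unique by auto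
  qed
  moreover have "L2_fun (lebesgue_on U) u" "L2_fun (lebesgue_on U) u'"
    using L2_tendsto_bounded[of U w B u] L2_tendsto_bounded[of U v B u'] assms m by (auto simp: L2_tendsto_def)
  ultimately show ?thesis by (simp add: weak_deriv_def)
qed

text \<open>
  Smoothness up to the boundary is expressed by smoothness on a neighbourhood \<open>V\<close> of the closure; on
  \<open>U\<close> itself the derivatives need not be bounded.
\<close>

lemma smooth_imp_sobolev:
  assumes "open U" "bounded U" "open V" "closure U \<subseteq> V" "\<And>k. C_k_on k V w"
  shows "w \<in> sobolev k U"
  using assms(5)
proof (induction k arbitrary: w)
  case 0
  obtain b :: 'a where "b \<in> Basis" using nonempty_Basis by blast
  from weak_deriv_C1[OF assms(1-4) 0 this] show ?case unfolding weak_deriv_def by simp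
next
  case (Suc k)
  obtain b :: 'a where b: "b \<in> Basis" using nonempty_Basis by blast
  have wd: "weak_deriv U b w (\<lambda>x. frechet_derivative w (at x) b)" if "b \<in> Basis" for b
    by (rule weak_deriv_C1[OF assms(1-4) Suc.prems that])
  moreover have "(\<lambda>x. frechet_derivative w (at x) b) \<in> sobolev k U" if "b \<in> Basis" for b
  proof (rule Suc.IH)
    fix j show "C_k_on j V (\<lambda>x. frechet_derivative w (at x) b)" using Suc.prems[of "Suc j"] that by simp
  qed
  ultimately have "\<forall>b\<in>Basis. \<exists>v. weak_deriv U b w v \<and> v \<in> sobolev k U" by blast
  moreover have "L2_fun (lebesgue_on U) w" using wd[OF b] unfolding weak_deriv_def by blast
  ultimately show ?case by simp
qed

lemma sobolev_cong:
  assumes "\<And>x. x \<in> U \<Longrightarrow> u x = u' x" "u \<in> sobolev k U" shows "u' \<in> sobolev k U"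
proof -
  have L2: "L2_fun (lebesgue_on U) u \<longleftrightarrow> L2_fun (lebesgue_on U) u'"
    using assms(1) by (rule L2_fun_cong)
  show ?thesis
  proof (cases k)
    case 0 then show ?thesis using assms(2) L2 by simp
  next
    case (Suc n)
    have "\<exists>v. weak_deriv U b u' v \<and> v \<in> sobolev n U" if b: "b \<in> Basis" for b
    proof -
      have "\<exists>v. weak_deriv U b u v \<and> v \<in> sobolev n U" using assms(2) b unfolding Suc by simp
      then obtain v where v: "weak_deriv U b u v" "v \<in> sobolev n U" by blast
      have "weak_deriv U b u' v" by (rule weak_deriv_cong[of U u u' v v, OF assms(1) refl v(1)])
      with v(2) show ?thesis by blast
    qed
    moreover have "L2_fun (lebesgue_on U) u" using assms(2) unfolding Suc by simp
    ultimately show ?thesis using L2 unfolding Suc by simp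
  qed
qed

lemma weak_div_of_weak_derivs:
  assumes U: "U \<in> lmeasurable" and X: "\<And>b. b \<in> Basis \<Longrightarrow> weak_deriv U b (\<lambda>x. X x \<bullet> b) (d b)"
    and f: "\<And>x. x \<in> U \<Longrightarrow> f x = (\<Sum>b\<in>Basis. d b x)" "L2_fun (lebesgue_on U) f"
  shows "weak_div U X f"
proof -
  have "(\<integral>x. frechet_derivative \<phi> (at x) (X x) \<partial>lebesgue_on U) = - (\<integral>x. f x * \<phi> x \<partial>lebesgue_on U)"
    if \<phi>: "test_fun U \<phi>" for \<phi>
  proof -
    have Us: "U \<in> sets lebesgue" using U by auto
    have i1: "integrable (lebesgue_on U) (\<lambda>x. X x \<bullet> b * frechet_derivative \<phi> (at x) b)"
      and i2: "integrable (lebesgue_on U) (\<lambda>x. d b x * \<phi> x)" if b: "b \<in> Basis" for b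
    proof -
      obtain C where C: "\<And>x. \<bar>\<phi> x\<bar> \<le> C" "\<And>x. \<bar>frechet_derivative \<phi> (at x) b\<bar> \<le> C" using test_fun_bounded[OF \<phi> b]
          by blast
      show "integrable (lebesgue_on U) (\<lambda>x. X x \<bullet> b * frechet_derivative \<phi> (at x) b)"
        by (rule L2_fun_mult_bounded[OF U _ _ C(2)]) (use X[OF b] test_fun_measurable[OF \<phi> b Us] in \<open>auto simp:
            weak_deriv_def\<close>)
      show "integrable (lebesgue_on U) (\<lambda>x. d b x * \<phi> x)"
        by (rule L2_fun_mult_bounded[OF U _ _ C(1)]) (use X[OF b] test_fun_measurable[OF \<phi> b Us] in \<open>auto simp:
            weak_deriv_def\<close>)
    qed
    have "frechet_derivative \<phi> (at x) (X x) = (\<Sum>b\<in>Basis. X x \<bullet> b * frechet_derivative \<phi> (at x) b)" for x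
      by (rule test_fun_derivative_coordinates[OF \<phi>])
    then have "(\<integral>x. frechet_derivative \<phi> (at x) (X x) \<partial>lebesgue_on U)
        = (\<Sum>b\<in>Basis. \<integral>x. X x \<bullet> b * frechet_derivative \<phi> (at x) b \<partial>lebesgue_on U)"
      using i1 by (simp add: Bochner_Integration.integral_sum)
    also have "\<dots> = (\<Sum>b\<in>Basis. - (\<integral>x. d b x * \<phi> x \<partial>lebesgue_on U))"
      using X \<phi> by (intro sum.cong refl) (simp add: weak_deriv_def)
    also have "\<dots> = - (\<integral>x. (\<Sum>b\<in>Basis. d b x * \<phi> x) \<partial>lebesgue_on U)"
      using i2 by (simp add: Bochner_Integration.integral_sum sum_negf)
    also have "(\<integral>x. (\<Sum>b\<in>Basis. d b x * \<phi> x) \<partial>lebesgue_on U) = (\<integral>x. f x * \<phi> x \<partial>lebesgue_on U)"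
      by (rule Bochner_Integration.integral_cong[OF refl]) (simp add: f(1) sum_distrib_right)
    finally show ?thesis .
  qed
  then show ?thesis using X f by (simp add: weak_div_def weak_deriv_def)
qed

lemma weak_div_limit:
  assumes "U \<in> lmeasurable" "\<And>k. weak_div U (X k) (f k)"
    "\<And>k b x. b \<in> Basis \<Longrightarrow> x \<in> U \<Longrightarrow> \<bar>X k x \<bullet> b\<bar> \<le> B" "\<And>k x. x \<in> U \<Longrightarrow> \<bar>f k x\<bar> \<le> B"
    "\<And>b x. b \<in> Basis \<Longrightarrow> x \<in> U \<Longrightarrow> (\<lambda>k. X k x \<bullet> b) \<longlonglongrightarrow> Y x \<bullet> b" "\<And>x. x \<in> U \<Longrightarrow> (\<lambda>k. f k x) \<longlonglongrightarrow> g x"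
  shows "weak_div U Y g"
proof -
  have m: "(\<lambda>x. X k x \<bullet> b) \<in> borel_measurable (lebesgue_on U)" "f k \<in> borel_measurable (lebesgue_on U)"
      if "b \<in> Basis" for k b
    using assms(2)[of k] that by (auto simp: weak_div_def L2_fun_def)
  have Us: "U \<in> sets lebesgue" using assms(1) by auto
  obtain b0 :: 'a where b0: "b0 \<in> Basis" using nonempty_Basis by blast
  have "(\<integral>x. frechet_derivative \<phi> (at x) (Y x) \<partial>lebesgue_on U) = - (\<integral>x. g x * \<phi> x \<partial>lebesgue_on U)"
    if \<phi>: "test_fun U \<phi>" for \<phi>
  proof -
    note rep = test_fun_derivative_coordinates[OF \<phi>]
    have "\<forall>b\<in>Basis. \<exists>C. \<forall>x. \<bar>frechet_derivative \<phi> (at x) b\<bar> \<le> C"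
    proof
      fix b :: 'a assume b: "b \<in> Basis"
      show "\<exists>C. \<forall>x. \<bar>frechet_derivative \<phi> (at x) b\<bar> \<le> C" by (rule test_fun_bounded[OF \<phi> b]) blast
    qed
    from bchoice[OF this]
    have "\<exists>C. \<forall>b\<in>Basis. \<forall>x. \<bar>frechet_derivative \<phi> (at x) b\<bar> \<le> C b" .
    then obtain C where C: "\<And>b x. b \<in> Basis \<Longrightarrow> \<bar>frechet_derivative \<phi> (at x) b\<bar> \<le> C b" by blast
    obtain C0 where C0: "\<And>x. \<bar>\<phi> x\<bar> \<le> C0" using test_fun_bounded[OF \<phi> b0] by blast
    have "(\<lambda>k. \<integral>x. (\<Sum>b\<in>Basis. X k x \<bullet> b * frechet_derivative \<phi> (at x) b) \<partial>lebesgue_on U)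
        \<longlonglongrightarrow> (\<integral>x. (\<Sum>b\<in>Basis. Y x \<bullet> b * frechet_derivative \<phi> (at x) b) \<partial>lebesgue_on U)"
    proof (rule bounded_convergence_lebesgue_on(3)[OF assms(1), where B = "\<Sum>b\<in>Basis. B * C b"])
      show "\<bar>\<Sum>b\<in>Basis. X k x \<bullet> b * frechet_derivative \<phi> (at x) b\<bar> \<le> (\<Sum>b\<in>Basis. B * C b)" if "x \<in> U" for k x
      proof (rule order_trans[OF sum_abs sum_mono])
        fix b :: 'a assume b: "b \<in> Basis"
        show "\<bar>X k x \<bullet> b * frechet_derivative \<phi> (at x) b\<bar> \<le> B * C b"
          unfolding abs_mult by (intro mult_mono assms(3)[OF b that] C[OF b] order_trans[OF abs_ge_zero assms(3)[OF b
              that]]) auto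
      qed
      show "(\<lambda>x. \<Sum>b\<in>Basis. X k x \<bullet> b * frechet_derivative \<phi> (at x) b) \<in> borel_measurable (lebesgue_on U)" for k
        using m(1) test_fun_measurable[OF \<phi> _ Us] by (intro borel_measurable_sum borel_measurable_times) auto
    qed (intro tendsto_sum tendsto_mult tendsto_const assms(5))
    then have "(\<lambda>k. \<integral>x. frechet_derivative \<phi> (at x) (X k x) \<partial>lebesgue_on U)
        \<longlonglongrightarrow> (\<integral>x. frechet_derivative \<phi> (at x) (Y x) \<partial>lebesgue_on U)"
      unfolding rep[symmetric] .
    moreover have "(\<lambda>k. - (\<integral>x. f k x * \<phi> x \<partial>lebesgue_on U)) \<longlonglongrightarrow> - (\<integral>x. g x * \<phi> x \<partial>lebesgue_on U)"
    proof (intro tendsto_minus bounded_convergence_lebesgue_on(3)[OF assms(1), where B = "B * C0"])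
      show "\<bar>f k x * \<phi> x\<bar> \<le> B * C0" if "x \<in> U" for k x
        unfolding abs_mult by (intro mult_mono assms(4)[OF that] C0 order_trans[OF abs_ge_zero assms(4)[OF that]])
            auto
      show "(\<lambda>x. f k x * \<phi> x) \<in> borel_measurable (lebesgue_on U)" for k
        using m(2)[OF b0] test_fun_measurable[OF \<phi> b0 Us] by auto
    qed (intro tendsto_mult tendsto_const assms(6))
    moreover have "(\<integral>x. frechet_derivative \<phi> (at x) (X k x) \<partial>lebesgue_on U) = - (\<integral>x. f k x * \<phi> x \<partial>lebesgue_on U)"
        for k
      using assms(2) \<phi> by (simp add: weak_div_def)
    ultimately show ?thesis using LIMSEQ_unique by auto
  qed
  moreover have "L2_fun (lebesgue_on U) (\<lambda>x. Y x \<bullet> b)" if b: "b \<in> Basis" for b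
    using L2_tendsto_bounded[of U "\<lambda>k x. X k x \<bullet> b" B "\<lambda>x. Y x \<bullet> b"] assms m b by (auto simp: L2_tendsto_def)
  moreover have "L2_fun (lebesgue_on U) g"
    using L2_tendsto_bounded[of U f B g] assms m b0 by (auto simp: L2_tendsto_def)
  ultimately show ?thesis by (simp add: weak_div_def)
qed

section \<open>Linear second order equations by power series\<close>

text \<open>
  The Taylor coefficients at \<open>0\<close> of the solution of \<open>y'' = (\<Sum>j. q j * t^j) * y\<close> with \<open>y 0 = \<alpha>\<close> and \<open>y' 0 = \<beta>\<close>,
  obtained by comparing coefficients.
\<close>

fun ode_coeff :: "(nat \<Rightarrow> real) \<Rightarrow> real \<Rightarrow> real \<Rightarrow> nat \<Rightarrow> real" where
  "ode_coeff q \<alpha> \<beta> 0 = \<alpha>"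
| "ode_coeff q \<alpha> \<beta> (Suc 0) = \<beta>"
| "ode_coeff q \<alpha> \<beta> (Suc (Suc k)) = (\<Sum>j\<le>k. q j * ode_coeff q \<alpha> \<beta> (k - j)) / (real (Suc k) * real (Suc (Suc k)))"

text \<open>
  A bound for the coefficients that is uniform over all equations with the same bound \<open>B\<close> on the
  coefficient series and the same bound \<open>M\<close> on the initial data. In the recursion the factor
  \<open>\<rho>\<^sup>2 * B\<close> is absorbed by the denominator as soon as the index is large, so that only finitely many steps can
  increase \<open>\<bar>a k\<bar> * \<rho> ^ k\<close>.
\<close>

lemma ode_coeff_bound:
  assumes "\<rho> > 0" "B \<ge> 0" "M \<ge> 0"
  obtains K where "\<And>q \<alpha> \<beta> k. \<lbrakk>\<bar>\<alpha>\<bar> \<le> M; \<bar>\<beta>\<bar> \<le> M; \<And>k. (\<Sum>j\<le>k. \<bar>q j\<bar> * \<rho>^j) \<le> B\<rbrakk>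
      \<Longrightarrow> \<bar>ode_coeff q \<alpha> \<beta> k\<bar> * \<rho>^k \<le> K"
proof -
  define D where "D = 1 + \<rho>\<^sup>2 * B"
  define M' where "M' = M * (1 + \<rho>)"
  obtain k0 :: nat where k0: "real k0 \<ge> D" using real_arch_simple by blast
  \<comment> \<open>A majorant that grows by the factor \<open>D\<close> at each of the first \<open>k0\<close> steps and is constant afterwards.\<close>
  define W where "W k = M' * D ^ (min k k0)" for k
  have D1: "D \<ge> 1" using assms by (simp add: D_def)
  have M'0: "M' \<ge> 0" using assms by (simp add: M'_def)
  have Wmono: "W i \<le> W k" if "i \<le> k" for i k
    unfolding W_def using that D1 M'0 by (intro mult_left_mono power_increasing) auto
  have Wstep: "\<rho>\<^sup>2 * B * W k \<le> real (Suc k) * real (Suc (Suc k)) * W (Suc (Suc k))" for k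
  proof (cases "Suc k \<ge> k0")
    case True
    have "\<rho>\<^sup>2 * B \<le> D" by (simp add: D_def)
    also have "\<dots> \<le> real (Suc k)" using True k0 by linarith
    also have "\<dots> \<le> real (Suc k) * real (Suc (Suc k))"
      by (metis le_add1 mult.right_neutral mult_left_mono of_nat_0_le_iff of_nat_1 of_nat_le_iff plus_1_eq_Suc)
    finally have "\<rho>\<^sup>2 * B \<le> real (Suc k) * real (Suc (Suc k))" .
    moreover have "W k \<ge> 0" using D1 M'0 by (simp add: W_def)
    ultimately show ?thesis using Wmono[of k "Suc (Suc k)"]
      by (intro mult_mono[of "\<rho>\<^sup>2 * B"]) auto
  next
    case False
    then have "D * W k = M' * D ^ Suc k" by (simp add: W_def)
    also have "\<dots> = W (Suc k)" using False by (simp add: W_def)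
    also have "\<dots> \<le> W (Suc (Suc k))" by (rule Wmono) simp
    finally have 1: "D * W k \<le> W (Suc (Suc k))" .
    have W0: "W i \<ge> 0" for i using D1 M'0 by (simp add: W_def)
    have "\<rho>\<^sup>2 * B * W k \<le> D * W k" using W0 by (intro mult_right_mono) (auto simp: D_def)
    also note 1
    also have "W (Suc (Suc k)) \<le> (real (Suc k) * real (Suc (Suc k))) * W (Suc (Suc k))"
    proof -
      have "1 \<le> real (Suc k) * real (Suc (Suc k))"
        using mult_mono[of 1 "real (Suc k)" 1 "real (Suc (Suc k))"] by simp
      from mult_right_mono[OF this W0[of "Suc (Suc k)"]] show ?thesis by simp
    qed
    finally show ?thesis .
  qed
  show ?thesis
  proof (rule that[of "M' * D ^ k0"])
    fix q \<alpha> \<beta> k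
    assume a: "\<bar>\<alpha>\<bar> \<le> M" "\<bar>\<beta>\<bar> \<le> M" and q: "\<And>k. (\<Sum>j\<le>k. \<bar>q j\<bar> * \<rho>^j) \<le> B"
    let ?a = "ode_coeff q \<alpha> \<beta>"
    have "\<bar>?a k\<bar> * \<rho>^k \<le> W k"
    proof (induction k rule: less_induct)
      case (less k)
      consider "k = 0" | "k = 1" | m where "k = Suc (Suc m)"
        by (metis One_nat_def not0_implies_Suc)
      then show ?case
      proof cases
        case 1
        have "M \<le> M'" using assms by (simp add: M'_def algebra_simps)
        then show ?thesis using 1 a by (simp add: W_def)
      next
        case 2
        have "\<bar>\<beta>\<bar> * \<rho> \<le> M * \<rho>" using a assms by (intro mult_right_mono) auto
        also have "\<dots> \<le> M'" using assms by (simp add: M'_def algebra_simps)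
        also have "\<dots> \<le> W 1" using Wmono[of 0 1] by (simp add: W_def)
        finally show ?thesis using 2 by simp
      next
        case 3
        have "\<bar>?a k\<bar> * \<rho>^k * (real (Suc m) * real (Suc (Suc m)))
             = \<rho>\<^sup>2 * (\<bar>\<Sum>j\<le>m. q j * ?a (m - j)\<bar> * \<rho>^m)"
          using 3 by (simp add: field_simps abs_mult power2_eq_square del: of_nat_Suc)
        also have "\<dots> \<le> \<rho>\<^sup>2 * ((\<Sum>j\<le>m. \<bar>q j * ?a (m - j)\<bar>) * \<rho>^m)"
          using assms by (intro mult_left_mono mult_right_mono sum_abs) auto
        also have "(\<Sum>j\<le>m. \<bar>q j * ?a (m - j)\<bar>) * \<rho>^m = (\<Sum>j\<le>m. (\<bar>q j\<bar> * \<rho>^j) * (\<bar>?a (m - j)\<bar> * \<rho>^(m-j)))"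
          unfolding sum_distrib_right
          by (intro sum.cong refl) (simp add: abs_mult flip: power_add)
        also have "\<dots> \<le> (\<Sum>j\<le>m. (\<bar>q j\<bar> * \<rho>^j) * W m)"
        proof (intro sum_mono mult_left_mono)
          fix j assume "j \<in> {..m}"
          have "\<bar>?a (m - j)\<bar> * \<rho>^(m-j) \<le> W (m - j)" using 3 by (intro less) auto
          also have "\<dots> \<le> W m" by (rule Wmono) simp
          finally show "\<bar>?a (m - j)\<bar> * \<rho>^(m-j) \<le> W m" .
        qed (use assms in auto)
        also have "\<dots> \<le> B * W m"
          unfolding sum_distrib_right[symmetric] using D1 M'0
          by (intro mult_right_mono q) (auto simp: W_def)
        finally have "\<bar>?a k\<bar> * \<rho>^k * (real (Suc m) * real (Suc (Suc m))) \<le> \<rho>\<^sup>2 * B * W m"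
          using assms by (simp add: mult_left_mono mult.assoc)
        also note Wstep[of m]
        finally show ?thesis using 3
          by (simp add: mult.commute[of "W _"] mult_less_cancel_left del: of_nat_Suc ode_coeff.simps)
      qed
    qed
    also have "\<dots> \<le> M' * D ^ k0" unfolding W_def using D1 M'0
      by (intro mult_left_mono power_increasing) auto
    finally show "\<bar>?a k\<bar> * \<rho>^k \<le> M' * D ^ k0" .
  qed
qed

lemma continuous_on_ode_coeff:
  assumes "\<And>j. continuous_on \<Lambda> (\<lambda>l. q l j)" "continuous_on \<Lambda> \<alpha>" "continuous_on \<Lambda> \<beta>"
  shows "continuous_on \<Lambda> (\<lambda>l. ode_coeff (q l) (\<alpha> l) (\<beta> l) k)"
proof (induction k rule: less_induct)
  case (less k)
  consider "k = 0" | "k = 1" | m where "k = Suc (Suc m)"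
    by (metis One_nat_def not0_implies_Suc)
  then show ?case
  proof cases
    case 3
    then show ?thesis
      by (auto intro!: continuous_intros assms less simp del: of_nat_Suc)
  qed (use assms in auto)
qed

text \<open>
  Solutions with an entire coefficient depending on a parameter \<open>l\<close>. The joint continuity in parameter and
  time is what the shooting argument needs; it comes from uniform convergence of the power series.
\<close>

lemma linear_ode_solution:
  fixes q :: "'p::topological_space \<Rightarrow> nat \<Rightarrow> real"
  assumes cq: "\<And>j. continuous_on \<Lambda> (\<lambda>l. q l j)" and ca: "continuous_on \<Lambda> \<alpha>" and cb: "continuous_on \<Lambda> \<beta>"
    and M: "\<And>l. l \<in> \<Lambda> \<Longrightarrow> \<bar>\<alpha> l\<bar> \<le> M" "\<And>l. l \<in> \<Lambda> \<Longrightarrow> \<bar>\<beta> l\<bar> \<le> M"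
    and qB: "\<And>\<rho>. \<rho> > 0 \<Longrightarrow> \<exists>B. \<forall>l\<in>\<Lambda>. \<forall>k. (\<Sum>j\<le>k. \<bar>q l j\<bar> * \<rho>^j) \<le> B"
  obtains Y Y' where
    "\<And>l. l \<in> \<Lambda> \<Longrightarrow> Y l 0 = \<alpha> l" "\<And>l. l \<in> \<Lambda> \<Longrightarrow> Y' l 0 = \<beta> l"
    "\<And>l t. l \<in> \<Lambda> \<Longrightarrow> (Y l has_real_derivative Y' l t) (at t)"
    "\<And>l t. l \<in> \<Lambda> \<Longrightarrow> (Y' l has_real_derivative (\<Sum>j. q l j * t^j) * Y l t) (at t)"
    "\<And>T. continuous_on (\<Lambda> \<times> {-T..T}) (\<lambda>(l,t). Y l t)"
    "\<And>T. continuous_on (\<Lambda> \<times> {-T..T}) (\<lambda>(l,t). Y' l t)"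
proof -
  define a where "a l = ode_coeff (q l) (\<alpha> l) (\<beta> l)" for l
  define Y where "Y l t = (\<Sum>k. a l k * t^k)" for l t
  define Y' where "Y' l t = (\<Sum>k. diffs (a l) k * t^k)" for l t
  have bound: "\<exists>K\<ge>0. \<forall>l\<in>\<Lambda>. \<forall>k. \<bar>a l k\<bar> * \<rho>^k \<le> K" if \<rho>: "\<rho> > 0" for \<rho>
  proof -
    obtain B where B: "\<forall>l\<in>\<Lambda>. \<forall>k. (\<Sum>j\<le>k. \<bar>q l j\<bar> * \<rho>^j) \<le> B" using qB[OF \<rho>] by blast
    obtain K where K: "\<And>q \<alpha> \<beta> k. \<lbrakk>\<bar>\<alpha>\<bar> \<le> max M 0; \<bar>\<beta>\<bar> \<le> max M 0; \<And>k. (\<Sum>j\<le>k. \<bar>q j\<bar> * \<rho>^j) \<le> max B 0\<rbrakk>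
      \<Longrightarrow> \<bar>ode_coeff q \<alpha> \<beta> k\<bar> * \<rho>^k \<le> K"
      by (rule ode_coeff_bound[OF \<rho>, of "max B 0" "max M 0"]) auto
    have "\<bar>a l k\<bar> * \<rho>^k \<le> max K 0" if "l \<in> \<Lambda>" for l k
    proof -
      have "\<bar>ode_coeff (q l) (\<alpha> l) (\<beta> l) k\<bar> * \<rho>^k \<le> K"
        using M[OF that] B that by (intro K) (auto simp: le_max_iff_disj)
      then show ?thesis unfolding a_def by (rule max.coboundedI1)
    qed
    then show ?thesis by (intro exI[of _ "max K 0"]) auto
  qed
  \<comment> \<open>Both series are dominated on \<open>{-T..T}\<close> by a geometric series, using the bound for \<open>4 T\<close>.\<close>
  have dom: "\<exists>K. \<forall>l\<in>\<Lambda>. \<forall>k. \<forall>t. \<bar>t\<bar> \<le> T \<longrightarrow> \<bar>a l k * t^k\<bar> \<le> K * (1/2)^k \<and> \<bar>diffs (a l) k * t^k\<bar> \<le> K * (1/2)^k"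
    if T: "T \<ge> 1" for T
  proof -
    \<comment> \<open>The radius \<open>4 * T\<close> leaves a factor \<open>(1/4)^k\<close>; one of its two factors \<open>(1/2)^k\<close> absorbs the index in the differentiated series.\<close>
    obtain K where K: "K \<ge> 0" "\<forall>l\<in>\<Lambda>. \<forall>k. \<bar>a l k\<bar> * (4*T)^k \<le> K" 
    proof -
      have "4 * T > 0" using T by simp
      from bound[OF this] that show ?thesis by blast
    qed
    have *: "\<bar>a l k\<bar> * T^k \<le> K * (1/4)^k" if "l \<in> \<Lambda>" for l k
    proof -
      have "\<bar>a l k\<bar> * T^k * 4^k \<le> K"
        using K(2)[rule_format, OF that, of k] by (simp add: power_mult_distrib mult_ac)
      then have "\<bar>a l k\<bar> * T^k \<le> K / 4^k" by (simp add: pos_le_divide_eq)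
      then show ?thesis unfolding power_one_over by simp
    qed
    have tk: "\<bar>t\<bar>^k \<le> T^k" if "\<bar>t\<bar> \<le> T" for t k using that by (intro power_mono) auto
    show ?thesis
    proof (intro exI[of _ K] ballI allI impI conjI)
      fix l k t assume l: "l \<in> \<Lambda>" and t: "\<bar>t\<bar> \<le> T"
      have "\<bar>a l k * t^k\<bar> \<le> \<bar>a l k\<bar> * T^k" using tk[OF t] by (simp add: abs_mult power_abs mult_left_mono)
      also have "\<dots> \<le> K * (1/4)^k" by (rule *[OF l])
      also have "\<dots> \<le> K * (1/2)^k" using K by (intro mult_left_mono power_mono) auto
      finally show "\<bar>a l k * t^k\<bar> \<le> K * (1/2)^k" .
      have "\<bar>diffs (a l) k * t^k\<bar> = real (Suc k) * (\<bar>a l (Suc k)\<bar> * \<bar>t\<bar>^k)" 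
        by (simp add: diffs_def abs_mult power_abs)
      also have "\<dots> \<le> real (Suc k) * (\<bar>a l (Suc k)\<bar> * T^Suc k)"
      proof (intro mult_left_mono)
        have "T^k \<le> T^Suc k" using T by (intro power_increasing) auto
        then show "\<bar>t\<bar>^k \<le> T^Suc k" using tk[OF t, of k] by linarith
      qed auto
      also have "\<dots> \<le> 2^k * (K * (1/4)^Suc k * 2)"
      proof -
        have "real (Suc k) < real (2 ^ Suc k)" by (simp only: of_nat_less_iff less_exp)
        then have "real (Suc k) \<le> 2^k * 2" by (simp del: of_nat_Suc)
        then have "real (Suc k) * (\<bar>a l (Suc k)\<bar> * T^Suc k) \<le> (2^k * 2) * (K * (1/4)^Suc k)"
          by (rule mult_mono[OF _ *[OF l, of "Suc k"]]) (use T in auto)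
        then show ?thesis by (simp add: mult_ac)
      qed
      also have "\<dots> = K/2 * (2 * (1/4))^k" unfolding power_mult_distrib by simp
      also have "\<dots> = K/2 * (1/2)^k" by simp
      also have "\<dots> \<le> K * (1/2)^k" using K by (intro mult_right_mono) auto
      finally show "\<bar>diffs (a l) k * t^k\<bar> \<le> K * (1/2)^k" .
    qed
  qed
  have geo: "summable (\<lambda>k. K * (1/2::real)^k)" for K by (intro summable_mult summable_geometric) auto
  have sa: "summable (\<lambda>k. norm (a l k * t^k))" and sd: "summable (\<lambda>k. norm (diffs (a l) k * t^k))"
      if l: "l \<in> \<Lambda>" for l t
  proof -
    obtain K where "\<forall>k. \<bar>a l k * t^k\<bar> \<le> K * (1/2)^k \<and> \<bar>diffs (a l) k * t^k\<bar> \<le> K * (1/2)^k"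
      using dom[of "max 1 \<bar>t\<bar>", OF max.cobounded1] max.cobounded2[of "\<bar>t\<bar>" 1] l by blast
    then show "summable (\<lambda>k. norm (a l k * t^k))" "summable (\<lambda>k. norm (diffs (a l) k * t^k))"
      by (auto intro!: summable_comparison_test[OF _ geo[of K]])
  qed
  show ?thesis
  proof (rule that[of Y Y'])
    fix l assume l: "l \<in> \<Lambda>"
    show "Y l 0 = \<alpha> l" by (simp add: Y_def a_def)
    show "Y' l 0 = \<beta> l" by (simp add: Y'_def diffs_def a_def)
    fix t
    show "(Y l has_real_derivative Y' l t) (at t)"
      unfolding Y_def Y'_def
      by (rule termdiffs_strong_converges_everywhere) (rule summable_norm_cancel[OF sa[OF l]])
    have "(Y' l has_real_derivative (\<Sum>k. diffs (diffs (a l)) k * t^k)) (at t)"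
      unfolding Y'_def
      by (rule termdiffs_strong_converges_everywhere) (rule summable_norm_cancel[OF sd[OF l]])
    also have "(\<Sum>k. diffs (diffs (a l)) k * t^k) = (\<Sum>k. \<Sum>j\<le>k. (q l j * t^j) * (a l (k - j) * t^(k-j)))"
    proof (intro suminf_cong)
      fix k
      have "diffs (diffs (a l)) k = (\<Sum>j\<le>k. q l j * a l (k - j))"
        unfolding diffs_def a_def ode_coeff.simps by (simp del: of_nat_Suc)
      then show "diffs (diffs (a l)) k * t^k = (\<Sum>j\<le>k. (q l j * t^j) * (a l (k - j) * t^(k-j)))"
        by (auto simp: sum_distrib_right intro!: sum.cong simp flip: power_add)
    qed
    also have "\<dots> = (\<Sum>j. q l j * t^j) * Y l t"
      unfolding Y_def
    proof (rule Cauchy_product[symmetric])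
      obtain B where B: "\<forall>l\<in>\<Lambda>. \<forall>k. (\<Sum>j\<le>k. \<bar>q l j\<bar> * (\<bar>t\<bar>+1)^j) \<le> B"
        using qB[of "\<bar>t\<bar>+1"] abs_ge_zero[of t] by (meson add_nonneg_pos zero_less_one)
      show "summable (\<lambda>k. norm (q l k * t ^ k))"
      proof (rule bounded_imp_summable)
        fix k
        have "(\<Sum>j\<le>k. norm (q l j * t ^ j)) \<le> (\<Sum>j\<le>k. \<bar>q l j\<bar> * (\<bar>t\<bar>+1)^j)"
          by (intro sum_mono) (auto simp: abs_mult power_abs intro!: mult_left_mono power_mono)
        also have "\<dots> \<le> B" using B l by auto
        finally show "(\<Sum>j\<le>k. norm (q l j * t ^ j)) \<le> B" .
      qed auto
    qed (rule sa[OF l])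
    finally show "(Y' l has_real_derivative (\<Sum>j. q l j * t^j) * Y l t) (at t)" .
  next
    fix T :: real
    obtain K where K: "\<forall>l\<in>\<Lambda>. \<forall>k. \<forall>t. \<bar>t\<bar> \<le> max 1 T \<longrightarrow> \<bar>a l k * t^k\<bar> \<le> K * (1/2)^k
        \<and> \<bar>diffs (a l) k * t^k\<bar> \<le> K * (1/2)^k"
      using dom[of "max 1 T", OF max.cobounded1] by blast
    have ac: "continuous_on (\<Lambda> \<times> {-T..T}) (\<lambda>(l,t). a l k)" for k
    proof -
      have "continuous_on \<Lambda> (\<lambda>l. a l k)" unfolding a_def by (intro continuous_on_ode_coeff cq ca cb)
      from continuous_on_compose2[OF this continuous_on_fst[OF continuous_on_id], of "\<Lambda> \<times> {-T..T}"]
      show ?thesis by (auto simp: case_prod_beta image_def)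
    qed
    have u1: "uniform_limit (\<Lambda> \<times> {-T..T}) (\<lambda>n x. \<Sum>k<n. a (fst x) k * snd x^k) (\<lambda>x. \<Sum>k. a (fst x) k * snd x^k)
        sequentially"
     by (rule Weierstrass_m_test[OF _ geo[of K]]) (use K in auto)
    have u2: "uniform_limit (\<Lambda> \<times> {-T..T}) (\<lambda>n x. \<Sum>k<n. diffs (a (fst x)) k * snd x^k) (\<lambda>x. \<Sum>k. diffs (a (fst x)) k *
        snd x^k) sequentially"
     by (rule Weierstrass_m_test[OF _ geo[of K]]) (use K in auto)
    show "continuous_on (\<Lambda> \<times> {-T..T}) (\<lambda>(l,t). Y l t)"
      unfolding Y_def case_prod_beta
      by (rule uniform_limit_theorem[OF _ u1]) 
         (auto intro!: always_eventually continuous_intros ac[unfolded case_prod_beta])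
    show "continuous_on (\<Lambda> \<times> {-T..T}) (\<lambda>(l,t). Y' l t)"
      unfolding Y'_def case_prod_beta
      by (rule uniform_limit_theorem[OF _ u2]) 
         (auto intro!: always_eventually continuous_intros ac[unfolded case_prod_beta] simp: diffs_def)
  qed
qed

section \<open>Positivity, decay and oscillation of solutions\<close>

text \<open>
  The derivative of \<open>y * y'\<close> is \<open>y'\<^sup>2 + q * y\<^sup>2\<close>.
\<close>

lemma ode_product_mono:
  fixes y y' q :: "real \<Rightarrow> real"
  assumes y: "\<And>t. t \<in> {a..b} \<Longrightarrow> (y has_real_derivative y' t) (at t)"
    and y': "\<And>t. t \<in> {a..b} \<Longrightarrow> (y' has_real_derivative q t * y t) (at t)"
    and q: "\<And>t. t \<in> {a..b} \<Longrightarrow> q t \<ge> 0" and s: "s \<in> {a..b}"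
  shows "y a * y' a \<le> y s * y' s"
proof (rule DERIV_nonneg_imp_nondecreasing[of a s "\<lambda>t. y t * y' t"])
  fix x assume "a \<le> x" "x \<le> s"
  then have x: "x \<in> {a..b}" using s by auto
  have "((\<lambda>t. y t * y' t) has_real_derivative (y' x)\<^sup>2 + q x * (y x)\<^sup>2) (at x)"
    by (rule derivative_eq_intros y[OF x] y'[OF x] refl)+ (simp add: power2_eq_square algebra_simps)
  then show "\<exists>d. ((\<lambda>t. y t * y' t) has_real_derivative d) (at x) \<and> 0 \<le> d" using q[OF x] by fastforce
qed (use s in auto)

text \<open>
  Since \<open>y * y'\<close> stays nonnegative, \<open>y'\<^sup>2\<close> increases, and \<open>y'\<close> cannot change sign.
\<close>

lemma ode_increasing:
  fixes y y' q :: "real \<Rightarrow> real"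
  assumes y: "\<And>t. t \<in> {a..b} \<Longrightarrow> (y has_real_derivative y' t) (at t)"
    and y': "\<And>t. t \<in> {a..b} \<Longrightarrow> (y' has_real_derivative q t * y t) (at t)"
    and q: "\<And>t. t \<in> {a..b} \<Longrightarrow> q t \<ge> 0" and "y a \<ge> 0" "y' a > 0" and t: "t \<in> {a..b}"
  shows "y' t \<ge> y' a" and "y t \<ge> y a + y' a * (t - a)"
proof -
  have A: "y s * y' s \<ge> y a * y' a" if "s \<in> {a..b}" for s
    by (rule ode_product_mono[of a b y y' q]) (use y y' q that in auto)
  have yy: "y s * y' s \<ge> 0" if "s \<in> {a..b}" for s
    using A[OF that] assms(4,5) by (meson less_imp_le mult_nonneg_nonneg order_trans)
  have B: "(y' s)\<^sup>2 \<ge> (y' a)\<^sup>2" if "s \<in> {a..b}" for s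
  proof (rule DERIV_nonneg_imp_nondecreasing[of a s "\<lambda>t. (y' t)\<^sup>2"])
    fix x assume "a \<le> x" "x \<le> s"
    then have x: "x \<in> {a..b}" using that by auto
    have "((\<lambda>t. (y' t)\<^sup>2) has_real_derivative 2 * q x * (y x * y' x)) (at x)"
      by (rule derivative_eq_intros y[OF x] y'[OF x] refl)+ (simp add: power2_eq_square algebra_simps)
    then show "\<exists>d. ((\<lambda>t. (y' t)\<^sup>2) has_real_derivative d) (at x) \<and> 0 \<le> d" using q[OF x] yy[OF x] by fastforce
  qed (use that in auto)
  have C: "y' s \<ge> y' a" if s: "s \<in> {a..b}" for s
  proof (rule ccontr)
    assume "\<not> y' s \<ge> y' a"
    moreover have "\<bar>y' a\<bar> \<le> \<bar>y' s\<bar>" using B[OF s] by (simp add: abs_le_square_iff)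
    ultimately have neg: "y' s < 0" using assms(5) by linarith
    have "\<exists>x. a \<le> x \<and> x \<le> s \<and> y' x = 0"
      by (rule IVT2') (use neg assms(5) s in \<open>auto intro!: continuous_at_imp_continuous_on DERIV_isCont[OF y']\<close>)
    then obtain x where "a \<le> x" "x \<le> s" "y' x = 0" by blast
    with B[of x] s assms(5) show False by simp
  qed
  show "y' t \<ge> y' a" by (rule C[OF t])
  have "y a - y' a * a \<le> y t - y' a * t"
  proof (rule DERIV_nonneg_imp_nondecreasing[of a t "\<lambda>t. y t - y' a * t"])
    fix x assume "a \<le> x" "x \<le> t"
    then have x: "x \<in> {a..b}" using t by auto
    have "((\<lambda>t. y t - y' a * t) has_real_derivative y' x - y' a) (at x)"
      by (rule derivative_eq_intros y[OF x] refl)+ simp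
    then show "\<exists>d. ((\<lambda>t. y t - y' a * t) has_real_derivative d) (at x) \<and> 0 \<le> d" using C[OF x] by fastforce
  qed (use t in auto)
  then show "y t \<ge> y a + y' a * (t - a)" by (simp add: algebra_simps)
qed

text \<open>
  Uniqueness in the form needed for double zeros. By Gronwall's argument
  \<open>(y\<^sup>2 + y'\<^sup>2) * exp ((1 + B) * t)\<close> increases, so if it vanishes at \<open>b\<close> it vanishes at \<open>a\<close>.
\<close>

lemma ode_zero_data:
  fixes y y' q :: "real \<Rightarrow> real"
  assumes y: "\<And>t. t \<in> {a..b} \<Longrightarrow> (y has_real_derivative y' t) (at t)"
    and y': "\<And>t. t \<in> {a..b} \<Longrightarrow> (y' has_real_derivative q t * y t) (at t)"
    and q: "\<And>t. t \<in> {a..b} \<Longrightarrow> \<bar>q t\<bar> \<le> B" and "y b = 0" "y' b = 0" and "a \<le> b"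
  shows "y a = 0" "y' a = 0"
proof -
  let ?E = "\<lambda>t. ((y t)\<^sup>2 + (y' t)\<^sup>2) * exp ((1 + B) * t)"
  have "?E a \<le> ?E b"
  proof (rule DERIV_nonneg_imp_nondecreasing[OF \<open>a \<le> b\<close>])
    fix x assume "a \<le> x" "x \<le> b"
    then have x: "x \<in> {a..b}" by auto
    have d: "(?E has_real_derivative
        (2 * (1 + q x) * (y x * y' x) + (1 + B) * ((y x)\<^sup>2 + (y' x)\<^sup>2)) * exp ((1 + B) * x)) (at x)"
      by (rule derivative_eq_intros y[OF x] y'[OF x] refl)+ (simp add: power2_eq_square algebra_simps)
    have "2 * \<bar>y x * y' x\<bar> \<le> (y x)\<^sup>2 + (y' x)\<^sup>2"
      using sum_squares_bound[of "\<bar>y x\<bar>" "\<bar>y' x\<bar>"] by (simp add: abs_mult)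
    then have "\<bar>1 + q x\<bar> * (2 * \<bar>y x * y' x\<bar>) \<le> (1 + B) * ((y x)\<^sup>2 + (y' x)\<^sup>2)"
      using q[OF x] by (intro mult_mono) auto
    then have "\<bar>2 * (1 + q x) * (y x * y' x)\<bar> \<le> (1 + B) * ((y x)\<^sup>2 + (y' x)\<^sup>2)"
      unfolding abs_mult by (simp add: mult_ac)
    then have "0 \<le> (2 * (1 + q x) * (y x * y' x) + (1 + B) * ((y x)\<^sup>2 + (y' x)\<^sup>2)) * exp ((1 + B) * x)"
      by (intro mult_nonneg_nonneg) auto
    with d show "\<exists>d. (?E has_real_derivative d) (at x) \<and> 0 \<le> d" by blast
  qed
  then have "(y a)\<^sup>2 + (y' a)\<^sup>2 \<le> 0" using assms by (simp add: mult_le_0_iff)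
  then show "y a = 0" "y' a = 0" by (simp_all add: sum_power2_le_zero_iff)
qed

text \<open>
  Agmon's estimate in one dimension. Starting from a zero, \<open>y * y'\<close> and then \<open>y'\<^sup>2 - m\<^sup>2 * y\<^sup>2\<close> stay
  nonnegative, so \<open>y * y' \<ge> m * y\<^sup>2\<close>, and \<open>y\<^sup>2 * exp (- 2 * m * t)\<close> increases.
\<close>

lemma ode_decay:
  fixes y y' q :: "real \<Rightarrow> real"
  assumes y: "\<And>t. t \<in> {a..b} \<Longrightarrow> (y has_real_derivative y' t) (at t)"
    and y': "\<And>t. t \<in> {a..b} \<Longrightarrow> (y' has_real_derivative q t * y t) (at t)"
    and q: "\<And>t. t \<in> {a..b} \<Longrightarrow> q t \<ge> m\<^sup>2" and "y a = 0" "m \<ge> 0"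
    and t: "a \<le> t" "t \<le> t'" "t' \<le> b"
  shows "(y t)\<^sup>2 \<le> exp (- (2 * m * (t' - t))) * (y t')\<^sup>2"
proof -
  have q0: "q t \<ge> 0" if "t \<in> {a..b}" for t using q[OF that] by (meson order_trans zero_le_power2)
  have A: "y s * y' s \<ge> y a * y' a" if "s \<in> {a..b}" for s
    by (rule ode_product_mono[of a b y y' q]) (use y y' q0 that in auto)
  then have yy: "y s * y' s \<ge> 0" if "s \<in> {a..b}" for s using assms(4) that by force
  have B: "(y' s)\<^sup>2 - m\<^sup>2 * (y s)\<^sup>2 \<ge> 0" if "s \<in> {a..b}" for s
  proof -
    have "(y' a)\<^sup>2 - m\<^sup>2 * (y a)\<^sup>2 \<le> (y' s)\<^sup>2 - m\<^sup>2 * (y s)\<^sup>2"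
    proof (rule DERIV_nonneg_imp_nondecreasing[of a s "\<lambda>s. (y' s)\<^sup>2 - m\<^sup>2 * (y s)\<^sup>2"])
      fix x assume "a \<le> x" "x \<le> s"
      then have x: "x \<in> {a..b}" using that by auto
      have d: "((\<lambda>s. (y' s)\<^sup>2 - m\<^sup>2 * (y s)\<^sup>2) has_real_derivative 2 * (q x - m\<^sup>2) * (y x * y' x)) (at x)"
        by (rule derivative_eq_intros y[OF x] y'[OF x] refl)+ (simp add: power2_eq_square algebra_simps)
      have "0 \<le> 2 * (q x - m\<^sup>2) * (y x * y' x)"
        by (rule mult_nonneg_nonneg) (use q[OF x] yy[OF x] in auto)
      with d show "\<exists>d. ((\<lambda>s. (y' s)\<^sup>2 - m\<^sup>2 * (y s)\<^sup>2) has_real_derivative d) (at x) \<and> 0 \<le> d" by blast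
    qed (use that in auto)
    then show ?thesis using assms(4) by simp (insert zero_le_power2[of "y' a"], linarith)
  qed
  have C: "m * (y s)\<^sup>2 \<le> y s * y' s" if "s \<in> {a..b}" for s
  proof -
    have "(m * \<bar>y s\<bar>)\<^sup>2 \<le> \<bar>y' s\<bar>\<^sup>2" using B[OF that] by (simp add: power_mult_distrib)
    then have "m * \<bar>y s\<bar> \<le> \<bar>y' s\<bar>" by (rule power2_le_imp_le) simp
    then have "\<bar>y s\<bar> * (m * \<bar>y s\<bar>) \<le> \<bar>y s\<bar> * \<bar>y' s\<bar>" by (intro mult_left_mono) auto
    also have "\<dots> = y s * y' s" using yy[OF that] by (simp flip: abs_mult)
    finally show ?thesis by (simp add: power2_eq_square mult_ac flip: abs_mult)
  qed
  have "(y t)\<^sup>2 * exp (- 2 * m * t) \<le> (y t')\<^sup>2 * exp (- 2 * m * t')"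
  proof (rule DERIV_nonneg_imp_nondecreasing[OF t(2)])
    fix x assume "t \<le> x" "x \<le> t'"
    then have x: "x \<in> {a..b}" using t by auto
    have d: "((\<lambda>s. (y s)\<^sup>2 * exp (- 2 * m * s)) has_real_derivative
        2 * (y x * y' x - m * (y x)\<^sup>2) * exp (- 2 * m * x)) (at x)"
      by (rule derivative_eq_intros y[OF x] y'[OF x] refl)+ (simp add: power2_eq_square algebra_simps)
    have "0 \<le> 2 * (y x * y' x - m * (y x)\<^sup>2) * exp (- 2 * m * x)"
      using C[OF x] by (intro mult_nonneg_nonneg) auto
    with d show "\<exists>d. ((\<lambda>s. (y s)\<^sup>2 * exp (- 2 * m * s)) has_real_derivative d) (at x) \<and> 0 \<le> d" by blast
  qed
  then have "(y t)\<^sup>2 * exp (- 2 * m * t) * exp (2 * m * t) \<le> (y t')\<^sup>2 * exp (- 2 * m * t') * exp (2 * m * t)"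
    by (intro mult_right_mono) auto
  then show ?thesis by (simp add: mult.assoc flip: exp_add) (simp add: algebra_simps)
qed

lemma ode_decay_backward:
  fixes y y' q :: "real \<Rightarrow> real"
  assumes y: "\<And>t. t \<in> {a..b} \<Longrightarrow> (y has_real_derivative y' t) (at t)"
    and y': "\<And>t. t \<in> {a..b} \<Longrightarrow> (y' has_real_derivative q t * y t) (at t)"
    and q: "\<And>t. t \<in> {a..b} \<Longrightarrow> q t \<ge> m\<^sup>2" and "y b = 0" "m \<ge> 0"
    and t: "a \<le> t'" "t' \<le> t" "t \<le> b"
  shows "(y t)\<^sup>2 \<le> exp (- (2 * m * (t - t'))) * (y t')\<^sup>2"
proof -
  have "(y (- (- t)))\<^sup>2 \<le> exp (- (2 * m * (- t' - - t))) * (y (- (- t')))\<^sup>2"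
  proof (rule ode_decay[where y = "\<lambda>s. y (- s)" and y' = "\<lambda>s. - y' (- s)" and q = "\<lambda>s. q (- s)" and a = "- b" and b
      = "- a"])
    fix s assume "s \<in> {-b..-a}"
    then have s: "- s \<in> {a..b}" by auto
    show "((\<lambda>s. y (- s)) has_real_derivative - y' (- s)) (at s)"
      using y[OF s] by (simp add: DERIV_mirror)
    show "((\<lambda>s. - y' (- s)) has_real_derivative q (- s) * y (- s)) (at s)"
      using DERIV_minus[OF y'[OF s, unfolded DERIV_mirror]] by simp
    show "m\<^sup>2 \<le> q (- s)" by (rule q[OF s])
  qed (use assms in auto)
  then show ?thesis by (simp add: algebra_simps)
qed

text \<open>
  If \<open>y\<close> were positive, its Wronskian with the sine that has half a period on \<open>{a..b}\<close> would increase,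
  although it is positive at \<open>a\<close> and negative at \<open>b\<close>.
\<close>

lemma sturm_oscillation:
  fixes y y' q :: "real \<Rightarrow> real"
  assumes y: "\<And>t. t \<in> {a..b} \<Longrightarrow> (y has_real_derivative y' t) (at t)"
    and y': "\<And>t. t \<in> {a..b} \<Longrightarrow> (y' has_real_derivative q t * y t) (at t)"
    and q: "\<And>t. t \<in> {a..b} \<Longrightarrow> q t \<le> - (pi / (b - a))\<^sup>2" and "a < b"
  shows "\<exists>t\<in>{a..b}. y t \<le> 0"
proof (rule ccontr)
  assume "\<not> ?thesis"
  then have pos: "y t > 0" if "t \<in> {a..b}" for t using that by force
  define w where "w = pi / (b - a)"
  have w: "w > 0" using \<open>a < b\<close> by (simp add: w_def)
  let ?W = "\<lambda>t. y t * (w * cos (w * (t - a))) - y' t * sin (w * (t - a))"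
  have "?W a \<le> ?W b"
  proof (rule DERIV_nonneg_imp_nondecreasing[of a b ?W])
    fix x assume ax: "a \<le> x" "x \<le> b"
    then have x: "x \<in> {a..b}" by auto
    have d: "(?W has_real_derivative - (w\<^sup>2 + q x) * y x * sin (w * (x - a))) (at x)"
      by (rule derivative_eq_intros y[OF x] y'[OF x] refl)+ (simp add: power2_eq_square algebra_simps)
    have "w * (x - a) \<le> w * (b - a)" using w ax by (intro mult_left_mono) auto
    moreover have "w * (b - a) = pi" using \<open>a < b\<close> by (simp add: w_def)
    ultimately have "sin (w * (x - a)) \<ge> 0" using w ax by (intro sin_ge_zero) auto
    then have "0 \<le> - (w\<^sup>2 + q x) * y x * sin (w * (x - a))"
      using q[OF x] pos[OF x] by (intro mult_nonneg_nonneg) (auto simp: w_def)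
    with d show "\<exists>d. (?W has_real_derivative d) (at x) \<and> 0 \<le> d" by blast
  qed (use \<open>a < b\<close> in auto)
  moreover have "w * (b - a) = pi" using \<open>a < b\<close> by (simp add: w_def)
  ultimately have "y a * w \<le> - (y b * w)" by simp
  moreover have "y a * w > 0" "y b * w > 0" using pos \<open>a < b\<close> w by auto
  ultimately show False by linarith
qed

text \<open>
  The general solution, applied to the coefficient \<open>N - (l / c) * exp (2 * t)\<close> and recentred at \<open>s\<close>. The
  initial data may depend on \<open>l\<close>, so that a second solution can be started from the values reached by a
  first one.
\<close>

lemma radial_ode_solution:
  fixes c s la lb A B :: real and N :: real
  assumes "c > 0" "continuous_on {la..lb} \<alpha>" "continuous_on {la..lb} \<beta>"
  obtains Y Y' :: "real \<Rightarrow> real \<Rightarrow> real" where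
    "\<And>l. l \<in> {la..lb} \<Longrightarrow> Y l s = \<alpha> l" "\<And>l. l \<in> {la..lb} \<Longrightarrow> Y' l s = \<beta> l"
    "\<And>l t. l \<in> {la..lb} \<Longrightarrow> (Y l has_real_derivative Y' l t) (at t)"
    "\<And>l t. l \<in> {la..lb} \<Longrightarrow> (Y' l has_real_derivative (N - l / c * exp (2 * t)) * Y l t) (at t)"
    "continuous_on ({la..lb} \<times> {A..B}) (\<lambda>(l,t). Y l t)"
    "continuous_on ({la..lb} \<times> {A..B}) (\<lambda>(l,t). Y' l t)"
proof -
  define q where "q l j = (if j = 0 then N else 0) - l / c * exp (2 * s) * (2^j / fact j)" for l :: real and j :: nat
  have qs: "(\<lambda>j. q l j * t^j) sums (N - l / c * exp (2 * (t + s)))" for l t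
  proof -
    have "(\<lambda>j. (2 * t)^j /\<^sub>R fact j) sums exp (2 * t)" by (rule exp_converges)
    then have "(\<lambda>j. l / c * exp (2 * s) * ((2 * t)^j /\<^sub>R fact j)) sums (l / c * exp (2 * s) * exp (2 * t))"
      by (rule sums_mult)
    moreover have "(\<lambda>j. if j = 0 then N else 0) sums N" using sums_single[of 0 "\<lambda>_. N"] by simp
    ultimately have "(\<lambda>j. (if j = 0 then N else 0) - l / c * exp (2 * s) * ((2 * t)^j /\<^sub>R fact j))
        sums (N - l / c * exp (2 * s) * exp (2 * t))"
      by (intro sums_diff)
    moreover have "(\<lambda>j. (if j = 0 then N else 0) - l / c * exp (2 * s) * ((2 * t)^j /\<^sub>R fact j)) = (\<lambda>j. q l j * t^j)"
      by (rule ext) (auto simp: q_def power_mult_distrib divide_inverse algebra_simps)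
    moreover have "exp (2 * s) * exp (2 * t) = exp (2 * (t + s))" by (simp add: algebra_simps flip: exp_add)
    ultimately show ?thesis by (simp add: mult.assoc)
  qed
  have bnd: "\<exists>M. \<forall>l\<in>{la..lb}. \<bar>g l\<bar> \<le> M" if "continuous_on {la..lb} g" for g :: "real \<Rightarrow> real"
    using compact_imp_bounded[OF compact_continuous_image[OF that compact_Icc]] by (auto simp: bounded_iff)
  obtain M1 M2 where M: "\<forall>l\<in>{la..lb}. \<bar>\<alpha> l\<bar> \<le> M1" "\<forall>l\<in>{la..lb}. \<bar>\<beta> l\<bar> \<le> M2" using bnd assms by metis
  obtain Z Z' where Z: 
    "\<And>l. l \<in> {la..lb} \<Longrightarrow> Z l 0 = \<alpha> l" "\<And>l. l \<in> {la..lb} \<Longrightarrow> Z' l 0 = \<beta> l"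
    "\<And>l t. l \<in> {la..lb} \<Longrightarrow> (Z l has_real_derivative Z' l t) (at t)"
    "\<And>l t. l \<in> {la..lb} \<Longrightarrow> (Z' l has_real_derivative (\<Sum>j. q l j * t^j) * Z l t) (at t)"
    "\<And>T. continuous_on ({la..lb} \<times> {-T..T}) (\<lambda>(l,t). Z l t)"
    "\<And>T. continuous_on ({la..lb} \<times> {-T..T}) (\<lambda>(l,t). Z' l t)"
  proof (rule linear_ode_solution[of "{la..lb}" q \<alpha> \<beta> "max M1 M2"])
    show "continuous_on {la..lb} (\<lambda>l. q l j)" for j unfolding q_def using assms(1) by (intro continuous_intros) auto
    fix \<rho> :: real assume \<rho>: "\<rho> > 0"
    have "(\<Sum>j\<le>k. \<bar>q l j\<bar> * \<rho> ^ j) \<le> \<bar>N\<bar> + max \<bar>la\<bar> \<bar>lb\<bar> / c * exp (2 * s) * exp (2 * \<rho>)" if l: "l \<in> {la..lb}" for l k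
    proof -
      have "(\<Sum>j\<le>k. \<bar>q l j\<bar> * \<rho> ^ j) \<le> (\<Sum>j\<le>k. (if j
          = 0 then \<bar>N\<bar> else 0) + \<bar>l\<bar> / c * exp (2 * s) * ((2 * \<rho>)^j /\<^sub>R fact j))"
      proof (rule sum_mono)
        fix j
        have "\<bar>q l j\<bar> \<le> \<bar>if j = 0 then N else 0\<bar> + \<bar>l / c * exp (2 * s) * (2^j / fact j)\<bar>"
          unfolding q_def by (rule abs_triangle_ineq4)
        also have "\<dots> = (if j = 0 then \<bar>N\<bar> else 0) + \<bar>l\<bar> / c * exp (2 * s) * (2^j / fact j)"
          using assms(1) by (simp add: abs_mult)
        finally have "\<bar>q l j\<bar> * \<rho>^j \<le> ((if j = 0 then \<bar>N\<bar> else 0) + \<bar>l\<bar> / c * exp (2 * s) * (2^j / fact j)) * \<rho>^j"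
          using \<rho> by (intro mult_right_mono) auto
        also have "\<dots> = (if j = 0 then \<bar>N\<bar> else 0) + \<bar>l\<bar> / c * exp (2 * s) * ((2 * \<rho>)^j /\<^sub>R fact j)"
          by (simp add: power_mult_distrib divide_inverse algebra_simps)
        finally show "\<bar>q l j\<bar> * \<rho>^j \<le> (if j = 0 then \<bar>N\<bar> else 0) + \<bar>l\<bar> / c * exp (2 * s) * ((2 * \<rho>)^j /\<^sub>R fact j)" .
      qed
      also have "\<dots> = \<bar>N\<bar> + \<bar>l\<bar> / c * exp (2 * s) * (\<Sum>j\<le>k. (2 * \<rho>)^j /\<^sub>R fact j)"
        by (simp add: sum.distrib sum_distrib_left)
      also have "\<dots> \<le> \<bar>N\<bar> + max \<bar>la\<bar> \<bar>lb\<bar> / c * exp (2 * s) * exp (2 * \<rho>)"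
      proof (intro add_left_mono mult_mono divide_right_mono)
        show "(\<Sum>j\<le>k. (2 * \<rho>)^j /\<^sub>R fact j) \<le> exp (2 * \<rho>)"
          using sum_le_suminf[OF sums_summable[OF exp_converges[of "2 * \<rho>"]], of "{..k}"] \<rho>
          by (simp add: exp_def)
      qed (use l \<rho> assms(1) in \<open>auto intro!: sum_nonneg\<close>)
      finally show ?thesis .
    qed
    then show "\<exists>B. \<forall>l\<in>{la..lb}. \<forall>k. (\<Sum>j\<le>k. \<bar>q l j\<bar> * \<rho> ^ j) \<le> B" by blast
  qed (use M assms in \<open>auto simp: le_max_iff_disj\<close>)
  define T where "T = max \<bar>A - s\<bar> \<bar>B - s\<bar>"
  have sh: "continuous_on ({la..lb} \<times> {A..B}) (\<lambda>(l,t). g l (t - s))"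
    if g: "\<And>T. continuous_on ({la..lb} \<times> {-T..T}) (\<lambda>(l,t). g l t)" for g :: "real \<Rightarrow> real \<Rightarrow> real"
  proof -
    have "continuous_on ({la..lb} \<times> {A..B}) (\<lambda>x. (\<lambda>(l,t). g l t) (fst x, snd x - s))"
      by (rule continuous_on_compose2[OF g[of T]]) (auto intro!: continuous_intros simp: T_def)
    then show ?thesis by (simp add: case_prod_beta)
  qed
  show ?thesis
  proof (rule that[of "\<lambda>l t. Z l (t - s)" "\<lambda>l t. Z' l (t - s)"])
    fix l t assume l: "l \<in> {la..lb}"
    show "((\<lambda>t. Z l (t - s)) has_real_derivative Z' l (t - s)) (at t)"
      using Z(3)[OF l, of "t + - s"] unfolding DERIV_shift by simp
    have "(\<Sum>j. q l j * (t - s)^j) = N - l / c * exp (2 * t)" using qs[of l "t - s"] by (simp add: sums_iff)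
    then show "((\<lambda>t. Z' l (t - s)) has_real_derivative (N - l / c * exp (2 * t)) * Z l (t - s)) (at t)"
      using Z(4)[OF l, of "t + - s"] unfolding DERIV_shift by simp
  qed (use Z sh in auto)
qed

section \<open>Eigenvalues of the radial problem\<close>

text \<open>
  The radial eigenvalue problem in the variable \<open>t = ln r\<close>; \<open>a\<close>, \<open>b\<close>, \<open>c\<close> are the logarithms of the three
  radii. The inner part \<open>f\<close> and the outer part \<open>g\<close> are both required to solve their equation on the whole
  line, so each of them is smooth beyond its own annulus.
\<close>

definition eigenpair :: "real \<Rightarrow> real \<Rightarrow> real \<Rightarrow> real \<Rightarrow> real \<Rightarrow> nat \<Rightarrow> real \<Rightarrow> (real \<Rightarrow> real) \<Rightarrow> (real \<Rightarrow> real) \<Rightarrow> (real \<Rightarrow> real)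
    \<Rightarrow> (real \<Rightarrow> real) \<Rightarrow> bool" where
  "eigenpair a b c cm cp n l f f' g g' \<longleftrightarrow>
    (\<forall>t. (f has_real_derivative f' t) (at t)) \<and>
    (\<forall>t. (f' has_real_derivative ((real n)\<^sup>2 - l / cm * exp (2 * t)) * f t) (at t)) \<and>
    (\<forall>t. (g has_real_derivative g' t) (at t)) \<and>
    (\<forall>t. (g' has_real_derivative ((real n)\<^sup>2 - l / cp * exp (2 * t)) * g t) (at t)) \<and>
    f a = 0 \<and> g c = 0 \<and> f b = g b \<and> cm * f' b = cp * g' b"

text \<open>
  The parameter \<open>la\<close> admits a positive solution and \<open>lb\<close> one with a zero. The set of pairs of a parameter
  and a time at which the solution is not positive is compact. At the smallest parameter in it the
  solution is nonnegative, so a zero in the interior would be a double zero, or, at the interface, a zero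
  where the slopes on both sides have the same sign and must vanish. Hence the zero is at \<open>c\<close>. The condition
  involving \<open>\<delta>\<close> keeps zeros away from \<open>a\<close>, where all solutions start from zero.
\<close>

lemma eigenpair_exists:
  fixes a b c cm cp la lb s \<delta> :: real and n :: nat
  defines "q \<equiv> \<lambda>l c t. (real n)\<^sup>2 - l / c * exp (2 * t)"
  assumes cm: "cm > 0" and cp: "cp > 0" and ab: "a < b" and bc: "b < c" and la: "0 \<le> la" and lab: "la \<le> lb"
    and qm: "\<And>t. t \<in> {a..b} \<Longrightarrow> q la cm t \<ge> 0" and qp: "\<And>t. t \<in> {b..c} \<Longrightarrow> q la cp t \<ge> 0"
    and \<delta>: "\<delta> > 0" "\<And>t. t \<in> {a..a+\<delta>} \<Longrightarrow> q lb cm t \<ge> 0"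
    and s: "a + \<delta> \<le> s" "s < b" "\<And>t. t \<in> {s..b} \<Longrightarrow> q lb cm t \<le> - (pi / (b - s))\<^sup>2"
  shows "\<exists>l\<in>{la..lb}. \<exists>f f' g g'. eigenpair a b c cm cp n l f f' g g' \<and> f' a = 1"
proof -
  obtain Y Y' where Y:
    "\<And>l. l \<in> {la..lb} \<Longrightarrow> Y l a = 0" "\<And>l. l \<in> {la..lb} \<Longrightarrow> Y' l a = 1"
    "\<And>l t. l \<in> {la..lb} \<Longrightarrow> (Y l has_real_derivative Y' l t) (at t)"
    "\<And>l t. l \<in> {la..lb} \<Longrightarrow> (Y' l has_real_derivative q l cm t * Y l t) (at t)"
    and Yc: "continuous_on ({la..lb} \<times> {a..c}) (\<lambda>(l,t). Y l t)"
    "continuous_on ({la..lb} \<times> {a..c}) (\<lambda>(l,t). Y' l t)"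
    unfolding q_def
    by (rule radial_ode_solution[OF cm, of la lb "\<lambda>_. 0" "\<lambda>_. 1" a "(real n)\<^sup>2" a c]) (auto intro: continuous_intros)
  have slice: "continuous_on {la..lb} (\<lambda>l. g l t)"
    if "continuous_on ({la..lb} \<times> {A..c}) (\<lambda>(l,t). g l t)" "t \<in> {A..c}" for g :: "real \<Rightarrow> real \<Rightarrow> real" and t A
  proof -
    have "continuous_on {la..lb} (\<lambda>l. (\<lambda>(l,t). g l t) (l, t))"
      by (rule continuous_on_compose2[OF that(1)]) (use that(2) in \<open>auto intro!: continuous_intros\<close>)
    then show ?thesis by simp
  qed
  obtain Z Z' where Z:
    "\<And>l. l \<in> {la..lb} \<Longrightarrow> Z l b = Y l b" "\<And>l. l \<in> {la..lb} \<Longrightarrow> Z' l b = cm / cp * Y' l b"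
    "\<And>l t. l \<in> {la..lb} \<Longrightarrow> (Z l has_real_derivative Z' l t) (at t)"
    "\<And>l t. l \<in> {la..lb} \<Longrightarrow> (Z' l has_real_derivative q l cp t * Z l t) (at t)"
    and Zc: "continuous_on ({la..lb} \<times> {a..c}) (\<lambda>(l,t). Z l t)"
    unfolding q_def
  proof (rule radial_ode_solution[OF cp, of la lb "\<lambda>l. Y l b" "\<lambda>l. cm / cp * Y' l b" b "(real n)\<^sup>2" a c])
    show "continuous_on {la..lb} (\<lambda>l. Y l b)" using slice[OF Yc(1)] ab bc by auto
    show "continuous_on {la..lb} (\<lambda>l. cm / cp * Y' l b)"
      using slice[OF Yc(2)] ab bc cp by (intro continuous_intros) auto
  qed auto
  have qmono: "q l' k t \<le> q l k t" if "l \<le> l'" "k > 0" for l l' k t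
    unfolding q_def using that by (simp add: divide_right_mono)
  have qabs: "\<exists>B. \<forall>t\<in>{u..v}. \<bar>q l k t\<bar> \<le> B" for l k u v
  proof -
    have "continuous_on {u..v} (q l k)" unfolding q_def by (intro continuous_intros)
    from compact_imp_bounded[OF compact_continuous_image[OF this compact_Icc]]
    show ?thesis by (auto simp: bounded_iff)
  qed
  define H where "H p = (if snd p \<le> b then Y (fst p) (snd p) else Z (fst p) (snd p))" for p
  define D where "D = {la..lb} \<times> {a+\<delta>..c}"
  have "a + \<delta> < b" using s by linarith
  have Hc: "continuous_on D H"
    unfolding H_def
  proof (rule continuous_on_cases_le)
    show "continuous_on {x \<in> D. snd x \<le> b} (\<lambda>x. Y (fst x) (snd x))"
      using \<delta>(1) by (intro continuous_on_subset[OF Yc(1)[unfolded case_prod_beta]]) (auto simp: D_def)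
    show "continuous_on {x \<in> D. b \<le> snd x} (\<lambda>x. Z (fst x) (snd x))"
      using \<delta>(1) by (intro continuous_on_subset[OF Zc(1)[unfolded case_prod_beta]]) (auto simp: D_def)
  qed (auto intro!: continuous_intros simp: D_def Z)
  define K where "K = D \<inter> H -` {..0}"
  have "compact D" "closed D" by (auto simp: D_def intro!: compact_Times closed_Times)
  then have "compact K"
    using continuous_closed_preimage[OF Hc _ closed_atMost, of 0] compact_Int_closed[of D K]
    by (simp add: K_def Int_absorb2)
  moreover have "K \<noteq> {}"
  proof -
    have lb: "lb \<in> {la..lb}" using lab by simp
    have "\<exists>t\<in>{s..b}. Y lb t \<le> 0"
      by (rule sturm_oscillation[OF Y(3)[OF lb] Y(4)[OF lb] s(3) s(2)])
    then obtain t where "t \<in> {s..b}" "Y lb t \<le> 0" by blast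
    then have "(lb, t) \<in> K" using s bc lab by (auto simp: K_def D_def H_def)
    then show ?thesis by blast
  qed
  ultimately have "\<exists>p\<in>K. \<forall>p'\<in>K. fst p \<le> fst p'"
    by (rule continuous_attains_inf) (intro continuous_intros)
  then obtain l t where ltK: "(l, t) \<in> K" and min: "\<And>p. p \<in> K \<Longrightarrow> l \<le> fst p" by fastforce
  have l: "l \<in> {la..lb}" and t: "t \<in> {a+\<delta>..c}" and Hlt: "H (l, t) \<le> 0" using ltK by (auto simp: K_def D_def)
  have la': "la \<in> {la..lb}" using lab by simp
  have Hla: "H (la, r) > 0" if r: "r \<in> {a+\<delta>..c}" for r
  proof -
    have y: "Y la r \<ge> r - a" "Y' la r \<ge> 1" if "r \<in> {a..b}" for r
      using ode_increasing[where a = a and b = b and t = r, OF Y(3)[OF la'] Y(4)[OF la'] qm] that Y(1,2)[OF la']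
          by auto
    have "Y la b > 0" "Y' la b > 0" using y[of b] ab by auto
    then have zb: "Z la b > 0" "Z' la b > 0" using Z(1,2)[OF la'] cm cp by auto
    show ?thesis
    proof (cases "r \<le> b")
      case True
      then show ?thesis using y(1)[of r] r \<delta> by (simp add: H_def)
    next
      case False
      have "Z la b + Z' la b * (r - b) \<le> Z la r"
        using ode_increasing(2)[where a = b and b = c and t = r, OF Z(3)[OF la'] Z(4)[OF la'] qp] r False zb by auto
      moreover have "Z' la b * (r - b) > 0" using zb False by auto
      ultimately have "Z la r > 0" using zb(1) by linarith
      then show ?thesis using False by (simp add: H_def)
    qed
  qed
  then have "l \<noteq> la" using Hlt t by force
  then have lla: "la < l" using l by auto
  \<comment> \<open>Below the smallest parameter with a zero the solution is positive, so at that parameter it is still nonnegative.\<close>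
  have Hnn: "H (l, r) \<ge> 0" if r: "r \<in> {a+\<delta>..c}" for r
  proof -
    have "continuous_on {la..l} (\<lambda>x. H (x, r))"
      by (rule continuous_on_compose2[OF Hc]) (use r l in \<open>auto intro!: continuous_intros simp: D_def\<close>)
    then have "continuous_on (closure {la..<l}) (\<lambda>x. H (x, r))" using lla by simp
    moreover have "l \<in> closure {la..<l}" using lla by simp
    moreover have "H (x, r) \<ge> 0" if "x \<in> {la..<l}" for x
    proof (rule ccontr)
      assume "\<not> ?thesis"
      then have "(x, r) \<in> K" using that r l by (auto simp: K_def D_def)
      from min[OF this] that show False by simp
    qed
    ultimately show ?thesis by (rule continuous_ge_on_closure)
  qed
  have H0: "H (l, t) = 0" using Hlt Hnn[OF t] by simp
  have Ypos: "Y l (a + \<delta>) > 0"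
  proof -
    have "Y l (a + \<delta>) \<ge> Y l a + Y' l a * (a + \<delta> - a)"
    proof (rule ode_increasing(2)[OF Y(3)[OF l] Y(4)[OF l]])
      fix r assume "r \<in> {a..a+\<delta>}"
      from \<delta>(2)[OF this] qmono[of l lb cm r] show "0 \<le> q l cm r" using l cm by auto
    qed (use Y(1,2)[OF l] \<delta> in auto)
    then show ?thesis using Y(1,2)[OF l] \<delta> by simp
  qed
  then have tgt: "t > a + \<delta>" using H0 t \<open>a + \<delta> < b\<close> by (cases "t = a + \<delta>") (auto simp: H_def)
  have Ynz: False if "Y l r = 0" "Y' l r = 0" "a \<le> r" for r
    using ode_zero_data(2)[OF Y(3)[OF l] Y(4)[OF l] _ that(1,2,3)] qabs[of a r l cm] Y(2)[OF l] by fastforce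
  have "t = c"
  proof (rule ccontr)
    assume "t \<noteq> c"
    then have tc: "t < c" using t by simp
    consider "t < b" | "t = b" | "t > b" by linarith
    then show False
    proof cases
      case 1
      have "Y' l t = 0"
      proof (rule DERIV_local_min[OF Y(3)[OF l]])
        show "0 < min (t - (a + \<delta>)) (b - t)" using 1 tgt by simp
        show "\<forall>y. \<bar>t - y\<bar> < min (t - (a + \<delta>)) (b - t) \<longrightarrow> Y l t \<le> Y l y"
        proof (intro allI impI)
          fix y assume "\<bar>t - y\<bar> < min (t - (a + \<delta>)) (b - t)"
          then have "a + \<delta> \<le> y" "y \<le> b" by linarith+
          then show "Y l t \<le> Y l y" using Hnn[of y] H0 1 bc by (simp add: H_def)
        qed
      qed
      then show False using Ynz[of t] H0 1 tgt \<delta> by (simp add: H_def)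
    next
      case 2
      have Y0: "Y l b = 0" and Z0: "Z l b = 0" using H0 2 Z(1)[OF l] by (auto simp: H_def)
      \<comment> \<open>Nonnegativity to the left of the zero bounds the slope from above, to the right of it from below; the flux condition relates the two.\<close>
      have "Y' l b \<le> 0"
      proof (rule ccontr)
        assume "\<not> ?thesis"
        then obtain d where d: "d > 0" "\<And>h. h > 0 \<Longrightarrow> h < d \<Longrightarrow> Y l (b - h) < Y l b"
          using DERIV_pos_inc_left[OF Y(3)[OF l, of b]] by auto
        define h where "h = min (d/2) (b - (a + \<delta>))"
        have h: "h > 0" "h < d" "a + \<delta> \<le> b - h" using d(1) \<open>a + \<delta> < b\<close> by (auto simp: h_def)
        then show False using d(2)[of h] Hnn[of "b - h"] Y0 bc by (simp add: H_def)
      qed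
      moreover have "Z' l b \<ge> 0"
      proof (rule ccontr)
        assume "\<not> ?thesis"
        then obtain d where d: "d > 0" "\<And>h. h > 0 \<Longrightarrow> h < d \<Longrightarrow> Z l (b + h) < Z l b"
          using DERIV_neg_dec_right[OF Z(3)[OF l, of b]] by auto
        define h where "h = min (d/2) (c - b)"
        have h: "h > 0" "h < d" "b + h \<le> c" using d(1) bc by (auto simp: h_def)
        then show False using d(2)[of h] Hnn[of "b + h"] Z0 \<open>a + \<delta> < b\<close> by (simp add: H_def)
      qed
      then have "Y' l b \<ge> 0" using Z(2)[OF l] cm cp by (simp add: zero_le_mult_iff zero_le_divide_iff)
      ultimately show False using Ynz[of b] Y0 ab by simp
    next
      case 3
      have Zt: "Z l t = 0" using H0 3 by (simp add: H_def)
      have Zt': "Z' l t = 0"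
      proof (rule DERIV_local_min[OF Z(3)[OF l]])
        show "0 < min (t - b) (c - t)" using 3 tc by simp
        show "\<forall>y. \<bar>t - y\<bar> < min (t - b) (c - t) \<longrightarrow> Z l t \<le> Z l y"
        proof (intro allI impI)
          fix y assume "\<bar>t - y\<bar> < min (t - b) (c - t)"
          then have "b < y" "y \<le> c" by linarith+
          then show "Z l t \<le> Z l y" using Hnn[of y] H0 3 \<open>a + \<delta> < b\<close> by (simp add: H_def)
        qed
      qed
      obtain B where B: "\<And>r. r \<in> {b..t} \<Longrightarrow> \<bar>q l cp r\<bar> \<le> B" using qabs by blast
      have "Z l b = 0" "Z' l b = 0"
        using ode_zero_data[OF Z(3)[OF l] Z(4)[OF l] B Zt Zt'] 3 by auto
      then show False using Ynz[of b] Z(1,2)[OF l] ab cm cp by auto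
    qed
  qed
  then have "Z l c = 0" using H0 bc by (simp add: H_def)
  then have "eigenpair a b c cm cp n l (Y l) (Y' l) (Z l) (Z' l)"
    unfolding eigenpair_def using Y[OF l] Z[OF l] cp by (auto simp: q_def)
  then show ?thesis using l Y(2)[OF l] by blast
qed

text \<open>
  With \<open>l = E * (1 + e) * n\<^sup>2\<close> the inner coefficient is \<open>n\<^sup>2 * (1 - (1 + e) * exp (2 * (t - b)))\<close>. On an
  interval of length \<open>L\<close> next to \<open>b\<close>, independent of \<open>n\<close>, it is at most \<open>- n\<^sup>2 * e / 2\<close>, which for large \<open>n\<close> is
  below \<open>- (pi / L)\<^sup>2\<close>.
\<close>

lemma eigenpair_near_bottom:
  fixes a b c cm cp \<epsilon> :: real
  defines "E \<equiv> cm * exp (- 2 * b)"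
  assumes cm: "cm > 0" and cp: "cp > 0" and ab: "a < b" and bc: "b < c"
    and gap: "E < cp * exp (- 2 * c)" and "\<epsilon> > 0"
  shows "\<exists>N. \<forall>n\<ge>N. \<exists>l f f' g g'. E * (real n)\<^sup>2 \<le> l \<and> l \<le> E * (1 + \<epsilon>) * (real n)\<^sup>2 \<and>
           eigenpair a b c cm cp n l f f' g g' \<and> f' a = 1"
proof -
  define \<delta> where "\<delta> = (b - a) / 2"
  \<comment> \<open>The second bound keeps the coefficient nonnegative on the left half of \<open>{a..b}\<close>.\<close>
  define e where "e = min \<epsilon> (exp (2 * \<delta>) - 1)"
  \<comment> \<open>The length at which \<open>(1 + e) * exp (- 2 * L)\<close> has dropped to \<open>1 + e / 2\<close>.\<close>
  define L where "L = ln ((1 + e) / (1 + e / 2)) / 2"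
  have \<delta>: "\<delta> > 0" using ab by (simp add: \<delta>_def)
  have e: "e > 0" "e \<le> \<epsilon>" "1 + e \<le> exp (2 * \<delta>)" using \<open>\<epsilon> > 0\<close> \<delta> by (auto simp: e_def)
  have L: "L > 0" "(1 + e) * exp (- 2 * L) = 1 + e / 2"
    using e by (auto simp: L_def exp_minus)
  have "(1 + e) * 1 \<le> (1 + e) * (1 + e / 2)" using e by (intro mult_left_mono) auto
  then have "(1 + e) / (1 + e / 2) \<le> 1 + e" using e by (simp add: pos_divide_le_eq)
  then have "exp (2 * L) \<le> exp (2 * \<delta>)" using e by (simp add: L_def)
  then have L\<delta>: "L \<le> \<delta>" by simp
  have E: "E > 0" using cm by (simp add: E_def)
  obtain N :: nat where N: "real N \<ge> 2 * (pi / L)\<^sup>2 / e" using real_arch_simple by blast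
  show ?thesis
  proof (intro exI[of _ "max 1 N"] allI impI)
    fix n assume "n \<ge> max 1 N"
    then have n1: "n \<ge> 1" and nN: "real n \<ge> 2 * (pi / L)\<^sup>2 / e" using N by auto
    have n2: "(real n)\<^sup>2 \<ge> real n" using n1 by (simp add: power2_eq_square)
    define la where "la = E * (real n)\<^sup>2"
    define lb where "lb = E * (1 + e) * (real n)\<^sup>2"
    have qla: "(real n)\<^sup>2 - la / cm * exp (2 * t) = (real n)\<^sup>2 * (1 - exp (2 * (t - b)))" for t
      using cm by (simp add: la_def E_def field_simps flip: exp_add)
    have qlb: "(real n)\<^sup>2 - lb / cm * exp (2 * t) = (real n)\<^sup>2 * (1 - (1 + e) * exp (2 * (t - b)))" for t
      using cm by (simp add: lb_def E_def field_simps flip: exp_add)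
    have "\<exists>l\<in>{la..lb}. \<exists>f f' g g'. eigenpair a b c cm cp n l f f' g g' \<and> f' a = 1"
    proof (rule eigenpair_exists[OF cm cp ab bc, where \<delta> = \<delta> and s = "b - L"])
      show "0 \<le> la" using E by (simp add: la_def)
      show "la \<le> lb" using E e by (simp add: la_def lb_def mult_right_mono)
      show "0 \<le> (real n)\<^sup>2 - la / cm * exp (2 * t)" if "t \<in> {a..b}" for t
        unfolding qla using that by (intro mult_nonneg_nonneg) auto
      show "0 \<le> (real n)\<^sup>2 - la / cp * exp (2 * t)" if "t \<in> {b..c}" for t
      proof -
        have "E * exp (2 * t) \<le> E * exp (2 * c)" using that E by (intro mult_left_mono) auto
        also have "\<dots> \<le> cp * exp (- 2 * c) * exp (2 * c)" using gap by (intro mult_right_mono) auto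
        also have "\<dots> = cp" by (simp add: mult.assoc flip: exp_add)
        finally have "(E * exp (2 * t) / cp) * (real n)\<^sup>2 \<le> 1 * (real n)\<^sup>2" using cp by (intro mult_right_mono) auto
        then show ?thesis by (simp add: la_def mult_ac)
      qed
      show "0 \<le> (real n)\<^sup>2 - lb / cm * exp (2 * t)" if "t \<in> {a..a+\<delta>}" for t
      proof -
        have "t - b \<le> - \<delta>" using that by (simp add: \<delta>_def field_simps)
        then have "(1 + e) * exp (2 * (t - b)) \<le> exp (2 * \<delta>) * exp (2 * (- \<delta>))"
          using e by (intro mult_mono[OF e(3)]) auto
        also have "\<dots> = 1" by (simp flip: exp_add)
        finally show ?thesis unfolding qlb by (intro mult_nonneg_nonneg) auto
      qed
      show "(real n)\<^sup>2 - lb / cm * exp (2 * t) \<le> - (pi / (b - (b - L)))\<^sup>2" if "t \<in> {b-L..b}" for t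
      proof -
        have "exp (- 2 * L) \<le> exp (2 * (t - b))" using that by auto
        then have "(1 + e) * exp (2 * (t - b)) \<ge> 1 + e / 2" 
          unfolding L(2)[symmetric] using e by (intro mult_left_mono) auto
        then have "(real n)\<^sup>2 * (1 - (1 + e) * exp (2 * (t - b))) \<le> (real n)\<^sup>2 * (- (e / 2))"
          by (intro mult_left_mono) auto
        also have "\<dots> \<le> real n * (- (e / 2))" using n2 e by (intro mult_right_mono_neg) auto
        also have "\<dots> \<le> - (pi / L)\<^sup>2" 
        proof -
          have "2 * (pi / L)\<^sup>2 \<le> real n * e" using nN e(1) by (simp add: pos_divide_le_eq)
          then show ?thesis by simp
        qed
        finally show ?thesis unfolding qlb by simp
      qed
    qed (use \<delta> L L\<delta> in \<open>auto simp: \<delta>_def field_simps\<close>)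
    moreover have "lb \<le> E * (1 + \<epsilon>) * (real n)\<^sup>2"
      unfolding lb_def using E e by (intro mult_right_mono mult_left_mono) auto
    ultimately show "\<exists>l f f' g g'. E * (real n)\<^sup>2 \<le> l \<and> l \<le> E * (1 + \<epsilon>) * (real n)\<^sup>2 \<and>
           eigenpair a b c cm cp n l f f' g g' \<and> f' a = 1"
      unfolding la_def by fastforce
  qed
qed

text \<open>
  The coefficient divided by \<open>n\<^sup>2\<close> is at least \<open>1 - (1 + \<epsilon>) * \<rho>\<close>, where \<open>\<rho> < 1\<close> bounds the ratio of \<open>E\<close> to the
  effective potential on the region in question. In the outer annulus the gap condition gives such a \<open>\<rho>\<close> right
  up to the interface, in the inner one only at a distance \<open>\<delta>\<close> from it.
\<close>

lemma eigenpair_decay: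
  fixes a b c cm cp \<delta> :: real
  defines "E \<equiv> cm * exp (- 2 * b)"
  assumes cm: "cm > 0" and cp: "cp > 0" and gap: "E < cp * exp (- 2 * c)" and \<delta>: "\<delta> > 0"
  obtains \<kappa> \<epsilon> where "\<kappa> > 0" "\<epsilon> > 0"
    "\<And>n l f f' g g' t t'. eigenpair a b c cm cp n l f f' g g' \<Longrightarrow> l \<le> E * (1 + \<epsilon>) * (real n)\<^sup>2 \<Longrightarrow>
       a \<le> t \<Longrightarrow> t \<le> t' \<Longrightarrow> t' \<le> b - \<delta> \<Longrightarrow> (f t)\<^sup>2 \<le> exp (- (2 * (\<kappa> * real n) * (t' - t))) * (f t')\<^sup>2"
    "\<And>n l f f' g g' t t'. eigenpair a b c cm cp n l f f' g g' \<Longrightarrow> l \<le> E * (1 + \<epsilon>) * (real n)\<^sup>2 \<Longrightarrow>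
       b \<le> t' \<Longrightarrow> t' \<le> t \<Longrightarrow> t \<le> c \<Longrightarrow> (g t)\<^sup>2 \<le> exp (- (2 * (\<kappa> * real n) * (t - t'))) * (g t')\<^sup>2"
proof -
  define \<rho> where "\<rho> = max (exp (- 2 * \<delta>)) (E * exp (2 * c) / cp)"
  have E: "E > 0" using cm by (simp add: E_def)
  have \<rho>: "0 < \<rho>" "\<rho> < 1" "exp (- 2 * \<delta>) \<le> \<rho>" "E * exp (2 * c) / cp \<le> \<rho>"
  proof -
    have "E * exp (2 * c) < cp * exp (- 2 * c) * exp (2 * c)" using gap by simp
    also have "\<dots> = cp" by (simp add: mult.assoc flip: exp_add)
    finally have "E * exp (2 * c) / cp < 1" using cp by simp
    moreover have "exp (- 2 * \<delta>) < 1" using \<delta> by simp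
    ultimately show "\<rho> < 1" unfolding \<rho>_def by simp
    show "0 < \<rho>" unfolding \<rho>_def by (simp add: less_max_iff_disj)
  qed (simp_all add: \<rho>_def)
  \<comment> \<open>Chosen so that \<open>(1 + \<epsilon>) * \<rho>\<close> is the midpoint of \<open>\<rho>\<close> and \<open>1\<close>.\<close>
  define \<epsilon> where "\<epsilon> = (1 - \<rho>) / (2 * \<rho>)"
  define \<kappa> where "\<kappa> = sqrt ((1 - \<rho>) / 2)"
  have \<epsilon>: "\<epsilon> > 0" "(1 + \<epsilon>) * \<rho> = 1 - (1 - \<rho>) / 2" using \<rho>(1,2) by (auto simp: \<epsilon>_def field_simps)
  have \<kappa>: "\<kappa> > 0" "\<kappa>\<^sup>2 = (1 - \<rho>) / 2" using \<rho>(1,2) by (auto simp: \<kappa>_def)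
  have key: "(\<kappa> * real n)\<^sup>2 \<le> (real n)\<^sup>2 - l / d * exp (2 * t)"
    if l: "l \<le> E * (1 + \<epsilon>) * (real n)\<^sup>2" and d: "d > 0" and t: "E * exp (2 * t) / d \<le> \<rho>" for n l d t
  proof -
    have "l / d * exp (2 * t) \<le> (E * (1 + \<epsilon>) * (real n)\<^sup>2) / d * exp (2 * t)"
      using l d by (intro mult_right_mono divide_right_mono) auto
    also have "\<dots> = (1 + \<epsilon>) * (real n)\<^sup>2 * (E * exp (2 * t) / d)" by simp
    also have "\<dots> \<le> (1 + \<epsilon>) * (real n)\<^sup>2 * \<rho>" using t \<epsilon>(1) by (intro mult_left_mono) auto
    also have "\<dots> = (real n)\<^sup>2 * ((1 + \<epsilon>) * \<rho>)" by simp
    also have "\<dots> = (real n)\<^sup>2 - (\<kappa> * real n)\<^sup>2" unfolding \<epsilon>(2) power_mult_distrib \<kappa>(2) by (simp add: algebra_simps)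
    finally show ?thesis by linarith
  qed
  show ?thesis
  proof (rule that[OF \<kappa>(1) \<epsilon>(1)])
    fix n l f f' g g' t t'
    assume ep: "eigenpair a b c cm cp n l f f' g g'" and l: "l \<le> E * (1 + \<epsilon>) * (real n)\<^sup>2"
    have f: "\<And>t. (f has_real_derivative f' t) (at t)"
        "\<And>t. (f' has_real_derivative ((real n)\<^sup>2 - l / cm * exp (2 * t)) * f t) (at t)"
      and g: "\<And>t. (g has_real_derivative g' t) (at t)"
          "\<And>t. (g' has_real_derivative ((real n)\<^sup>2 - l / cp * exp (2 * t)) * g t) (at t)"
      and bc: "f a = 0" "g c = 0"
      using ep by (auto simp: eigenpair_def)
    have \<kappa>n: "\<kappa> * real n \<ge> 0" using \<kappa>(1) by simp
    { assume "a \<le> t" "t \<le> t'" "t' \<le> b - \<delta>"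
      then show "(f t)\<^sup>2 \<le> exp (- (2 * (\<kappa> * real n) * (t' - t))) * (f t')\<^sup>2"
      proof (intro ode_decay[where q = "\<lambda>t. (real n)\<^sup>2 - l / cm * exp (2 * t)" and y = f and y' = f' and a = a and b
          = "b - \<delta>"] f bc \<kappa>n)
        fix s assume "s \<in> {a..b - \<delta>}"
        then have "E * exp (2 * s) \<le> cm * exp (- 2 * b) * exp (2 * (b - \<delta>))" unfolding E_def using cm
            by (intro mult_left_mono) auto
        also have "\<dots> = cm * exp (- 2 * \<delta>)" by (simp add: mult.assoc flip: exp_add)
        finally have "E * exp (2 * s) / cm \<le> exp (- 2 * \<delta>)" using cm by (simp add: pos_divide_le_eq mult.commute)
        then show "(\<kappa> * real n)\<^sup>2 \<le> (real n)\<^sup>2 - l / cm * exp (2 * s)" using \<rho>(3) by (intro key[OF l cm]) linarith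
      qed }
    { assume "b \<le> t'" "t' \<le> t" "t \<le> c"
      then show "(g t)\<^sup>2 \<le> exp (- (2 * (\<kappa> * real n) * (t - t'))) * (g t')\<^sup>2"
      proof (intro ode_decay_backward[where q = "\<lambda>t. (real n)\<^sup>2 - l / cp * exp (2 * t)" and y = g and y' = g' and a
          = b and b = c] g bc \<kappa>n)
        fix s assume "s \<in> {b..c}"
        then have "E * exp (2 * s) / cp \<le> E * exp (2 * c) / cp" using E cp
            by (intro divide_right_mono mult_left_mono) auto
        then show "(\<kappa> * real n)\<^sup>2 \<le> (real n)\<^sup>2 - l / cp * exp (2 * s)" using \<rho>(4) by (intro key[OF l cp]) linarith
      qed }
  qed
qed

section \<open>Smooth approximation of glued functions\<close>

lemma ode_solution_smooth:
  fixes y y' q :: "real \<Rightarrow> real"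
  assumes "\<And>t. (y has_real_derivative y' t) (at t)" "\<And>t. (y' has_real_derivative q t * y t) (at t)"
    "\<And>k. C_k_on k UNIV q"
  shows "C_k_on k UNIV y \<and> C_k_on k UNIV y'"
proof (induction k)
  case 0
  show ?case using DERIV_isCont[OF assms(1)] DERIV_isCont[OF assms(2)] by (simp add: continuous_on_eq_continuous_at)
next
  case (Suc k)
  then show ?case
    using C_k_on_real_SucI[of UNIV y y' k, OF open_UNIV assms(1)]
      C_k_on_real_SucI[of UNIV y' "\<lambda>t. q t * y t" k, OF open_UNIV assms(2)]
      C_k_on_mult[OF open_UNIV assms(3), of k y] by blast
qed

lemma C_k_on_affine: "C_k_on k UNIV (\<lambda>t::real. a * t + b)"
  using C_k_on_add[OF open_UNIV C_k_on_cmult[OF open_UNIV C_k_on_inner[OF open_UNIV, of k "1::real"], of a]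
      C_k_on_const[OF open_UNIV, of k b]] by simp

text \<open>
  Ever steeper steps \<open>\<sigma> (\<kappa> * t)\<close>. Since the derivative lives on \<open>1 \<le> \<kappa> * t \<le> 2\<close>, the product
  \<open>t * s' k t\<close> stays bounded; this is what makes it harmless to multiply a function that vanishes at the
  origin by such a step. Starting the sequence of slopes late enough makes all steps equal to \<open>1\<close> beyond \<open>\<eta>\<close>.
\<close>

lemma step_sequence:
  assumes "\<eta> > 0"
  obtains s s' :: "nat \<Rightarrow> real \<Rightarrow> real" and B :: real where
    "\<And>j k. C_k_on j UNIV (s k)" "\<And>k t. (s k has_real_derivative s' k t) (at t)"
    "\<And>k t. 0 \<le> s k t" "\<And>k t. s k t \<le> 1" "\<And>k t. t \<le> 0 \<Longrightarrow> s k t = 0"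
    "\<And>k. \<exists>e>0. \<forall>t\<le>e. s k t = 0"
    "\<And>k t. t \<le> 0 \<Longrightarrow> s' k t = 0" "\<And>k t. \<bar>t * s' k t\<bar> \<le> B"
    "\<And>t. t > 0 \<Longrightarrow> \<forall>\<^sub>F k in sequentially. s k t = 1 \<and> s' k t = 0" "\<And>k t. t \<ge> \<eta> \<Longrightarrow> s k t = 1"
proof -
  obtain \<sigma> \<sigma>' :: "real \<Rightarrow> real" and B where \<sigma>:
    "\<And>k. C_k_on k UNIV \<sigma>" "\<And>t. (\<sigma> has_real_derivative \<sigma>' t) (at t)"
    "\<And>t. 0 \<le> \<sigma> t" "\<And>t. \<sigma> t \<le> 1" "\<And>t. t \<le> 1 \<Longrightarrow> \<sigma> t = 0" "\<And>t. t \<ge> 2 \<Longrightarrow> \<sigma> t = 1"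
    "\<And>t. t \<le> 1 \<or> t \<ge> 2 \<Longrightarrow> \<sigma>' t = 0" "\<And>t. \<bar>\<sigma>' t\<bar> \<le> B" using smooth_step by blast
  obtain K0 :: nat where K0: "real K0 \<ge> 2 / \<eta>" using real_arch_simple by blast
  define \<kappa> where "\<kappa> k = real (k + K0) + 1" for k
  have \<kappa>: "\<kappa> k > 0" for k by (simp add: \<kappa>_def)
  have \<kappa>\<eta>: "\<kappa> k * t \<ge> 2" if "t \<ge> \<eta>" for k t
  proof -
    have "2 / \<eta> \<le> \<kappa> k" using K0 by (simp add: \<kappa>_def)
    then have "2 \<le> \<kappa> k * \<eta>" using assms by (simp add: pos_divide_le_eq)
    also have "\<dots> \<le> \<kappa> k * t" using \<kappa>[of k] that by (intro mult_left_mono) auto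
    finally show ?thesis .
  qed
  have neg: "\<kappa> k * t \<le> 1" if "t \<le> 0" for k t using \<kappa>[of k] that mult_nonneg_nonpos[of "\<kappa> k" t] by simp
  show ?thesis
  proof (rule that[of "\<lambda>k t. \<sigma> (\<kappa> k * t)" "\<lambda>k t. \<kappa> k * \<sigma>' (\<kappa> k * t)" "2 * B"])
    show "C_k_on j UNIV (\<lambda>t. \<sigma> (\<kappa> k * t))" for j k
      using C_k_on_compose[OF open_UNIV open_UNIV \<sigma>(1) C_k_on_affine[of j "\<kappa> k" 0]] by simp
    show "((\<lambda>t. \<sigma> (\<kappa> k * t)) has_real_derivative \<kappa> k * \<sigma>' (\<kappa> k * t)) (at t)" for k t
      using DERIV_chain2[where f = \<sigma> and g = "\<lambda>t. \<kappa> k * t" and s = UNIV and x = t, OF \<sigma>(2) DERIV_cmult_Id]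
          by (simp add: mult.commute)
    show "\<exists>e>0. \<forall>t\<le>e. \<sigma> (\<kappa> k * t) = 0" for k
    proof (intro exI[of _ "1 / \<kappa> k"] conjI allI impI)
      fix t assume "t \<le> 1 / \<kappa> k"
      then have "\<kappa> k * t \<le> 1" using \<kappa>[of k] by (simp add: pos_le_divide_eq mult.commute)
      then show "\<sigma> (\<kappa> k * t) = 0" by (rule \<sigma>(5))
    qed (use \<kappa>[of k] in simp)
    show "\<bar>t * (\<kappa> k * \<sigma>' (\<kappa> k * t))\<bar> \<le> 2 * B" for k t
    proof (cases "\<kappa> k * t \<le> 1 \<or> \<kappa> k * t \<ge> 2")
      case True
      then show ?thesis using \<sigma>(7)[of "\<kappa> k * t"] order_trans[OF abs_ge_zero \<sigma>(8)] by simp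
    next
      case False
      then have "\<bar>\<kappa> k * t\<bar> * \<bar>\<sigma>' (\<kappa> k * t)\<bar> \<le> 2 * B" by (intro mult_mono \<sigma>(8)) auto
      moreover have "t * (\<kappa> k * \<sigma>' (\<kappa> k * t)) = (\<kappa> k * t) * \<sigma>' (\<kappa> k * t)" by simp
      ultimately show ?thesis by (simp only: abs_mult)
    qed
    show "\<forall>\<^sub>F k in sequentially. \<sigma> (\<kappa> k * t) = 1 \<and> \<kappa> k * \<sigma>' (\<kappa> k * t) = 0" if t: "t > 0" for t
    proof -
      obtain K1 :: nat where K1: "real K1 \<ge> 2 / t" using real_arch_simple by blast
      have "\<kappa> k * t \<ge> 2" if "k \<ge> K1" for k
      proof -
        have "2 / t \<le> \<kappa> k" using K1 that by (simp add: \<kappa>_def)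
        then show ?thesis using t by (simp add: pos_divide_le_eq)
      qed
      then show ?thesis unfolding eventually_sequentially using \<sigma>(6,7) by (intro exI[of _ K1]) auto
    qed
    show "\<sigma> (\<kappa> k * t) = 1" if "t \<ge> \<eta>" for k t using \<sigma>(6) \<kappa>\<eta>[OF that] by blast
    show "\<kappa> k * \<sigma>' (\<kappa> k * t) = 0" if "t \<le> 0" for k t using \<sigma>(7) neg[OF that] by simp
    show "\<sigma> (\<kappa> k * t) = 0" if "t \<le> 0" for k t using \<sigma>(5) neg[OF that] by blast
  qed (use \<sigma>(3,4) in auto)
qed

lemma bounded_on_Icc:
  fixes p :: "real \<Rightarrow> real"
  assumes "C_k_on 0 UNIV p" obtains M where "M \<ge> 0" "\<And>t. t \<in> {a..c} \<Longrightarrow> \<bar>p t\<bar> \<le> M"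
proof -
  have "continuous_on {a..c} p" using assms by (auto intro: continuous_on_subset)
  then obtain M where M: "\<forall>t\<in>{a..c}. \<bar>p t\<bar> \<le> M"
    using compact_imp_bounded[OF compact_continuous_image[OF _ compact_Icc, of a c p]] by (auto simp: bounded_iff)
  show ?thesis by (rule that[of "max M 0"]) (use M in \<open>auto simp: le_max_iff_disj\<close>)
qed

lemma linear_bound_from_zero:
  fixes d d' :: "real \<Rightarrow> real"
  assumes "\<And>t. t \<in> {a..c} \<Longrightarrow> (d has_real_derivative d' t) (at t)" "\<And>t. t \<in> {a..c} \<Longrightarrow> \<bar>d' t\<bar> \<le> M"
    and "d b = 0" "b \<in> {a..c}" "t \<in> {a..c}"
  shows "\<bar>d t\<bar> \<le> M * \<bar>t - b\<bar>"
proof -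
  have "norm (d t - d b) \<le> M * norm (t - b)"
    by (rule field_differentiable_bound[of "{a..c}" d d' M]) (use assms in \<open>auto intro:
        has_field_derivative_at_within\<close>)
  then show ?thesis using assms(3) by simp
qed

abbreviation glue :: "real \<Rightarrow> (real \<Rightarrow> real) \<Rightarrow> (real \<Rightarrow> real) \<Rightarrow> real \<Rightarrow> real" where
  "glue b f g \<equiv> \<lambda>t. if t \<le> b then f t else g t"

text \<open>
  The two pieces are blended as \<open>p + s k (t - b) * (q - p)\<close>. If \<open>p\<close> and \<open>q\<close> agree at \<open>b\<close>, the term containing the
  derivative of the step is bounded, because \<open>q - p\<close> vanishes linearly at \<open>b\<close>; it disappears in the limit, because for
  fixed \<open>t\<close> it is eventually zero. The step vanishes at \<open>b\<close>, so the limits hold at \<open>t = b\<close> as well, with the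
  convention that the left piece counts there.
\<close>

lemma smooth_approx_glued:
  fixes p p' q q' :: "real \<Rightarrow> real"
  assumes ab: "a < b" and bc: "b < c"
    and sm: "\<And>k. C_k_on k UNIV p" "\<And>k. C_k_on k UNIV q" "C_k_on 0 UNIV p'" "C_k_on 0 UNIV q'"
    and d: "\<And>t. (p has_real_derivative p' t) (at t)" "\<And>t. (q has_real_derivative q' t) (at t)"
  obtains P P' M where "\<And>j k. C_k_on j UNIV (P k)" "\<And>k t. (P k has_real_derivative P' k t) (at t)"
    "\<And>k t. t \<in> {a..c} \<Longrightarrow> \<bar>P k t\<bar> \<le> M" "\<And>k t. p b = q b \<Longrightarrow> t \<in> {a..c} \<Longrightarrow> \<bar>P' k t\<bar> \<le> M"
    "\<And>t. (\<lambda>k. P k t) \<longlonglongrightarrow> glue b p q t" 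
    "\<And>t. (\<lambda>k. P' k t) \<longlonglongrightarrow> glue b p' q' t"
    "\<And>k. P k a = p a" "\<And>k. P k c = q c"
proof -
  have "c - b > 0" using bc by simp
  then obtain s s' B where s:
    "\<And>j k. C_k_on j UNIV (s k)" "\<And>k t. (s k has_real_derivative s' k t) (at t)"
    "\<And>k t. 0 \<le> s k t" "\<And>k t. s k t \<le> 1" "\<And>k t. t \<le> 0 \<Longrightarrow> s k t = 0"
    "\<And>k. \<exists>e>0. \<forall>t\<le>e. s k t = 0"
    "\<And>k t. t \<le> 0 \<Longrightarrow> s' k t = 0" "\<And>k t. \<bar>t * s' k t\<bar> \<le> B"
    "\<And>t. t > 0 \<Longrightarrow> \<forall>\<^sub>F k in sequentially. s k t = 1 \<and> s' k t = 0" "\<And>k t. t \<ge> c - b \<Longrightarrow> s k t = 1"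
    by (rule step_sequence) blast
  obtain M1 where M1: "M1 \<ge> 0" "\<And>t. t \<in> {a..c} \<Longrightarrow> \<bar>p t\<bar> \<le> M1" using bounded_on_Icc[OF sm(1)] by blast
  obtain M2 where M2: "M2 \<ge> 0" "\<And>t. t \<in> {a..c} \<Longrightarrow> \<bar>q t\<bar> \<le> M2" using bounded_on_Icc[OF sm(2)] by blast
  obtain M3 where M3: "M3 \<ge> 0" "\<And>t. t \<in> {a..c} \<Longrightarrow> \<bar>p' t\<bar> \<le> M3" using bounded_on_Icc[OF sm(3)] by blast
  obtain M4 where M4: "M4 \<ge> 0" "\<And>t. t \<in> {a..c} \<Longrightarrow> \<bar>q' t\<bar> \<le> M4" using bounded_on_Icc[OF sm(4)] by blast
  have B0: "B \<ge> 0" using s(8) abs_ge_zero order_trans by blast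
  define P where "P k t = p t + s k (t - b) * (q t - p t)" for k t
  define P' where "P' k t = p' t + (s' k (t - b) * (q t - p t) + s k (t - b) * (q' t - p' t))" for k t
  have sd: "((\<lambda>t. s k (t - b)) has_real_derivative s' k (t - b)) (at t)" for k t
    using s(2)[of k "t + - b"] unfolding DERIV_shift by simp
  have ss: "C_k_on j UNIV (\<lambda>t. s k (t - b))" for j k
    using C_k_on_compose[OF open_UNIV open_UNIV s(1) C_k_on_affine[of j 1 "- b"]] by simp
  have lin: "\<bar>q t - p t\<bar> \<le> (M4 + M3) * \<bar>t - b\<bar>" if eq: "p b = q b" and t: "t \<in> {a..c}" for t
  proof (rule linear_bound_from_zero[where d = "\<lambda>t. q t - p t" and d' = "\<lambda>t. q' t - p' t" and a = a and c = c])
    show "((\<lambda>t. q t - p t) has_real_derivative q' r - p' r) (at r)" for r by (rule DERIV_diff[OF d(2,1)])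
    show "\<bar>q' r - p' r\<bar> \<le> M4 + M3" if "r \<in> {a..c}" for r using M3(2)[OF that] M4(2)[OF that] by linarith
  qed (use eq t ab bc in auto)
  show ?thesis
  proof (rule that[of P P' "max (M1 + (M2 + M1)) (M3 + (B * (M4 + M3) + (M4 + M3)))"])
    show "C_k_on j UNIV (P k)" for j k unfolding P_def
      by (intro C_k_on_add C_k_on_mult C_k_on_diff open_UNIV ss sm(1,2))
    show "(P k has_real_derivative P' k t) (at t)" for k t unfolding P_def P'_def
      using DERIV_add[OF d(1) DERIV_mult[OF sd DERIV_diff[OF d(2,1)]]] by (simp add: add.commute mult.commute)
    show "\<bar>P k t\<bar> \<le> max (M1 + (M2 + M1)) (M3 + (B * (M4 + M3) + (M4 + M3)))" if t: "t \<in> {a..c}" for k t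
    proof -
      have "\<bar>s k (t - b) * (q t - p t)\<bar> \<le> 1 * (M2 + M1)"
        unfolding abs_mult
      proof (rule mult_mono)
        show "\<bar>q t - p t\<bar> \<le> M2 + M1" using M1(2)[OF t] M2(2)[OF t] by linarith
      qed (use s(3,4) in auto)
      then have "\<bar>P k t\<bar> \<le> M1 + (M2 + M1)" unfolding P_def
        using M1(2)[OF t] abs_triangle_ineq[of "p t" "s k (t - b) * (q t - p t)"] by simp
      then show ?thesis by (rule max.coboundedI1)
    qed
    show "\<bar>P' k t\<bar> \<le> max (M1 + (M2 + M1)) (M3 + (B * (M4 + M3) + (M4 + M3)))"
        if eq: "p b = q b" and t: "t \<in> {a..c}" for k t
    proof -
      have "\<bar>s k (t - b) * (q' t - p' t)\<bar> \<le> 1 * (M4 + M3)"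
        unfolding abs_mult
      proof (rule mult_mono)
        show "\<bar>q' t - p' t\<bar> \<le> M4 + M3" using M3(2)[OF t] M4(2)[OF t] by linarith
      qed (use s(3,4) in auto)
      note m = this
      have m': "\<bar>s' k (t - b) * (q t - p t)\<bar> \<le> B * (M4 + M3)"
      proof -
        have "\<bar>s' k (t - b)\<bar> * \<bar>q t - p t\<bar> \<le> \<bar>s' k (t - b)\<bar> * ((M4 + M3) * \<bar>t - b\<bar>)"
          using lin[OF eq t] by (rule mult_left_mono) simp
        also have "\<dots> = \<bar>(t - b) * s' k (t - b)\<bar> * (M4 + M3)" by (simp add: abs_mult)
        also have "\<dots> \<le> B * (M4 + M3)" using s(8) M3(1) M4(1) by (intro mult_right_mono) auto
        finally show ?thesis by (simp add: abs_mult)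
      qed
      then have "\<bar>P' k t\<bar> \<le> M3 + (B * (M4 + M3) + (M4 + M3))" 
      proof -
        have tri: "\<bar>x + (y + z)\<bar> \<le> X + (Y + Z)" if "\<bar>z\<bar> \<le> Z" "\<bar>y\<bar> \<le> Y" "\<bar>x\<bar> \<le> X" for x y z X Y Z :: real
          using that by linarith
        show ?thesis unfolding P'_def using tri[OF m m' M3(2)[OF t]] by simp
      qed
      then show ?thesis by (rule max.coboundedI2)
    qed
    have lim: "(\<lambda>k. P k t) \<longlonglongrightarrow> glue b p q t" 
      and lim': "(\<lambda>k. P' k t) \<longlonglongrightarrow> glue b p' q' t" for t
    proof -
      have "\<forall>\<^sub>F k in sequentially. P k t = glue b p q t \<and> P' k t = glue b p' q' t"
      proof (cases "t \<le> b")
        case True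
        then show ?thesis using s(5,7) by (simp add: P_def P'_def)
      next
        case False
        then have "\<forall>\<^sub>F k in sequentially. s k (t - b) = 1 \<and> s' k (t - b) = 0" by (intro s(9)) simp
        then show ?thesis by eventually_elim (use False in \<open>simp add: P_def P'_def\<close>)
      qed
      then show "(\<lambda>k. P k t) \<longlonglongrightarrow> glue b p q t" "(\<lambda>k. P' k t) \<longlonglongrightarrow> glue b p' q' t"
        by (auto intro!: tendsto_eventually elim: eventually_mono)
    qed
    show "(\<lambda>k. P k t) \<longlonglongrightarrow> glue b p q t" for t by (rule lim)
    show "(\<lambda>k. P' k t) \<longlonglongrightarrow> glue b p' q' t" for t by (rule lim')
    show "P k a = p a" "P k c = q c" for k using s(5)[of "a - b" k] s(10)[of "c - b" k] ab by (simp_all add: P_def)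
  qed
qed

text \<open>
  Multiplication by two further steps gives compact support inside \<open>{a<..<c}\<close>. The derivatives stay bounded
  because the functions vanish at \<open>a\<close> and \<open>c\<close> at a uniform linear rate.
\<close>

lemma smooth_cutoff_approx:
  fixes P P' :: "nat \<Rightarrow> real \<Rightarrow> real"
  assumes ac: "a < c"
    and sm: "\<And>j k. C_k_on j UNIV (P k)" and d: "\<And>k t. (P k has_real_derivative P' k t) (at t)"
    and M: "\<And>k t. t \<in> {a..c} \<Longrightarrow> \<bar>P k t\<bar> \<le> M" "\<And>k t. t \<in> {a..c} \<Longrightarrow> \<bar>P' k t\<bar> \<le> M"
    and lim: "\<And>t. (\<lambda>k. P k t) \<longlonglongrightarrow> F t" "\<And>t. (\<lambda>k. P' k t) \<longlonglongrightarrow> F' t"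
    and z: "\<And>k. P k a = 0" "\<And>k. P k c = 0"
  obtains Q Q' N where "\<And>j k. C_k_on j UNIV (Q k)" "\<And>k t. (Q k has_real_derivative Q' k t) (at t)"
    "\<And>k t. t \<in> {a..c} \<Longrightarrow> \<bar>Q k t\<bar> \<le> N" "\<And>k t. t \<in> {a..c} \<Longrightarrow> \<bar>Q' k t\<bar> \<le> N"
    "\<And>t. t \<in> {a<..<c} \<Longrightarrow> (\<lambda>k. Q k t) \<longlonglongrightarrow> F t" 
    "\<And>t. t \<in> {a<..<c} \<Longrightarrow> (\<lambda>k. Q' k t) \<longlonglongrightarrow> F' t"
    "\<And>k. \<exists>e>0. \<forall>t. t \<le> a + e \<or> t \<ge> c - e \<longrightarrow> Q k t = 0"
proof -
  have "(1::real) > 0" by simp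
  then obtain s s' B where s:
    "\<And>j k. C_k_on j UNIV (s k)" "\<And>k t. (s k has_real_derivative s' k t) (at t)"
    "\<And>k t. 0 \<le> s k t" "\<And>k t. s k t \<le> 1" "\<And>k t. t \<le> 0 \<Longrightarrow> s k t = 0"
    "\<And>k. \<exists>e>0. \<forall>t\<le>e. s k t = 0"
    "\<And>k t. t \<le> 0 \<Longrightarrow> s' k t = 0" "\<And>k t. \<bar>t * s' k t\<bar> \<le> B"
    "\<And>t. t > 0 \<Longrightarrow> \<forall>\<^sub>F k in sequentially. s k t = 1 \<and> s' k t = 0" "\<And>k t. t \<ge> 1 \<Longrightarrow> s k t = 1"
    by (rule step_sequence) blast
  have M0: "M \<ge> 0" using M(1)[of a 0] ac by simp
  have B0: "B \<ge> 0" using s(8) abs_ge_zero order_trans by blast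
  define Q where "Q k t = P k t * (s k (t - a) * s k (c - t))" for k t
  define Q' where "Q' k t = P' k t * (s k (t - a) * s k (c - t))
      + P k t * (s' k (t - a) * s k (c - t) - s k (t - a) * s' k (c - t))" for k t
  have sd: "((\<lambda>t. s k (t - a)) has_real_derivative s' k (t - a)) (at t)" for k t
    using s(2)[of k "t + - a"] unfolding DERIV_shift by simp
  have sd2: "((\<lambda>t. s k (c - t)) has_real_derivative - s' k (c - t)) (at t)" for k t
  proof -
    have "((\<lambda>t. c - t) has_real_derivative - 1) (at t)" by (auto intro!: derivative_eq_intros)
    from DERIV_chain2[where f = "s k" and g = "\<lambda>t. c - t", OF s(2) this] show ?thesis by simp
  qed
  have ss: "C_k_on j UNIV (\<lambda>t. s k (t - a))" "C_k_on j UNIV (\<lambda>t. s k (c - t))" for j k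
    using C_k_on_compose[OF open_UNIV open_UNIV s(1) C_k_on_affine[of j 1 "- a"]]
      C_k_on_compose[OF open_UNIV open_UNIV s(1) C_k_on_affine[of j "-1" c]] by simp_all
  have near: "\<bar>P k t\<bar> \<le> M * \<bar>t - a\<bar>" "\<bar>P k t\<bar> \<le> M * \<bar>c - t\<bar>" if t: "t \<in> {a..c}" for k t
    using linear_bound_from_zero[of a c "P k" "P' k" M a t, OF d M(2) z(1)]
      linear_bound_from_zero[of a c "P k" "P' k" M c t, OF d M(2) z(2)] t ac by (auto simp: abs_minus_commute)
  have ev: "\<forall>\<^sub>F k in sequentially. s k (t - a) = 1 \<and> s' k (t - a) = 0 \<and> s k (c - t) = 1 \<and> s' k (c - t) = 0"
    if "t \<in> {a<..<c}" for t
    using eventually_conj[OF s(9)[of "t - a"] s(9)[of "c - t"]] that by auto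
  show ?thesis
  proof (rule that[of Q Q' "M + (B * M + B * M)"])
    show "C_k_on j UNIV (Q k)" for j k unfolding Q_def
      by (intro C_k_on_mult open_UNIV ss sm)
    show "(Q k has_real_derivative Q' k t) (at t)" for k t unfolding Q_def Q'_def
      using DERIV_mult[OF d[of k t] DERIV_mult[OF sd[of k t] sd2[of k t]]] by (simp add: algebra_simps)
    fix k t assume t: "t \<in> {a..c}"
    have ss1: "\<bar>s k (t - a) * s k (c - t)\<bar> \<le> 1"
      unfolding abs_mult using s(3,4) by (simp add: mult_le_one)
    have le: "\<bar>p * r\<bar> \<le> m" if "\<bar>p\<bar> \<le> m" "\<bar>r\<bar> \<le> 1" "m \<ge> 0" for p r m :: real
      using mult_mono[OF that(1,2)] that(3) by (simp add: abs_mult)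
    have "\<bar>Q k t\<bar> \<le> M" unfolding Q_def by (rule le[OF M(1)[OF t] ss1 M0])
    then show "\<bar>Q k t\<bar> \<le> M + (B * M + B * M)" using M0 B0 by (simp add: add_increasing2)
    have edge: "\<bar>P k t * s' k r\<bar> \<le> B * M" if "\<bar>P k t\<bar> \<le> M * \<bar>r\<bar>" for r
    proof -
      have "\<bar>P k t\<bar> * \<bar>s' k r\<bar> \<le> M * \<bar>r\<bar> * \<bar>s' k r\<bar>" using that by (rule mult_right_mono) simp
      also have "\<dots> = \<bar>r * s' k r\<bar> * M" by (simp add: abs_mult)
      also have "\<dots> \<le> B * M" using s(8) M0 by (intro mult_right_mono)
      finally show ?thesis by (simp add: abs_mult)
    qed
    have BM: "B * M \<ge> 0" using B0 M0 by simp
    have "\<bar>(P k t * s' k (t - a)) * s k (c - t)\<bar> \<le> B * M"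
      using le[OF edge[OF near(1)[OF t]] _ BM, of "s k (c - t)"] s(3,4) by simp
    moreover have "\<bar>(P k t * s' k (c - t)) * s k (t - a)\<bar> \<le> B * M"
      using le[OF edge[OF near(2)[OF t]] _ BM, of "s k (t - a)"] s(3,4) by simp
    moreover have "\<bar>P' k t * (s k (t - a) * s k (c - t))\<bar> \<le> M" by (rule le[OF M(2)[OF t] ss1 M0])
    moreover have "Q' k t = P' k t * (s k (t - a) * s k (c - t))
        + ((P k t * s' k (t - a)) * s k (c - t) - (P k t * s' k (c - t)) * s k (t - a))"
      by (simp add: Q'_def algebra_simps)
    ultimately show "\<bar>Q' k t\<bar> \<le> M + (B * M + B * M)" by linarith
  next
    fix t assume t: "t \<in> {a<..<c}"
    have "\<forall>\<^sub>F k in sequentially. P k t = Q k t" using ev[OF t] by eventually_elim (simp add: Q_def)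
    then show "(\<lambda>k. Q k t) \<longlonglongrightarrow> F t" by (rule Lim_transform_eventually[OF lim(1), rotated])
    have "\<forall>\<^sub>F k in sequentially. P' k t = Q' k t" using ev[OF t] by eventually_elim (simp add: Q'_def)
    then show "(\<lambda>k. Q' k t) \<longlonglongrightarrow> F' t" by (rule Lim_transform_eventually[OF lim(2), rotated])
  next
    fix k
    obtain e where "e > 0" "\<forall>t\<le>e. s k t = 0" using s(6) by blast
    then show "\<exists>e>0. \<forall>t. t \<le> a + e \<or> t \<ge> c - e \<longrightarrow> Q k t = 0"
      by (intro exI[of _ e]) (auto simp: Q_def)
  qed
qed

section \<open>Angular modes and fields in polar form\<close>

text \<open>
  This is \<open>cos (n * \<theta>)\<close> for \<open>x \<noteq> 0\<close>, where \<open>\<theta>\<close> is the polar angle. The complex power avoids a choice of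
  the angle.
\<close>

definition cos_mode :: "nat \<Rightarrow> real^2 \<Rightarrow> real" where
  "cos_mode n x = Re (sgn (Complex (x $ 1) (x $ 2)) ^ n)"

definition sin_mode :: "nat \<Rightarrow> real^2 \<Rightarrow> real" where
  "sin_mode n x = Im (sgn (Complex (x $ 1) (x $ 2)) ^ n)"

definition perp :: "real^2 \<Rightarrow> real^2" where "perp x = vector [- (x $ 2), x $ 1]"

lemma inner_real2: "(x::real^2) \<bullet> y = x $ 1 * y $ 1 + x $ 2 * y $ 2"
  by (simp add: inner_vec_def sum_2)

lemma norm_real2: "(norm (x::real^2))\<^sup>2 = (x $ 1)\<^sup>2 + (x $ 2)\<^sup>2"
  unfolding power2_norm_eq_inner inner_real2 by (simp add: power2_eq_square)

lemma inner_perp: "perp x \<bullet> h = x $ 1 * h $ 2 - x $ 2 * h $ 1"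
  by (simp add: inner_real2 perp_def vector_2)

lemma cmod_Complex_real2: "cmod (Complex (x $ 1) (x $ 2)) = norm (x::real^2)"
  unfolding cmod_def complex.sel norm_real2[symmetric] by simp

lemma mode_Suc:
  "cos_mode (Suc n) x = x $ 1 / norm x * cos_mode n x - x $ 2 / norm x * sin_mode n x"
  "sin_mode (Suc n) x = x $ 1 / norm x * sin_mode n x + x $ 2 / norm x * cos_mode n x"
proof -
  have "sgn (Complex (x $ 1) (x $ 2)) = Complex (x $ 1 / norm x) (x $ 2 / norm x)"
    by (simp add: sgn_eq cmod_Complex_real2 complex_eq_iff)
  then show "cos_mode (Suc n) x = x $ 1 / norm x * cos_mode n x - x $ 2 / norm x * sin_mode n x"
    "sin_mode (Suc n) x = x $ 1 / norm x * sin_mode n x + x $ 2 / norm x * cos_mode n x"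
    by (simp_all add: cos_mode_def sin_mode_def)
qed

lemma mode_0: "cos_mode 0 x = 1" "sin_mode 0 x = 0"
  by (auto simp: cos_mode_def sin_mode_def)

lemma mode_squares:
  assumes "x \<noteq> 0" shows "(cos_mode n x)\<^sup>2 + (sin_mode n x)\<^sup>2 = 1"
proof -
  have "cmod (sgn (Complex (x $ 1) (x $ 2))) = 1"
    using assms by (simp add: norm_sgn flip: norm_eq_zero[of x] cmod_Complex_real2)
  then show ?thesis
    unfolding cos_mode_def sin_mode_def cmod_power2[symmetric] by (simp add: norm_power)
qed

lemma mode_le_1: "\<bar>cos_mode n x\<bar> \<le> 1" "\<bar>sin_mode n x\<bar> \<le> 1"
proof -
  have "cmod (sgn (Complex (x $ 1) (x $ 2)) ^ n) \<le> 1" by (simp add: norm_power power_le_one norm_sgn)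
  then show "\<bar>cos_mode n x\<bar> \<le> 1" "\<bar>sin_mode n x\<bar> \<le> 1"
    unfolding cos_mode_def sin_mode_def using abs_Re_le_cmod abs_Im_le_cmod order_trans by blast+
qed

lemma direction_has_derivative:
  fixes x :: "real^2"
  assumes "x \<noteq> 0"
  shows "((\<lambda>x. x $ 1 / norm x) has_derivative (\<lambda>h. - (x $ 2 / norm x) * (perp x \<bullet> h) / (norm x)\<^sup>2)) (at x)"
    and "((\<lambda>x. x $ 2 / norm x) has_derivative (\<lambda>h. x $ 1 / norm x * (perp x \<bullet> h) / (norm x)\<^sup>2)) (at x)"
proof -
  define r where "r = norm x"
  have r: "r > 0" "r\<^sup>2 = (x $ 1)\<^sup>2 + (x $ 2)\<^sup>2" using assms norm_real2 by (auto simp: r_def)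
  have "((\<lambda>x. x $ i / norm x) has_derivative (\<lambda>h. h $ i / r - x $ i * (x \<bullet> h) / r ^ 3)) (at x)" for i
    using assms unfolding r_def
    by (auto intro!: derivative_eq_intros has_derivative_norm bounded_linear.has_derivative[OF bounded_linear_vec_nth]
        
        simp: sgn_div_norm divide_simps inner_commute power3_eq_cube)
  moreover have "h $ 1 / r - x $ 1 * (x \<bullet> h) / r ^ 3 = - (x $ 2 / r) * (perp x \<bullet> h) / r\<^sup>2" for h
  proof -
    have "h $ 1 / r - x $ 1 * (x \<bullet> h) / r ^ 3 = (h $ 1 * r\<^sup>2 - x $ 1 * (x \<bullet> h)) / r ^ 3"
      using r(1) by (simp add: field_simps power2_eq_square power3_eq_cube)
    also have "\<dots> = - (x $ 2 / r) * (perp x \<bullet> h) / r\<^sup>2"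
    proof -
      have "h $ 1 * r\<^sup>2 - x $ 1 * (x \<bullet> h) = - x $ 2 * (perp x \<bullet> h)"
        unfolding r(2) inner_perp unfolding inner_real2 by (simp add: power2_eq_square algebra_simps)
      then show ?thesis by (simp add: power2_eq_square power3_eq_cube)
    qed
    finally show ?thesis .
  qed
  moreover have "h $ 2 / r - x $ 2 * (x \<bullet> h) / r ^ 3 = x $ 1 / r * (perp x \<bullet> h) / r\<^sup>2" for h
  proof -
    have "h $ 2 / r - x $ 2 * (x \<bullet> h) / r ^ 3 = (h $ 2 * r\<^sup>2 - x $ 2 * (x \<bullet> h)) / r ^ 3"
      using r(1) by (simp add: field_simps power2_eq_square power3_eq_cube)
    also have "\<dots> = x $ 1 / r * (perp x \<bullet> h) / r\<^sup>2"
    proof -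
      have "h $ 2 * r\<^sup>2 - x $ 2 * (x \<bullet> h) = x $ 1 * (perp x \<bullet> h)"
        unfolding r(2) inner_perp unfolding inner_real2 by (simp add: power2_eq_square algebra_simps)
      then show ?thesis by (simp add: power2_eq_square power3_eq_cube)
    qed
    finally show ?thesis .
  qed
  ultimately show "((\<lambda>x. x $ 1 / norm x) has_derivative (\<lambda>h. - (x $ 2 / norm x) * (perp x \<bullet> h) / (norm x)\<^sup>2)) (at x)"
    "((\<lambda>x. x $ 2 / norm x) has_derivative (\<lambda>h. x $ 1 / norm x * (perp x \<bullet> h) / (norm x)\<^sup>2)) (at x)"
    unfolding r_def[symmetric] by (metis (no_types, lifting) ext)+
qed

text \<open>
  The modes depend on the angle only, so their gradients are multiples of \<open>perp x\<close>.
\<close>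

lemma mode_has_derivative:
  fixes x :: "real^2"
  assumes "x \<noteq> 0"
  shows "(cos_mode n has_derivative (\<lambda>h. - real n * sin_mode n x * (perp x \<bullet> h) / (norm x)\<^sup>2)) (at x)"
    and "(sin_mode n has_derivative (\<lambda>h. real n * cos_mode n x * (perp x \<bullet> h) / (norm x)\<^sup>2)) (at x)"
proof (induction n)
  case 0
  { case 1 show ?case by (simp add: mode_0[abs_def] mode_0) }
  { case 2 show ?case by (simp add: mode_0[abs_def] mode_0) }
next
  case (Suc n)
  note d = direction_has_derivative[OF assms] Suc
  { case 1 show ?case unfolding mode_Suc[abs_def]
      by (rule derivative_eq_intros d refl)+
         (use assms in \<open>auto simp: fun_eq_iff field_simps power2_eq_square\<close>) }
  { case 2 show ?case unfolding mode_Suc[abs_def]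
      by (rule derivative_eq_intros d refl)+
         (use assms in \<open>auto simp: fun_eq_iff field_simps power2_eq_square\<close>) }
qed

lemma C_k_on_mode: "C_k_on k (- {0}) (cos_mode n)" "C_k_on k (- {0}) (sin_mode n)"
proof (induction n)
  case 0
  { case 1 show ?case by (simp add: mode_0[abs_def]) (rule C_k_on_const, auto) }
  { case 2 show ?case by (simp add: mode_0[abs_def]) (rule C_k_on_const, auto) }
next
  case (Suc n)
  have dir: "C_k_on k (- {0}) (\<lambda>x::real^2. x $ i / norm x)" for i
  proof (rule C_k_on_cong)
    show "C_k_on k (- {0}) (\<lambda>x::real^2. (x \<bullet> axis i 1) * exp (- ln (norm x)))"
      by (intro C_k_on_mult C_k_on_inner C_k_on_compose[OF _ _ C_k_on_exp] C_k_on_minus C_k_on_ln_norm) auto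
  qed (auto simp: inner_axis exp_minus divide_inverse)
  { case 1 show ?case unfolding mode_Suc[abs_def] by (intro C_k_on_diff C_k_on_mult dir Suc) auto }
  { case 2 show ?case unfolding mode_Suc[abs_def] by (intro C_k_on_add C_k_on_mult dir Suc) auto }
qed

definition polar_mode :: "nat \<Rightarrow> (real \<Rightarrow> real) \<Rightarrow> real^2 \<Rightarrow> real" where
  "polar_mode n h x = h (ln (norm x)) * cos_mode n x"

text \<open>
  A vector field with radial part \<open>A * cos (n * \<theta>)\<close> times \<open>x\<close> and tangential part \<open>D\<close> weighted so that a gradient
  has this form: the gradient of \<open>polar_mode n h\<close> corresponds to \<open>A = h' * exp (- 2 * t)\<close> and
  \<open>D = h * exp (- 2 * t)\<close>.
\<close>

definition polar_field :: "nat \<Rightarrow> (real \<Rightarrow> real) \<Rightarrow> (real \<Rightarrow> real) \<Rightarrow> real^2 \<Rightarrow> real^2" where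
  "polar_field n A D x = (A (ln (norm x)) * cos_mode n x) *\<^sub>R x - (real n * D (ln (norm x)) * sin_mode n x) *\<^sub>R perp
      x"

lemma exp_ln_norm: "x \<noteq> 0 \<Longrightarrow> exp (- 2 * ln (norm x)) = 1 / (norm x)\<^sup>2"
  by (simp add: exp_minus exp_double inverse_eq_divide)

lemma radial_has_derivative:
  fixes x :: "'a::euclidean_space"
  assumes "x \<noteq> 0" "\<And>t. (h has_real_derivative h' t) (at t)"
  shows "((\<lambda>x. h (ln (norm x))) has_derivative (\<lambda>v. h' (ln (norm x)) * ((x \<bullet> v) / (norm x)\<^sup>2))) (at x)"
  by (rule has_derivative_compose[OF ln_norm_has_derivative[OF assms(1)] assms(2)[unfolded has_field_derivative_def]])

lemma polar_mode_has_derivative: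
  assumes "x \<noteq> 0" "\<And>t. (h has_real_derivative h' t) (at t)"
  shows "(polar_mode n h has_derivative
    (\<lambda>v. polar_field n (\<lambda>t. h' t * exp (- 2 * t)) (\<lambda>t. h t * exp (- 2 * t)) x \<bullet> v)) (at x)"
proof -
  have "((\<lambda>x. h (ln (norm x)) * cos_mode n x) has_derivative
     (\<lambda>v. h (ln (norm x)) * (- real n * sin_mode n x * (perp x \<bullet> v) / (norm x)\<^sup>2)
        + h' (ln (norm x)) * ((x \<bullet> v) / (norm x)\<^sup>2) * cos_mode n x)) (at x)"
    by (rule has_derivative_mult[OF radial_has_derivative[OF assms] mode_has_derivative(1)[OF assms(1)]])
  moreover have "h (ln (norm x)) * (- real n * sin_mode n x * (perp x \<bullet> v) / (norm x)\<^sup>2)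
        + h' (ln (norm x)) * ((x \<bullet> v) / (norm x)\<^sup>2) * cos_mode n x
      = polar_field n (\<lambda>t. h' t * exp (- 2 * t)) (\<lambda>t. h t * exp (- 2 * t)) x \<bullet> v" for v
    unfolding polar_field_def exp_ln_norm[OF assms(1)]
    by (simp add: inner_diff_left divide_inverse algebra_simps)
  ultimately show ?thesis by (simp add: polar_mode_def[abs_def])
qed

lemma C_k_on_radial: "C_k_on k UNIV h \<Longrightarrow> C_k_on k (- {0}) (\<lambda>x. h (ln (norm x)))"
  by (rule C_k_on_compose[OF open_UNIV _ _ C_k_on_ln_norm]) auto

lemma C_k_on_polar_mode: "C_k_on k UNIV h \<Longrightarrow> C_k_on k (- {0}) (polar_mode n h)"
  unfolding polar_mode_def[abs_def] by (rule C_k_on_mult[OF _ C_k_on_radial C_k_on_mode(1)]) auto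

lemma inner_polar_field:
  "polar_field n A D x \<bullet> b = A (ln (norm x)) * cos_mode n x * (x \<bullet> b) - real n * D (ln (norm x)) * sin_mode n x *
      (perp x \<bullet> b)"
  by (simp add: polar_field_def inner_diff_left)

lemma C_k_on_polar_field:
  assumes "C_k_on k UNIV A" "C_k_on k UNIV D"
  shows "C_k_on k (- {0}) (\<lambda>x. polar_field n A D x \<bullet> b)"
proof -
  have o: "open (- {0::real^2})" by auto
  have "C_k_on k (- {0}) (\<lambda>x::real^2. x \<bullet> vector [b $ 2, - b $ 1])" by (rule C_k_on_inner[OF o])
  moreover have "(\<lambda>x::real^2. x \<bullet> vector [b $ 2, - b $ 1]) = (\<lambda>x. perp x \<bullet> b)"
    unfolding inner_perp by (simp add: inner_real2 fun_eq_iff)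
  ultimately have p: "C_k_on k (- {0}) (\<lambda>x. perp x \<bullet> b)" by simp
  show ?thesis unfolding inner_polar_field
    by (rule C_k_on_diff[OF o C_k_on_mult[OF o C_k_on_mult[OF o C_k_on_radial[OF assms(1)] C_k_on_mode(1)]
        C_k_on_inner[OF o]]
        C_k_on_mult[OF o C_k_on_mult[OF o C_k_on_cmult[OF o C_k_on_radial[OF assms(2)]] C_k_on_mode(2)] p]])
qed

section \<open>Fields on annuli\<close>

lemma open_open_annulus: "open (open_annulus a b)"
proof -
  have "open_annulus a b = norm -` {a<..<b}" by (auto simp: open_annulus_def)
  then show ?thesis using open_vimage[of "{a<..<b}" norm] by (simp add: continuous_on_norm_id)
qed

lemma closed_closed_annulus: "closed (closed_annulus a b)"
proof -
  have "closed_annulus a b = norm -` {a..b}" by (auto simp: closed_annulus_def)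
  then show ?thesis using closed_vimage[of "{a..b}" norm] by (simp add: continuous_on_norm_id)
qed

lemma bounded_closed_annulus: "bounded (closed_annulus a b)"
  by (rule bounded_subset[of "cball 0 b"]) (auto simp: closed_annulus_def)

lemma open_subset_closed_annulus: "open_annulus a b \<subseteq> closed_annulus a b"
  by (auto simp: open_annulus_def closed_annulus_def)

lemma bounded_open_annulus: "bounded (open_annulus a b)"
  using bounded_closed_annulus open_subset_closed_annulus by (rule bounded_subset)

lemma lmeasurable_open_annulus: "open_annulus a b \<in> lmeasurable"
  using bounded_open_annulus open_open_annulus by (simp add: bounded_set_imp_lmeasurable)

lemma lmeasurable_closed_annulus: "closed_annulus a b \<in> lmeasurable"
  using bounded_closed_annulus closed_closed_annulus by (simp add: bounded_set_imp_lmeasurable)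

lemma closure_open_annulus: "closure (open_annulus a b) \<subseteq> closed_annulus a b"
  using open_subset_closed_annulus closed_closed_annulus by (rule closure_minimal)

lemma closed_annulus_nonzero: "0 < a \<Longrightarrow> closed_annulus a b \<subseteq> - {0}"
  by (auto simp: closed_annulus_def)

lemma closure_open_annulus_nonzero: "0 < a \<Longrightarrow> closure (open_annulus a b) \<subseteq> - {0}"
  using closure_open_annulus closed_annulus_nonzero by blast

lemma interior_closed_annulus:
  assumes "0 < a" shows "interior (closed_annulus a b) = open_annulus a b"
proof
  show "open_annulus a b \<subseteq> interior (closed_annulus a b)"
    by (rule interior_maximal[OF open_subset_closed_annulus open_open_annulus])
  show "interior (closed_annulus a b) \<subseteq> open_annulus a b"
  proof
    fix x assume "x \<in> interior (closed_annulus a b)"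
    then obtain e where e: "e > 0" "cball x e \<subseteq> closed_annulus a b" by (auto simp: mem_interior_cball)
    have "x \<in> closed_annulus a b" using e by (meson centre_in_cball in_mono less_imp_le)
    then have x0: "norm x > 0" using assms by (auto simp: closed_annulus_def)
    have n: "norm (x + d *\<^sub>R sgn x) = \<bar>norm x + d\<bar>" for d
    proof -
      have "x + d *\<^sub>R sgn x = ((norm x + d) / norm x) *\<^sub>R x"
        using x0 by (simp add: sgn_div_norm distrib_right scaleR_left_distrib divide_inverse)
      then show ?thesis using x0 by (simp add: abs_divide)
    qed
    have m: "x + d *\<^sub>R sgn x \<in> closed_annulus a b" if "\<bar>d\<bar> \<le> e" for d
    proof -
      have "dist x (x + d *\<^sub>R sgn x) \<le> e" using that x0 by (simp add: dist_norm norm_sgn)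
      then show ?thesis using e(2) by auto
    qed
    have "norm x + e \<le> b" using m[of e] n[of e] e(1) x0 by (simp add: closed_annulus_def)
    moreover define d where "d = min e (norm x / 2)"
    have "d \<le> norm x / 2" by (simp add: d_def)
    then have "d < norm x" using x0 by linarith
    then have d: "d > 0" "d \<le> e" "d < norm x" using e(1) x0 by (auto simp: d_def)
    then have "a \<le> norm x - d" using m[of "- d"] n[of "- d"] by (simp add: closed_annulus_def)
    then have "a < norm x" using d(1) by linarith
    ultimately show "x \<in> open_annulus a b" using e(1) by (simp add: open_annulus_def)
  qed
qed

lemma open_annulus_ln:
  assumes "0 < a" "x \<in> open_annulus a b"
  shows "ln (norm x) \<in> {ln a<..<ln b}" "x \<noteq> 0" "norm x \<le> b"
proof -
  have "0 < norm x" "a < norm x" "norm x < b" using assms by (auto simp: open_annulus_def)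
  then show "ln (norm x) \<in> {ln a<..<ln b}" "x \<noteq> 0" "norm x \<le> b" using assms(1)
      by (simp_all del: zero_less_norm_iff, auto)
qed

lemma closed_annulus_ln:
  assumes "0 < a" "x \<in> closed_annulus a b"
  shows "ln (norm x) \<in> {ln a..ln b}" "x \<noteq> 0" "norm x \<le> b"
proof -
  have "0 < norm x" "a \<le> norm x" "norm x \<le> b" using assms by (auto simp: closed_annulus_def)
  then show "ln (norm x) \<in> {ln a..ln b}" "x \<noteq> 0" "norm x \<le> b" using assms(1)
      by (simp_all del: zero_less_norm_iff, auto)
qed

lemma L2_fun_open_annulus:
  fixes f :: "real^2 \<Rightarrow> real"
  assumes "0 < a" "continuous_on (- {0}) f"
  shows "L2_fun (lebesgue_on (open_annulus a b)) f"
proof -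
  have "continuous_on (closed_annulus a b) f"
    using assms closed_annulus_nonzero by (blast intro: continuous_on_subset)
  moreover have "compact (closed_annulus a b)"
    using closed_closed_annulus bounded_closed_annulus by (simp add: compact_eq_bounded_closed)
  ultimately have "bounded (f ` closed_annulus a b)" by (intro compact_imp_bounded compact_continuous_image)
  then obtain B where "\<forall>x\<in>closed_annulus a b. \<bar>f x\<bar> \<le> B" by (auto simp: bounded_iff)
  moreover have "f \<in> borel_measurable (lebesgue_on (open_annulus a b))"
    using assms lmeasurable_open_annulus[of a b] open_annulus_ln(2)[OF assms(1)]
    by (intro continuous_imp_measurable_on_sets_lebesgue continuous_on_subset[OF assms(2)]) auto
  ultimately show ?thesis using open_subset_closed_annulus
    by (intro L2_fun_bounded[OF lmeasurable_open_annulus, of f a b B]) auto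
qed

lemma weak_deriv_annulus:
  assumes "0 < a" "C_k_on (Suc 0) (- {0}) w" "b \<in> Basis"
    and "\<And>x. x \<noteq> 0 \<Longrightarrow> (w has_derivative w' x) (at x)"
  shows "weak_deriv (open_annulus a c) b w (\<lambda>x. w' x b)"
proof (rule weak_deriv_cong[OF refl])
  show "weak_deriv (open_annulus a c) b w (\<lambda>x. frechet_derivative w (at x) b)"
    by (rule weak_deriv_C1[OF open_open_annulus bounded_open_annulus _ closure_open_annulus_nonzero[OF assms(1)]
        assms(2,3)]) auto
  show "frechet_derivative w (at x) b = w' x b" if "x \<in> open_annulus a c" for x
    using frechet_derivative_at[OF assms(4)[OF open_annulus_ln(2)[OF assms(1) that]]] by simp
qed

lemma weak_grad_polar_mode:
  assumes "0 < a" "C_k_on (Suc 0) UNIV h" "\<And>t. (h has_real_derivative h' t) (at t)"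
  shows "weak_grad (open_annulus a c) (polar_mode n h) (polar_field n (\<lambda>t. h' t * exp (- 2 * t)) (\<lambda>t. h t * exp (- 2 *
      t)))"
  unfolding weak_grad_def
  by (intro ballI weak_deriv_annulus[OF assms(1) C_k_on_polar_mode[OF assms(2)] _ polar_mode_has_derivative[OF _
      assms(3)]])

lemma sum_Basis_real2:
  fixes F :: "real^2 \<Rightarrow> real"
  shows "(\<Sum>b\<in>Basis. F b) = F (axis 1 1) + F (axis 2 1)"
proof -
  have eq: "(Basis :: (real^2) set) = {axis 1 1, axis 2 1}" by (auto simp: Basis_vec_def UNIV_2)
  have "axis 1 1 \<noteq> (axis 2 1 :: real^2)" by (simp add: axis_eq_axis)
  then show ?thesis unfolding eq by simp
qed

text \<open>
  The derivative of \<open>D\<close> does not enter the divergence, since it contributes only in the radial direction,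
  to which the tangential part is orthogonal. For this reason the tangential part may jump across a circle.
\<close>

lemma weak_div_polar_field:
  assumes a: "0 < a" and sm: "C_k_on (Suc 0) UNIV A" "C_k_on (Suc 0) UNIV D"
    and dA: "\<And>t. (A has_real_derivative A' t) (at t)" and cA': "continuous_on UNIV A'"
  shows "weak_div (open_annulus a c) (polar_field n A D)
    (\<lambda>x. (A' (ln (norm x)) + 2 * A (ln (norm x)) - (real n)\<^sup>2 * D (ln (norm x))) * cos_mode n x)"
proof -
  define D' where "D' t = frechet_derivative D (at t) 1" for t
  have dD: "(D has_real_derivative D' t) (at t)" for t
    unfolding D'_def by (rule C_k_on_real_has_derivative[OF sm(2)]) auto
  define dX where "dX b x v =
      (A' (ln (norm x)) * ((x \<bullet> v) / (norm x)\<^sup>2) * cos_mode n x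
        + A (ln (norm x)) * (- real n * sin_mode n x * (perp x \<bullet> v) / (norm x)\<^sup>2)) * (x \<bullet> b)
      + A (ln (norm x)) * cos_mode n x * (v \<bullet> b)
      - real n * ((D' (ln (norm x)) * ((x \<bullet> v) / (norm x)\<^sup>2) * sin_mode n x
        + D (ln (norm x)) * (real n * cos_mode n x * (perp x \<bullet> v) / (norm x)\<^sup>2)) * (perp x \<bullet> b)
      + D (ln (norm x)) * sin_mode n x * (perp v \<bullet> b))" for b x v :: "real^2"
  have dX: "((\<lambda>x. polar_field n A D x \<bullet> b) has_derivative dX b x) (at x)" if x: "x \<noteq> 0" for b x
  proof -
    have p: "((\<lambda>x. perp x \<bullet> b) has_derivative (\<lambda>v. perp v \<bullet> b)) (at x)"
      unfolding inner_perp by (auto intro!: derivative_eq_intros bounded_linear.has_derivative[OF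
          bounded_linear_vec_nth])
    note dmul = has_derivative_mult
    show ?thesis unfolding inner_polar_field dX_def
      by (rule has_derivative_eq_rhs, rule has_derivative_diff)
         (rule dmul[OF dmul[OF radial_has_derivative[OF x dA] mode_has_derivative(1)[OF x]]
             has_derivative_inner_left[OF has_derivative_ident]]
               dmul[OF dmul[OF has_derivative_mult_right[OF radial_has_derivative[OF x dD]] mode_has_derivative(2)[OF
                   x]] p]
           | simp add: fun_eq_iff algebra_simps)+
  qed
  show ?thesis
  proof (rule weak_div_of_weak_derivs[OF lmeasurable_open_annulus])
    show "weak_deriv (open_annulus a c) b (\<lambda>x. polar_field n A D x \<bullet> b) (\<lambda>x. dX b x b)" if "b \<in> Basis" for b
      by (rule weak_deriv_annulus[OF a C_k_on_polar_field[OF sm] that dX])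
    show "(A' (ln (norm x)) + 2 * A (ln (norm x)) - (real n)\<^sup>2 * D (ln (norm x))) * cos_mode n x
        = (\<Sum>b\<in>Basis. dX b x b)"
      if "x \<in> open_annulus a c" for x
    proof -
      \<comment> \<open>With \<open>i\<close> as an atom, the cross terms cancel by ring arithmetic, and the rest is \<open>i * (norm x)\<^sup>2 = 1\<close>.\<close>
      define i where "i = inverse ((norm x)\<^sup>2)"
      have i: "i * ((x $ 1)\<^sup>2 + (x $ 2)\<^sup>2) = 1"
        using open_annulus_ln(2)[OF a that] by (simp add: i_def flip: norm_real2)
      have "(\<Sum>b\<in>Basis. dX b x b) = A' (ln (norm x)) * cos_mode n x * (i * ((x $ 1)\<^sup>2 + (x $ 2)\<^sup>2))
          + 2 * A (ln (norm x)) * cos_mode n x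
          - (real n)\<^sup>2 * D (ln (norm x)) * cos_mode n x * (i * ((x $ 1)\<^sup>2 + (x $ 2)\<^sup>2))"
        unfolding sum_Basis_real2 dX_def inner_perp inner_axis divide_inverse i_def[symmetric]
        by (simp add: axis_def power2_eq_square algebra_simps)
      then show ?thesis unfolding i by (simp add: algebra_simps)
    qed
    show "L2_fun (lebesgue_on (open_annulus a c))
     (\<lambda>x. (A' (ln (norm x)) + 2 * A (ln (norm x)) - (real n)\<^sup>2 * D (ln (norm x))) * cos_mode n x)"
    proof (rule L2_fun_open_annulus[OF a])
      have "continuous_on (- {0}) (cos_mode n)" using C_k_on_mode(1)[of 0 n] by simp
      moreover have "continuous_on (- {0}) (\<lambda>x::real^2. h (ln (norm x)))"
          if "continuous_on UNIV h" for h :: "real \<Rightarrow> real"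
        using C_k_on_radial[of 0 h] that by simp
      ultimately show "continuous_on (- {0}) (\<lambda>x. (A' (ln (norm x))
          + 2 * A (ln (norm x)) - (real n)\<^sup>2 * D (ln (norm x))) * cos_mode n x)"
        using C_k_on_imp_continuous[OF sm(1)] C_k_on_imp_continuous[OF sm(2)] cA'
            by (intro continuous_on_mult continuous_on_diff continuous_on_add continuous_on_const) auto
    qed
  qed
qed

text \<open>
  The condition \<open>n \<ge> 1\<close> makes the product vanish at the origin, where \<open>ln 0 = 0\<close> is a meaningless argument
  for \<open>Q\<close>.
\<close>

lemma test_fun_polar_mode:
  assumes R: "0 < r" "r < R" and n: "n \<ge> 1" and sm: "\<And>k. C_k_on k UNIV Q"
    and z: "\<exists>e>0. \<forall>t. t \<le> ln r + e \<or> t \<ge> ln R - e \<longrightarrow> Q t = 0"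
  shows "test_fun (open_annulus r R) (polar_mode n Q)"
proof -
  obtain e where e: "e > 0" "\<And>t. t \<le> ln r + e \<or> t \<ge> ln R - e \<Longrightarrow> Q t = 0" using z by blast
  have zero: "polar_mode n Q x = 0" if "norm x < r * exp e \<or> norm x > R * exp (- e)" for x
  proof (cases "x = 0")
    case True
    have "cos_mode n 0 = 0" using n by (simp add: cos_mode_def complex_eq_iff sgn_zero_iff[THEN iffD2]
        zero_complex.code[symmetric])
    then show ?thesis using True by (simp add: polar_mode_def)
  next
    case False
    have "ln (norm x) \<le> ln r + e \<or> ln (norm x) \<ge> ln R - e"
      using that
    proof
      assume "norm x < r * exp e"
      then have "ln (norm x) < ln (r * exp e)" using False R by simp
      then show ?thesis using R by (simp add: ln_mult)
    next
      assume "norm x > R * exp (- e)"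
      then have "ln (norm x) > ln (R * exp (- e))" using False R by simp
      then show ?thesis using R by (simp add: ln_mult)
    qed
    then show ?thesis using e(2) by (simp add: polar_mode_def)
  qed
  have re: "r < r * exp e" "R * exp (- e) < R" using R e(1) by simp_all
  have "C_k_on k UNIV (polar_mode n Q)" for k
  proof -
    have "C_k_on k (ball 0 r) (polar_mode n Q)"
      by (rule C_k_on_cong[OF open_ball _ C_k_on_const[OF open_ball, of k 0]]) (use zero re in \<open>auto simp: dist_norm\<close>)
    with C_k_on_polar_mode[OF sm] have "C_k_on k (- {0} \<union> ball 0 r) (polar_mode n Q)"
      by (intro C_k_on_Un) auto
    moreover have "- {0} \<union> ball 0 r = (UNIV :: (real^2) set)" using R by auto
    ultimately show ?thesis by simp
  qed
  then have "\<forall>k. C_k k (polar_mode n Q)" by (simp add: C_k_on_UNIV)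
  moreover have supp: "closure {x. polar_mode n Q x \<noteq> 0} \<subseteq> closed_annulus (r * exp e) (R * exp (- e))"
    using zero by (intro closure_minimal closed_closed_annulus) (force simp: closed_annulus_def)
  moreover have "compact (closure {x. polar_mode n Q x \<noteq> 0})"
    using bounded_subset[OF bounded_closed_annulus supp] by (simp add: compact_eq_bounded_closed)
  moreover have "closed_annulus (r * exp e) (R * exp (- e)) \<subseteq> open_annulus r R"
    using re by (auto simp: closed_annulus_def open_annulus_def)
  ultimately show ?thesis by (auto simp: test_fun_def)
qed

lemma polar_field_bound:
  assumes "\<bar>A (ln (norm x))\<bar> \<le> M" "\<bar>D (ln (norm x))\<bar> \<le> M" "norm x \<le> R" "b \<in> Basis"
  shows "\<bar>polar_field n A D x \<bullet> b\<bar> \<le> M * R + real n * M * R"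
proof -
  have M: "M \<ge> 0" using assms(1) by linarith
  have "norm (perp x) = norm x"
    using power2_eq_iff_nonneg[OF norm_ge_zero norm_ge_zero, of "perp x" x] by (simp add: norm_real2 perp_def)
  then have b: "\<bar>x \<bullet> b\<bar> \<le> R" "\<bar>perp x \<bullet> b\<bar> \<le> R"
    using Basis_le_norm[OF assms(4), of x] Basis_le_norm[OF assms(4), of "perp x"] assms(3) by linarith+
  have "\<bar>A (ln (norm x)) * cos_mode n x * (x \<bullet> b)\<bar> \<le> (M * 1) * R"
    unfolding abs_mult using assms M mode_le_1 b by (intro mult_mono) auto
  moreover have "\<bar>real n * D (ln (norm x)) * sin_mode n x * (perp x \<bullet> b)\<bar> \<le> (real n * M * 1) * R"
    unfolding abs_mult using assms M mode_le_1 b by (intro mult_mono) auto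
  ultimately show ?thesis unfolding inner_polar_field by (simp add: abs_le_iff)
qed

lemma polar_field_tendsto:
  assumes "(\<lambda>k. A k (ln (norm x))) \<longlonglongrightarrow> A0 (ln (norm x))" "(\<lambda>k. D k (ln (norm x))) \<longlonglongrightarrow> D0 (ln (norm x))"
  shows "(\<lambda>k. polar_field n (A k) (D k) x \<bullet> b) \<longlonglongrightarrow> polar_field n A0 D0 x \<bullet> b"
  unfolding inner_polar_field by (intro tendsto_diff tendsto_mult tendsto_const assms)

section \<open>Separated solutions are weak eigenfunctions\<close>

text \<open>
  The approximations with compactly supported radial factor are test functions, and they converge together
  with their gradients boundedly and pointwise. The same limit identifies the weak gradient of the glued function.
\<close>

lemma H1_0_polar_mode:
  fixes f f' g g' :: "real \<Rightarrow> real"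
  assumes R: "0 < r0" "r0 < r1" "r1 < r2" and n: "n \<ge> 1"
    and sm: "\<And>k. C_k_on k UNIV f" "\<And>k. C_k_on k UNIV g" "C_k_on 0 UNIV f'" "C_k_on 0 UNIV g'"
    and d: "\<And>t. (f has_real_derivative f' t) (at t)" "\<And>t. (g has_real_derivative g' t) (at t)"
    and bc: "f (ln r0) = 0" "g (ln r2) = 0" "f (ln r1) = g (ln r1)"
  defines "F \<equiv> \<lambda>t. if t \<le> ln r1 then f t else g t" and "F' \<equiv> \<lambda>t. if t \<le> ln r1 then f' t else g' t"
  shows "polar_mode n F \<in> H1_0 (open_annulus r0 r2)"
    and "weak_grad (open_annulus r0 r2) (polar_mode n F) (polar_field n (\<lambda>t. F' t * exp (- 2 * t)) (\<lambda>t. F t * exp (- 2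
        * t)))"
proof -
  let ?U = "open_annulus r0 r2"
  have ln: "ln r0 < ln r1" "ln r1 < ln r2" "ln r0 < ln r2" using R by auto
  obtain P P' M where P: "\<And>j k. C_k_on j UNIV (P k)" "\<And>k t. (P k has_real_derivative P' k t) (at t)"
    "\<And>k t. t \<in> {ln r0..ln r2} \<Longrightarrow> \<bar>P k t\<bar> \<le> M" "\<And>k t. t \<in> {ln r0..ln r2} \<Longrightarrow> \<bar>P' k t\<bar> \<le> M"
    "\<And>t. (\<lambda>k. P k t) \<longlonglongrightarrow> F t" "\<And>t. (\<lambda>k. P' k t) \<longlonglongrightarrow> F' t"
    "\<And>k. P k (ln r0) = f (ln r0)" "\<And>k. P k (ln r2) = g (ln r2)"
    unfolding F_def F'_def by (rule smooth_approx_glued[OF ln(1,2) sm d]) (use bc(3) in blast)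
  obtain Q Q' N where Q: "\<And>j k. C_k_on j UNIV (Q k)" "\<And>k t. (Q k has_real_derivative Q' k t) (at t)"
    "\<And>k t. t \<in> {ln r0..ln r2} \<Longrightarrow> \<bar>Q k t\<bar> \<le> N" "\<And>k t. t \<in> {ln r0..ln r2} \<Longrightarrow> \<bar>Q' k t\<bar> \<le> N"
    "\<And>t. t \<in> {ln r0<..<ln r2} \<Longrightarrow> (\<lambda>k. Q k t) \<longlonglongrightarrow> F t" 
    "\<And>t. t \<in> {ln r0<..<ln r2} \<Longrightarrow> (\<lambda>k. Q' k t) \<longlonglongrightarrow> F' t"
    "\<And>k. \<exists>e>0. \<forall>t. t \<le> ln r0 + e \<or> t \<ge> ln r2 - e \<longrightarrow> Q k t = 0"
    by (rule smooth_cutoff_approx[OF ln(3) P(1-6)]) (use P(7,8) bc in auto)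
  define \<phi> where "\<phi> k = polar_mode n (Q k)" for k
  define \<Phi> where "\<Phi> k = polar_field n (\<lambda>t. Q' k t * exp (- 2 * t)) (\<lambda>t. Q k t * exp (- 2 * t))" for k
  define G where "G = polar_field n (\<lambda>t. F' t * exp (- 2 * t)) (\<lambda>t. F t * exp (- 2 * t))"
  have test: "test_fun ?U (\<phi> k)" for k
    unfolding \<phi>_def by (rule test_fun_polar_mode[OF R(1) _ n Q(1,7)]) (use R in simp)
  have grad: "weak_grad ?U (\<phi> k) (\<Phi> k)" for k
    unfolding \<phi>_def \<Phi>_def by (rule weak_grad_polar_mode[OF R(1) Q(1,2)])
  have meas: "\<phi> k \<in> borel_measurable (lebesgue_on ?U)" "(\<lambda>x. \<Phi> k x \<bullet> b) \<in> borel_measurable (lebesgue_on ?U)"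
    if "b \<in> Basis" for k b using grad[of k] that by (auto simp: weak_grad_def weak_deriv_def L2_fun_def)
  obtain b0 :: "real^2" where b0: "b0 \<in> Basis" using nonempty_Basis by blast
  define E where "E = exp (- 2 * ln r0)"
  have N0: "N \<ge> 0" using Q(3)[of "ln r0" 0] ln by auto
  have bnd: "\<bar>\<phi> k x\<bar> \<le> N" if x: "x \<in> ?U" for k x
  proof -
    have "\<bar>Q k (ln (norm x))\<bar> \<le> N" using Q(3) open_annulus_ln(1)[OF R(1) x] by auto
    from mult_mono[OF this mode_le_1(1)[of n x] N0] show ?thesis by (simp add: \<phi>_def polar_mode_def abs_mult)
  qed
  have bndG: "\<bar>\<Phi> k x \<bullet> b\<bar> \<le> N * E * r2 + real n * (N * E) * r2" if x: "x \<in> ?U" and b: "b \<in> Basis" for k x b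
    unfolding \<Phi>_def
  proof (rule polar_field_bound)
    have t: "ln (norm x) \<in> {ln r0..ln r2}" using open_annulus_ln(1)[OF R(1) x] by auto
    then have "exp (- 2 * ln (norm x)) \<le> E" by (simp add: E_def)
    then show "\<bar>Q' k (ln (norm x)) * exp (- 2 * ln (norm x))\<bar> \<le> N * E"
        "\<bar>Q k (ln (norm x)) * exp (- 2 * ln (norm x))\<bar> \<le> N * E"
      unfolding abs_mult using Q(3,4)[OF t] N0 by (auto intro!: mult_mono)
    show "norm x \<le> r2" by (rule open_annulus_ln(3)[OF R(1) x])
  qed (rule b)
  have lim: "(\<lambda>k. \<phi> k x) \<longlonglongrightarrow> polar_mode n F x" if x: "x \<in> ?U" for x
    unfolding \<phi>_def polar_mode_def
    by (intro tendsto_mult tendsto_const Q(5) open_annulus_ln(1)[OF R(1) x])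
  have limG: "(\<lambda>k. \<Phi> k x \<bullet> b) \<longlonglongrightarrow> G x \<bullet> b" if x: "x \<in> ?U" for x b
    unfolding \<Phi>_def G_def
    by (rule polar_field_tendsto) (intro tendsto_mult tendsto_const Q(5,6) open_annulus_ln(1)[OF R(1) x])+
  define N' where "N' = max N (N * E * r2 + real n * (N * E) * r2)"
  show wg: "weak_grad ?U (polar_mode n F) (polar_field n (\<lambda>t. F' t * exp (- 2 * t)) (\<lambda>t. F t * exp (- 2 * t)))"
    unfolding G_def[symmetric] weak_grad_def
  proof
    fix b :: "real^2" assume b: "b \<in> Basis"
    show "weak_deriv ?U b (polar_mode n F) (\<lambda>x. G x \<bullet> b)"
    proof (rule weak_deriv_limit[OF lmeasurable_open_annulus b, of _ _ \<phi> "\<lambda>k x. \<Phi> k x \<bullet> b" N'])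
      show "weak_deriv ?U b (\<phi> k) (\<lambda>x. \<Phi> k x \<bullet> b)" for k using grad b by (simp add: weak_grad_def)
      show "\<bar>\<phi> k x\<bar> \<le> N'" if "x \<in> ?U" for k x unfolding N'_def by (rule max.coboundedI1[OF bnd[OF that]])
      show "\<bar>\<Phi> k x \<bullet> b\<bar> \<le> N'" if "x \<in> ?U" for k x unfolding N'_def by (rule max.coboundedI2[OF bndG[OF that b]])
    qed (rule lim limG, assumption)+
  qed
  have "L2_tendsto (lebesgue_on ?U) \<phi> (polar_mode n F)"
    by (rule L2_tendsto_bounded[OF lmeasurable_open_annulus meas(1)[OF b0] bnd lim])
  moreover have "L2_tendsto (lebesgue_on ?U) (\<lambda>k x. \<Phi> k x \<bullet> b) (\<lambda>x. G x \<bullet> b)" if b: "b \<in> Basis" for b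
    by (rule L2_tendsto_bounded[OF lmeasurable_open_annulus meas(2)[OF b] bndG[OF _ b] limG])
  ultimately have "H1_tendsto ?U \<phi> (polar_mode n F)"
    unfolding H1_tendsto_def using grad wg[folded G_def] by blast
  then show "polar_mode n F \<in> H1_0 ?U" unfolding H1_0_def using test by blast
qed

text \<open>
  The radial part of the flux is glued continuously, so it is approximated together with its derivative.
  The tangential part is approximated without any control of derivatives. In the limit the divergence
  \<open>(P' - n\<^sup>2 * D) * exp (- 2 * t) * cos (n * \<theta>)\<close> is evaluated by the differential equation.
\<close>

lemma weak_div_flux:
  fixes f f' g g' :: "real \<Rightarrow> real"
  assumes R: "0 < r0" "r0 < r1" "r1 < r2"
    and sm: "\<And>k. C_k_on k UNIV f" "\<And>k. C_k_on k UNIV g" "\<And>k. C_k_on k UNIV f'" "\<And>k. C_k_on k UNIV g'"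
    and f: "\<And>t. (f has_real_derivative f' t) (at t)" "\<And>t. (g has_real_derivative g' t) (at t)"
    and d: "\<And>t. (f' has_real_derivative ((real n)\<^sup>2 - l / cm * exp (2 * t)) * f t) (at t)"
      "\<And>t. (g' has_real_derivative ((real n)\<^sup>2 - l / cp * exp (2 * t)) * g t) (at t)"
    and c: "cm > 0" "cp > 0" and flux: "cm * f' (ln r1) = cp * g' (ln r1)"
  defines "F \<equiv> \<lambda>t. if t \<le> ln r1 then f t else g t" 
  shows "weak_div (open_annulus r0 r2) 
     (polar_field n (\<lambda>t. (if t \<le> ln r1 then cm * f' t else cp * g' t) * exp (- 2 * t))
                    (\<lambda>t. (if t \<le> ln r1 then cm * f t else cp * g t) * exp (- 2 * t)))
     (\<lambda>x. - (l * polar_mode n F x))"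
proof -
  let ?U = "open_annulus r0 r2"
  have ln: "ln r0 < ln r1" "ln r1 < ln r2" "ln r0 < ln r2" using R by auto
  have csm: "C_k_on k UNIV (\<lambda>t. a * h t)" if "\<And>k. C_k_on k UNIV h" for k a and h :: "real \<Rightarrow> real"
    by (rule C_k_on_cmult[OF open_UNIV that])
  define pm where "pm t = cm * (((real n)\<^sup>2 - l / cm * exp (2 * t)) * f t)" for t
  define pp where "pp t = cp * (((real n)\<^sup>2 - l / cp * exp (2 * t)) * g t)" for t
  have cpm: "C_k_on 0 UNIV pm" "C_k_on 0 UNIV pp"
    using C_k_on_imp_continuous[OF sm(1)] C_k_on_imp_continuous[OF sm(2)] c unfolding pm_def pp_def
    by (auto intro!: continuous_intros)
  have dp: "((\<lambda>t. cm * f' t) has_real_derivative pm t) (at t)" "((\<lambda>t. cp * g' t) has_real_derivative pp t) (at t)"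
      for t
    unfolding pm_def pp_def by (rule DERIV_cmult[OF d(1)] DERIV_cmult[OF d(2)])+
  obtain P P' M where P: "\<And>j k. C_k_on j UNIV (P k)" "\<And>k t. (P k has_real_derivative P' k t) (at t)"
    "\<And>k t. t \<in> {ln r0..ln r2} \<Longrightarrow> \<bar>P k t\<bar> \<le> M" "\<And>k t. t \<in> {ln r0..ln r2} \<Longrightarrow> \<bar>P' k t\<bar> \<le> M"
    "\<And>t. (\<lambda>k. P k t) \<longlonglongrightarrow> (if t \<le> ln r1 then cm * f' t else cp * g' t)"
    "\<And>t. (\<lambda>k. P' k t) \<longlonglongrightarrow> (if t \<le> ln r1 then pm t else pp t)"
    by (rule smooth_approx_glued[OF ln(1,2) csm[OF sm(3)] csm[OF sm(4)] cpm dp]) (use flux in blast)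
  obtain D D' M' where D: "\<And>j k. C_k_on j UNIV (D k)" "\<And>k t. t \<in> {ln r0..ln r2} \<Longrightarrow> \<bar>D k t\<bar> \<le> M'"
    "\<And>t. (\<lambda>k. D k t) \<longlonglongrightarrow> (if t \<le> ln r1 then cm * f t else cp * g t)"
    by (rule smooth_approx_glued[OF ln(1,2) csm[OF sm(1)] csm[OF sm(2)] csm[OF sm(3)] csm[OF sm(4)] DERIV_cmult[OF
        f(1)] DERIV_cmult[OF f(2)]]) blast
  define e2 where "e2 t = exp (- 2 * t)" for t :: real
  have e2sm: "C_k_on k UNIV e2" for k
    unfolding e2_def using C_k_on_compose[OF open_UNIV open_UNIV C_k_on_exp C_k_on_affine[of k "- 2" 0]] by simp
  define X where "X k = polar_field n (\<lambda>t. P k t * e2 t) (\<lambda>t. D k t * e2 t)" for k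
  define h where "h k x = (P' k (ln (norm x)) - (real n)\<^sup>2 * D k (ln (norm x))) * e2 (ln (norm x)) * cos_mode n x"
      for k x
  define M0 where "M0 = max M M'"
  define E where "E = exp (- 2 * ln r0)"
  have M00: "M0 \<ge> 0" using P(3)[of "ln r0" 0] ln by (auto simp: M0_def)
  have E0: "E > 0" by (simp add: E_def)
  define B where "B = max (M0 * E * r2 + real n * (M0 * E) * r2) ((M0 + (real n)\<^sup>2 * M0) * E * 1)"
  show ?thesis
  proof (rule weak_div_limit[OF lmeasurable_open_annulus, of _ _ X h B])
    show "weak_div ?U (X k) (h k)" for k
    proof -
      define A' where "A' t = P' k t * e2 t + P k t * (- 2 * e2 t)" for t
      have "weak_div ?U (X k) (\<lambda>x. (A' (ln (norm x))
          + 2 * (P k (ln (norm x)) * e2 (ln (norm x))) - (real n)\<^sup>2 * (D k (ln (norm x)) * e2 (ln (norm x)))) *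
          cos_mode n x)"
        unfolding X_def
      proof (rule weak_div_polar_field[OF R(1)])
        show "C_k_on (Suc 0) UNIV (\<lambda>t. P k t * e2 t)" "C_k_on (Suc 0) UNIV (\<lambda>t. D k t * e2 t)"
          by (rule C_k_on_mult[OF open_UNIV _ e2sm], rule P D)+
        show "((\<lambda>t. P k t * e2 t) has_real_derivative A' t) (at t)" for t
          unfolding A'_def e2_def by (auto intro!: derivative_eq_intros P(2))
        have "P' k t = frechet_derivative (P k) (at t) 1" for t
          using DERIV_unique[OF P(2) C_k_on_real_has_derivative[OF P(1)[of "Suc 0"] open_UNIV]] by simp
        moreover have "continuous_on UNIV (\<lambda>t. frechet_derivative (P k) (at t) 1)"
          using P(1)[of "Suc 0" k] by simp
        ultimately have "continuous_on UNIV (P' k)" by simp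
        then show "continuous_on UNIV A'" unfolding A'_def
          using C_k_on_imp_continuous[OF P(1)] C_k_on_imp_continuous[OF e2sm] by (intro continuous_intros) auto
      qed
      moreover have "(A' t + 2 * (P k t * e2 t) - (real n)\<^sup>2 * (D k t * e2 t)) * y
          = (P' k t - (real n)\<^sup>2 * D k t) * e2 t * y" for t y
        by (simp add: A'_def algebra_simps)
      ultimately show ?thesis by (simp add: h_def[abs_def])
    qed
    fix k x assume x: "x \<in> ?U"
    have t: "ln (norm x) \<in> {ln r0..ln r2}" using open_annulus_ln(1)[OF R(1) x] by auto
    then have eE: "\<bar>e2 (ln (norm x))\<bar> \<le> E" by (simp add: E_def e2_def)
    have pb: "\<bar>P k (ln (norm x))\<bar> \<le> M0" "\<bar>P' k (ln (norm x))\<bar> \<le> M0" "\<bar>D k (ln (norm x))\<bar> \<le> M0"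
      using P(3,4)[OF t] D(2)[OF t] by (auto simp: M0_def le_max_iff_disj)
    { fix b :: "real^2" assume b: "b \<in> Basis"
      have "\<bar>X k x \<bullet> b\<bar> \<le> M0 * E * r2 + real n * (M0 * E) * r2"
        unfolding X_def
      proof (rule polar_field_bound)
        show "\<bar>P k (ln (norm x)) * e2 (ln (norm x))\<bar> \<le> M0 * E" "\<bar>D k (ln (norm x)) * e2 (ln (norm x))\<bar> \<le> M0 * E"
          unfolding abs_mult using pb eE M00 by (auto intro!: mult_mono)
      qed (use open_annulus_ln(3)[OF R(1) x] b in auto)
      then show "\<bar>X k x \<bullet> b\<bar> \<le> B" unfolding B_def by (rule max.coboundedI1) }
    have "\<bar>(real n)\<^sup>2 * D k (ln (norm x))\<bar> \<le> (real n)\<^sup>2 * M0"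
      unfolding abs_mult using pb(3) by (simp add: mult_left_mono)
    then have "\<bar>P' k (ln (norm x)) - (real n)\<^sup>2 * D k (ln (norm x))\<bar> \<le> M0 + (real n)\<^sup>2 * M0"
      using pb(2) abs_triangle_ineq4[of "P' k (ln (norm x))" "(real n)\<^sup>2 * D k (ln (norm x))"] by linarith
    then have "\<bar>h k x\<bar> \<le> (M0 + (real n)\<^sup>2 * M0) * E * 1"
      unfolding h_def abs_mult using eE mode_le_1(1)[of n x] M00 E0 by (intro mult_mono) auto
    then show "\<bar>h k x\<bar> \<le> B" unfolding B_def by (rule max.coboundedI2)
  next
    fix x b assume x: "x \<in> ?U"
    show "(\<lambda>k. X k x \<bullet> b) \<longlonglongrightarrow> polar_field n (\<lambda>t. (if t \<le> ln r1 then cm * f' t else cp * g' t) * exp (- 2 * t))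
                    (\<lambda>t. (if t \<le> ln r1 then cm * f t else cp * g t) * exp (- 2 * t)) x \<bullet> b"
      unfolding X_def e2_def by (rule polar_field_tendsto) (intro tendsto_mult tendsto_const P(5) D(3))+
  next
    fix x assume x: "x \<in> ?U"
    let ?t = "ln (norm x)"
    have "(\<lambda>k. h k x) \<longlonglongrightarrow> ((if ?t \<le> ln r1 then pm ?t else pp ?t) - (real n)\<^sup>2 * (if ?t
        \<le> ln r1 then cm * f ?t else cp * g ?t)) * e2 ?t * cos_mode n x"
      unfolding h_def by (intro tendsto_mult tendsto_diff tendsto_const P(6) D(3))
    moreover have "exp (2 * ?t) * e2 ?t = 1" by (simp add: e2_def flip: exp_add)
    then have "((if ?t \<le> ln r1 then pm ?t else pp ?t) - (real n)\<^sup>2 * (if ?t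
        \<le> ln r1 then cm * f ?t else cp * g ?t)) * e2 ?t * cos_mode n x
       = - (l * polar_mode n F x)"
    proof -
      assume e: "exp (2 * ?t) * e2 ?t = 1"
      have "(if ?t \<le> ln r1 then pm ?t else pp ?t) - (real n)\<^sup>2 * (if ?t
          \<le> ln r1 then cm * f ?t else cp * g ?t) = - l * F ?t * exp (2 * ?t)"
        using c by (simp add: pm_def pp_def F_def algebra_simps)
      then have "((if ?t \<le> ln r1 then pm ?t else pp ?t) - (real n)\<^sup>2 * (if ?t
          \<le> ln r1 then cm * f ?t else cp * g ?t)) * e2 ?t * cos_mode n x
        = - l * F ?t * (exp (2 * ?t) * e2 ?t) * cos_mode n x" by simp
      then show ?thesis unfolding e polar_mode_def by simp
    qed
    ultimately show "(\<lambda>k. h k x) \<longlonglongrightarrow> - (l * polar_mode n F x)" by simp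
  qed
qed

lemma circle_measure_facts:
  assumes "r > 0"
  shows "finite_measure (circle_measure r)" "space (circle_measure r) = sphere 0 r"
    "sets (circle_measure r) = sets (restrict_space borel (sphere 0 r))"
proof -
  let ?c = "\<lambda>\<theta>::real. vector [r * cos \<theta>, r * sin \<theta>] :: real^2"
  have "continuous_on UNIV ?c"
  proof -
    have eq: "?c = (\<lambda>\<theta>. (r * cos \<theta>) *\<^sub>R axis 1 1 + (r * sin \<theta>) *\<^sub>R axis 2 1)"
      by (auto simp: fun_eq_iff vec_eq_iff forall_2 axis_def vector_2)
    have "continuous_on UNIV (\<lambda>\<theta>. (r * cos \<theta>) *\<^sub>R (axis 1 1 :: real^2) + (r * sin \<theta>) *\<^sub>R axis 2 1)"
      by (intro continuous_intros)
    then show ?thesis by (rule subst[where P = "continuous_on UNIV", OF eq[symmetric]])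
  qed
  then have "?c \<in> borel_measurable borel" by (rule borel_measurable_continuous_onI)
  moreover have "norm (?c \<theta>) = r" for \<theta>
  proof -
    have "(norm (?c \<theta>))\<^sup>2 = r\<^sup>2 * ((cos \<theta>)\<^sup>2 + (sin \<theta>)\<^sup>2)"
      unfolding norm_real2 vector_2 power_mult_distrib distrib_left ..
    then have "(norm (?c \<theta>))\<^sup>2 = r\<^sup>2" unfolding sin_cos_squared_add2 by simp
    then show ?thesis using assms by (simp add: power2_eq_iff_nonneg)
  qed
  ultimately have m: "?c \<in> measurable (density lborel (\<lambda>\<theta>. ennreal (r * indicator {0..2 * pi} \<theta>))) (restrict_space
      borel (sphere 0 r))"
    by (intro measurable_restrict_space2) (auto simp: dist_norm)
  have "finite_measure (density lborel (\<lambda>\<theta>. ennreal (r * indicator {0..2 * pi} \<theta>)))"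
  proof
    have "emeasure (density lborel (\<lambda>\<theta>. ennreal (r * indicator {0..2 * pi} \<theta>))) (space (density lborel (\<lambda>\<theta>. ennreal (r
        * indicator {0..2 * pi} \<theta>))))
        = (\<integral>\<^sup>+\<theta>. ennreal r * indicator {0..2 * pi} \<theta> \<partial>lborel)"
      using assms by (auto simp: emeasure_density intro!: nn_integral_cong split: split_indicator)
    also have "\<dots> = ennreal r * emeasure lborel {0..2 * pi}" by (rule nn_integral_cmult_indicator) simp
    also have "\<dots> \<noteq> \<infinity>" by (simp add: ennreal_mult_eq_top_iff)
    finally show "emeasure (density lborel (\<lambda>\<theta>. ennreal (r * indicator {0..2 * pi} \<theta>))) (space (density lborel (\<lambda>\<theta>.
        ennreal (r * indicator {0..2 * pi} \<theta>)))) \<noteq> \<infinity>" .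
  qed
  then show "finite_measure (circle_measure r)" unfolding circle_measure_def
      by (rule finite_measure.finite_measure_distr[OF _ m])
  show "space (circle_measure r) = sphere 0 r" "sets (circle_measure r) = sets (restrict_space borel (sphere 0 r))"
    by (simp_all add: circle_measure_def space_restrict_space)
qed

lemma has_trace_smooth:
  assumes a: "0 < a" and r: "r > 0" and w: "C_k_on (Suc 0) (- {0}) w"
  shows "has_trace (open_annulus a c) (circle_measure r) w w"
proof -
  let ?U = "open_annulus a c"
  have cw: "continuous_on (- {0}) w" by (rule C_k_on_imp_continuous[OF w])
  have "continuous_on (closure ?U) w" by (rule continuous_on_subset[OF cw closure_open_annulus_nonzero[OF a]])
  moreover have "H1_tendsto ?U (\<lambda>k. w) w"
  proof -
    define G where "G x = (\<Sum>b\<in>Basis. frechet_derivative w (at x) b *\<^sub>R b)" for x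
    have G: "G x \<bullet> b = frechet_derivative w (at x) b" if "b \<in> Basis" for x b
      using that by (simp add: G_def inner_sum_left inner_Basis if_distrib sum.delta cong: if_cong)
    have wg: "weak_grad ?U w G" unfolding weak_grad_def
    proof
      fix b :: "real^2" assume b: "b \<in> Basis"
      show "weak_deriv ?U b w (\<lambda>x. G x \<bullet> b)" unfolding G[OF b]
        by (rule weak_deriv_C1[OF open_open_annulus bounded_open_annulus _ closure_open_annulus_nonzero[OF a] w b])
            auto
    qed
    have L2c: "L2_tendsto M (\<lambda>k. h) h" if "L2_fun M h" for M :: "(real^2) measure" and h
      using that by (simp add: L2_tendsto_def L2_norm_def)
    obtain b0 :: "real^2" where b0: "b0 \<in> Basis" using nonempty_Basis by blast
    have "L2_fun (lebesgue_on ?U) w" using wg b0 unfolding weak_grad_def weak_deriv_def by blast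
    then have Lw: "L2_tendsto (lebesgue_on ?U) (\<lambda>k. w) w" by (rule L2c)
    have LG: "L2_tendsto (lebesgue_on ?U) (\<lambda>k x. G x \<bullet> b) (\<lambda>x. G x \<bullet> b)" if "b \<in> Basis" for b
      by (rule L2c) (use wg that in \<open>unfold weak_grad_def weak_deriv_def, blast\<close>)
    show ?thesis unfolding H1_tendsto_def
      by (intro conjI exI[of _ "\<lambda>k. G"] exI[of _ G] allI ballI Lw wg LG)
  qed
  moreover have "L2_tendsto (circle_measure r) (\<lambda>k. w) w"
  proof -
    interpret finite_measure "circle_measure r" by (rule circle_measure_facts(1)[OF r])
    have cs: "continuous_on (sphere 0 r) w" by (rule continuous_on_subset[OF cw]) (use r in auto)
    then obtain B where B: "\<forall>x\<in>sphere 0 r. \<bar>w x\<bar> \<le> B"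
      using compact_imp_bounded[OF compact_continuous_image[OF cs]] by (auto simp: bounded_iff)
    have "w \<in> borel_measurable (restrict_space borel (sphere 0 r))"
        by (rule borel_measurable_continuous_on_restrict[OF cs])
    then have m: "w \<in> borel_measurable (circle_measure r)"
      by (simp add: measurable_cong_sets[OF circle_measure_facts(3)[OF r] refl])
    have "integrable (circle_measure r) (\<lambda>x. (w x)\<^sup>2)"
    proof (rule integrable_const_bound[of _ "B\<^sup>2"])
      show "AE x in circle_measure r. norm ((w x)\<^sup>2) \<le> B\<^sup>2"
      proof (rule AE_I2)
        fix x assume "x \<in> space (circle_measure r)"
        then have "\<bar>w x\<bar> \<le> B" using B circle_measure_facts(2)[OF r] by auto
        then have "\<bar>w x\<bar>\<^sup>2 \<le> B\<^sup>2" by (rule power_mono) simp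
        then show "norm ((w x)\<^sup>2) \<le> B\<^sup>2" by simp
      qed
    qed (use m in simp)
    then show ?thesis using m by (simp add: L2_tendsto_def L2_norm_def L2_fun_def)
  qed
  ultimately show ?thesis unfolding has_trace_def by (intro exI[of _ "\<lambda>k. w"] conjI allI)
qed

lemma weak_grad_cong:
  assumes "\<And>x. x \<in> U \<Longrightarrow> u x = u' x" "weak_grad U u G" shows "weak_grad U u' G"
  unfolding weak_grad_def
proof
  fix b :: 'a assume "b \<in> Basis"
  then have wd: "weak_deriv U b u (\<lambda>x. G x \<bullet> b)" using assms(2) by (simp add: weak_grad_def)
  show "weak_deriv U b u' (\<lambda>x. G x \<bullet> b)"
    by (rule weak_deriv_cong[of U u u' "\<lambda>x. G x \<bullet> b" "\<lambda>x. G x \<bullet> b", OF assms(1) refl wd])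
qed

lemma has_normal_deriv_polar_mode:
  assumes a: "0 < a" and r: "r > 0" and sm: "\<And>k. C_k_on k UNIV h" "\<And>k. C_k_on k UNIV h'"
    and d: "\<And>t. (h has_real_derivative h' t) (at t)"
    and eq: "\<And>x. x \<in> open_annulus a c \<Longrightarrow> polar_mode n h x = u x"
  shows "has_normal_deriv (open_annulus a c) (circle_measure r) sgn u (\<lambda>x. h' (ln r) / r * cos_mode n x)"
proof -
  let ?G = "polar_field n (\<lambda>t. h' t * exp (- 2 * t)) (\<lambda>t. h t * exp (- 2 * t))"
  have e2: "C_k_on k UNIV (\<lambda>t::real. exp (- 2 * t))" for k
    using C_k_on_compose[OF open_UNIV open_UNIV C_k_on_exp C_k_on_affine[of k "- 2" 0]] by simp
  have "weak_grad (open_annulus a c) u ?G"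
    by (rule weak_grad_cong[OF eq weak_grad_polar_mode[OF a sm(1) d]])
  moreover have "has_trace (open_annulus a c) (circle_measure r) (\<lambda>x. ?G x \<bullet> b) (\<lambda>x. ?G x \<bullet> b)" for b
    by (rule has_trace_smooth[OF a r C_k_on_polar_field[OF C_k_on_mult[OF open_UNIV sm(2) e2] C_k_on_mult[OF open_UNIV
        sm(1) e2]]])
  moreover have "AE x in circle_measure r. h' (ln r) / r * cos_mode n x = ?G x \<bullet> sgn x"
  proof (rule AE_I2)
    fix x assume "x \<in> space (circle_measure r)"
    then have nx: "norm x = r" using circle_measure_facts(2)[OF r] by auto
    then have x0: "x \<noteq> 0" using r by auto
    have "perp x \<bullet> x = 0" by (simp add: inner_perp)
    moreover have "x \<bullet> x = r * r" using nx by (simp add: dot_square_norm power2_eq_square)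
    ultimately show "h' (ln r) / r * cos_mode n x = ?G x \<bullet> sgn x"
      unfolding inner_polar_field sgn_div_norm inner_scaleR_right nx exp_ln_norm[OF x0, unfolded nx] using r
      by (simp add: field_simps power2_eq_square)
  qed
  ultimately show ?thesis unfolding has_normal_deriv_def by (intro exI[of _ ?G] conjI ballI)
qed

text \<open>
  On each of the two annuli \<open>u\<close> agrees with a function that is smooth away from the origin. This gives the
  regularity and the normal derivatives \<open>f' (ln r1) / r1 * cos (n * \<theta>)\<close> and \<open>g' (ln r1) / r1 * cos (n * \<theta>)\<close>.
  The coefficient
  \<^const>\<open>jump_coeff\<close> vanishes on the interface, so its product with the gradient equals the flux only almost
  everywhere.
\<close>

lemma eigenpair_in_op_domain:
  assumes R: "0 < r0" "r0 < r1" "r1 < r2" and c: "cm > 0" "cp > 0" and n: "n \<ge> 1"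
    and ep: "eigenpair (ln r0) (ln r1) (ln r2) cm cp n l f f' g g'"
  defines "u \<equiv> polar_mode n (glue (ln r1) f g)"
  shows "u \<in> op_domain r0 r1 r2 cm cp"
    and "neg_div_grad (interior (closed_annulus r0 r2)) (jump_coeff r0 r1 r2 cm cp) u (\<lambda>x. l * u x)"
proof -
  let ?F = "glue (ln r1) f g" and ?F' = "glue (ln r1) f' g'"
  have f: "\<And>t. (f has_real_derivative f' t) (at t)"
      "\<And>t. (f' has_real_derivative ((real n)\<^sup>2 - l / cm * exp (2 * t)) * f t) (at t)"
    and g: "\<And>t. (g has_real_derivative g' t) (at t)"
        "\<And>t. (g' has_real_derivative ((real n)\<^sup>2 - l / cp * exp (2 * t)) * g t) (at t)"
    and bc: "f (ln r0) = 0" "g (ln r2) = 0" "f (ln r1) = g (ln r1)" and flux: "cm * f' (ln r1) = cp * g' (ln r1)"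
    using ep by (auto simp: eigenpair_def)
  have qsm: "C_k_on k UNIV (\<lambda>t. (real n)\<^sup>2 - l / c * exp (2 * t))" for k c
  proof -
    have "C_k_on k UNIV (\<lambda>t::real. exp (2 * t))"
      using C_k_on_compose[OF open_UNIV open_UNIV C_k_on_exp C_k_on_affine[of k 2 0]] by simp
    then show ?thesis by (intro C_k_on_diff C_k_on_const C_k_on_cmult open_UNIV)
  qed
  have sm: "C_k_on k UNIV f" "C_k_on k UNIV f'" "C_k_on k UNIV g" "C_k_on k UNIV g'" for k
    using ode_solution_smooth[OF f qsm] ode_solution_smooth[OF g qsm] by blast+
  note H = H1_0_polar_mode[OF R n sm(1,3) sm(2)[of 0] sm(4)[of 0] f(1) g(1) bc]
  note int = interior_closed_annulus[OF R(1), of r2]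
  have R1: "0 < r1" using R by simp
  have um: "polar_mode n f x = u x" if "x \<in> open_annulus r0 r1" for x
    using open_annulus_ln(1)[OF R(1) that] by (simp add: u_def polar_mode_def)
  have up: "polar_mode n g x = u x" if "x \<in> open_annulus r1 r2" for x
    using open_annulus_ln(1)[OF R1 that] by (simp add: u_def polar_mode_def)
  have sob: "polar_mode n h \<in> sobolev 2 (open_annulus a b)" if "0 < a" "\<And>k. C_k_on k UNIV h" for h a b
    by (rule smooth_imp_sobolev[OF open_open_annulus bounded_open_annulus _ closure_open_annulus_nonzero[OF that(1)]
        C_k_on_polar_mode[OF that(2)]]) auto
  have "u \<in> sobolev 2 (open_annulus r0 r1)"
    by (rule sobolev_cong[OF um sob[OF R(1) sm(1)]])
  moreover have "u \<in> sobolev 2 (open_annulus r1 r2)"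
    by (rule sobolev_cong[OF up sob[OF R1 sm(3)]])
  moreover have "u \<in> H1_0 (interior (closed_annulus r0 r2))" unfolding int u_def by (rule H(1))
  moreover have "has_normal_deriv (open_annulus r0 r1) (circle_measure r1) sgn u (\<lambda>x. f' (ln r1) / r1 * cos_mode n x)"
    by (rule has_normal_deriv_polar_mode[OF R(1) R1 sm(1,2) f(1) um])
  moreover have "has_normal_deriv (open_annulus r1 r2) (circle_measure r1) sgn u (\<lambda>x. g' (ln r1) / r1 * cos_mode n x)"
    by (rule has_normal_deriv_polar_mode[OF R1 R1 sm(3,4) g(1) up])
  moreover have "cm * (f' (ln r1) / r1 * y) = cp * (g' (ln r1) / r1 * y)" for y
    using flux by (metis mult.assoc times_divide_eq_right)
  ultimately show "u \<in> op_domain r0 r1 r2 cm cp" unfolding op_domain_def by blast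
  let ?G = "polar_field n (\<lambda>t. ?F' t * exp (- 2 * t)) (\<lambda>t. ?F t * exp (- 2 * t))"
  let ?X = "polar_field n (\<lambda>t. (if t \<le> ln r1 then cm * f' t else cp * g' t) * exp (- 2 * t))
                    (\<lambda>t. (if t \<le> ln r1 then cm * f t else cp * g t) * exp (- 2 * t))"
  let ?U = "open_annulus r0 r2"
  have wd: "weak_div ?U ?X (\<lambda>x. - (l * u x))"
    unfolding u_def by (rule weak_div_flux[OF R sm(1,3,2,4) f(1) g(1) f(2) g(2) c flux])
  have eqX: "jump_coeff r0 r1 r2 cm cp x *\<^sub>R ?G x = ?X x" if x: "x \<in> ?U" "norm x \<noteq> r1" for x
  proof (cases "norm x < r1")
    case True
    have "ln (norm x) \<le> ln r1" using True open_annulus_ln(2)[OF R(1) x(1)] R1 by simp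
    moreover have "jump_coeff r0 r1 r2 cm cp x = cm" using x True by (simp add: jump_coeff_def open_annulus_def)
    ultimately show ?thesis by (simp add: polar_field_def scaleR_diff_right mult_ac)
  next
    case False
    then have "\<not> ln (norm x) \<le> ln r1" using x(2) open_annulus_ln(2)[OF R(1) x(1)] R1 by simp
    moreover have "jump_coeff r0 r1 r2 cm cp x = cp" using x False by (simp add: jump_coeff_def open_annulus_def)
    ultimately show ?thesis by (simp add: polar_field_def scaleR_diff_right mult_ac)
  qed
  have ae: "AE x in lebesgue_on ?U. jump_coeff r0 r1 r2 cm cp x *\<^sub>R ?G x = ?X x"
  proof -
    have "sphere (0::real^2) r1 \<in> null_sets lebesgue" using negligible_sphere negligible_iff_null_sets by blast
    then have "AE x in lebesgue. x \<notin> sphere (0::real^2) r1" by (rule AE_not_in)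
    then have "AE x in lebesgue. x \<in> ?U \<longrightarrow> jump_coeff r0 r1 r2 cm cp x *\<^sub>R ?G x = ?X x"
    proof (rule eventually_mono)
      fix x assume "x \<notin> sphere (0::real^2) r1"
      then have "norm x \<noteq> r1" by simp
      with eqX show "x \<in> ?U \<longrightarrow> jump_coeff r0 r1 r2 cm cp x *\<^sub>R ?G x = ?X x" by blast
    qed
    then show ?thesis using lmeasurable_open_annulus[of r0 r2] by (subst AE_restrict_space_iff) auto
  qed
  have wg: "weak_grad ?U u ?G" unfolding u_def by (rule H(2))
  have bm: "(\<lambda>x. ?G x \<bullet> b) \<in> borel_measurable (lebesgue_on ?U)" "(\<lambda>x. ?X x \<bullet> b) \<in> borel_measurable (lebesgue_on ?U)"
      if "b \<in> Basis" for b
    using wg wd that unfolding weak_grad_def weak_deriv_def weak_div_def L2_fun_def by blast+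
  have jm: "jump_coeff r0 r1 r2 cm cp \<in> borel_measurable (lebesgue_on ?U)"
  proof -
    have "jump_coeff r0 r1 r2 cm cp \<in> borel_measurable borel"
      unfolding jump_coeff_def[abs_def] using open_open_annulus
          by (auto intro!: borel_measurable_add borel_measurable_times borel_measurable_indicator)
    then show ?thesis by (intro measurable_restrict_space1 measurable_completion) simp
  qed
  have "weak_div ?U (\<lambda>x. jump_coeff r0 r1 r2 cm cp x *\<^sub>R ?G x) (\<lambda>x. - (l * u x))"
  proof -
    have "L2_fun (lebesgue_on ?U) (\<lambda>x. (jump_coeff r0 r1 r2 cm cp x *\<^sub>R ?G x) \<bullet> b)" if b: "b \<in> Basis" for b
    proof -
      have X: "L2_fun (lebesgue_on ?U) (\<lambda>x. ?X x \<bullet> b)" using wd b unfolding weak_div_def by blast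
      have m: "(\<lambda>x. (jump_coeff r0 r1 r2 cm cp x *\<^sub>R ?G x) \<bullet> b) \<in> borel_measurable (lebesgue_on ?U)"
        unfolding inner_scaleR_left by (rule borel_measurable_times[OF jm bm(1)[OF b]])
      have "integrable (lebesgue_on ?U) (\<lambda>x. ((jump_coeff r0 r1 r2 cm cp x *\<^sub>R ?G x) \<bullet> b)\<^sup>2)
          \<longleftrightarrow> integrable (lebesgue_on ?U) (\<lambda>x. (?X x \<bullet> b)\<^sup>2)"
      proof (rule integrable_cong_AE)
        show "AE x in lebesgue_on ?U. ((jump_coeff r0 r1 r2 cm cp x *\<^sub>R ?G x) \<bullet> b)\<^sup>2 = (?X x \<bullet> b)\<^sup>2"
          using ae by eventually_elim (simp only:)
      qed (use borel_measurable_power[OF m] borel_measurable_power[OF bm(2)[OF b]] in blast)+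
      then show ?thesis using X m by (simp only: L2_fun_def)
    qed
    moreover have "(\<integral>x. frechet_derivative \<phi> (at x) (jump_coeff r0 r1 r2 cm cp x *\<^sub>R ?G x) \<partial>lebesgue_on ?U)
        = (\<integral>x. frechet_derivative \<phi> (at x) (?X x) \<partial>lebesgue_on ?U)" if \<phi>: "test_fun ?U \<phi>" for \<phi>
    proof (rule integral_cong_AE)
      have m: "(\<lambda>x. frechet_derivative \<phi> (at x) (Z x)) \<in> borel_measurable (lebesgue_on ?U)"
        if Z: "\<And>b. b \<in> Basis \<Longrightarrow> (\<lambda>x. Z x \<bullet> b) \<in> borel_measurable (lebesgue_on ?U)" for Z
      proof -
        have "frechet_derivative \<phi> (at x) (Z x) = (\<Sum>b\<in>Basis. Z x \<bullet> b * frechet_derivative \<phi> (at x) b)" for x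
          by (rule test_fun_derivative_coordinates[OF \<phi>])
        moreover have "(\<lambda>x. \<Sum>b\<in>Basis. Z x \<bullet> b * frechet_derivative \<phi> (at x) b) \<in> borel_measurable (lebesgue_on ?U)"
          using Z test_fun_measurable[OF \<phi>] lmeasurable_open_annulus
              by (intro borel_measurable_sum borel_measurable_times) auto
        ultimately show ?thesis by simp
      qed
      show "(\<lambda>x. frechet_derivative \<phi> (at x) (jump_coeff r0 r1 r2 cm cp x *\<^sub>R ?G x)) \<in> borel_measurable (lebesgue_on
          ?U)"
        by (rule m) (unfold inner_scaleR_left, rule borel_measurable_times[OF jm bm(1)])
      show "(\<lambda>x. frechet_derivative \<phi> (at x) (?X x)) \<in> borel_measurable (lebesgue_on ?U)" by (rule m[OF bm(2)])
      show "AE x in lebesgue_on ?U. frechet_derivative \<phi> (at x) (jump_coeff r0 r1 r2 cm cp x *\<^sub>R ?G x)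
          = frechet_derivative \<phi> (at x) (?X x)"
        using ae by eventually_elim (simp only:)
    qed
    ultimately show ?thesis using wd unfolding weak_div_def by simp
  qed
  then show "neg_div_grad (interior (closed_annulus r0 r2)) (jump_coeff r0 r1 r2 cm cp) u (\<lambda>x. l * u x)"
    unfolding neg_div_grad_def int using wg by blast
qed

section \<open>The mass of a separated function\<close>

text \<open>
  It is enough to compare the two measures on boxes, whose preimages are images under the inverse.
\<close>

lemma lborel_distr_orthogonal:
  fixes T :: "real^2 \<Rightarrow> real^2"
  assumes T: "orthogonal_transformation T"
  shows "distr lborel borel T = lborel"
proof (rule lborel_eqI[symmetric])
  have T': "orthogonal_transformation (inv T)" and bij: "bij T"
    using T orthogonal_transformation_inv orthogonal_transformation_bij by auto
  have "continuous_on UNIV T" using T by (intro linear_continuous_on) (simp add: orthogonal_transformation_linear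
      linear_conv_bounded_linear[symmetric])
  then have m: "T \<in> borel_measurable borel" by (rule borel_measurable_continuous_onI)
  fix l u :: "real^2" assume lu: "\<And>b. b \<in> Basis \<Longrightarrow> l \<bullet> b \<le> u \<bullet> b"
  have pre: "T -` box l u = inv T ` box l u" using bij by (simp add: bij_vimage_eq_inv_image)
  have lm: "inv T ` box l u \<in> lmeasurable" "measure lebesgue (inv T ` box l u) = measure lebesgue (box l u)"
    using measurable_orthogonal_image[OF T', of "box l u"] measure_orthogonal_image[OF T', of "box l u"] by simp_all
  have sb: "T -` box l u \<in> sets borel" using measurable_sets[OF m, of "box l u"] by simp
  have "emeasure (distr lborel borel T) (box l u) = emeasure lborel (T -` box l u)"
    using m by (simp add: emeasure_distr)
  also have "\<dots> = emeasure lebesgue (inv T ` box l u)" using sb by (simp add: pre)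
  also have "\<dots> = emeasure lebesgue (box l u)"
    using lm by (simp add: emeasure_eq_measure2)
  also have "\<dots> = emeasure lborel (box l u)" by simp
  also have "\<dots> = (\<Prod>b\<in>Basis. (u - l) \<bullet> b)" using lu by (simp add: emeasure_lborel_box)
  finally show "emeasure (distr lborel borel T) (box l u) = (\<Prod>b\<in>Basis. (u - l) \<bullet> b)" .
qed simp

definition rotation :: "real \<Rightarrow> real^2 \<Rightarrow> real^2" where
  "rotation \<alpha> x = vector [cos \<alpha> * x $ 1 - sin \<alpha> * x $ 2, sin \<alpha> * x $ 1 + cos \<alpha> * x $ 2]"

lemma norm_rotation: "norm (rotation \<alpha> x) = norm x"
proof -
  have "(norm (rotation \<alpha> x))\<^sup>2 = ((cos \<alpha>)\<^sup>2 + (sin \<alpha>)\<^sup>2) * ((x $ 1)\<^sup>2 + (x $ 2)\<^sup>2)"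
    unfolding norm_real2 rotation_def vector_2 unfolding power2_eq_square by algebra
  then have "(norm (rotation \<alpha> x))\<^sup>2 = (norm x)\<^sup>2" unfolding sin_cos_squared_add2 norm_real2[of x] by simp
  then show ?thesis by (simp add: power2_eq_iff_nonneg)
qed

lemma orthogonal_rotation: "orthogonal_transformation (rotation \<alpha>)"
proof -
  have "linear (rotation \<alpha>)"
    by (rule linearI) (simp_all add: rotation_def vec_eq_iff forall_2 vector_2 algebra_simps)
  then show ?thesis by (simp add: orthogonal_transformation norm_rotation)
qed

lemma cos_mode_rotation:
  assumes "n \<ge> 1"
  shows "cos_mode n (rotation (pi / (2 * real n)) x) = - sin_mode n x"
proof -
  let ?\<alpha> = "pi / (2 * real n)"
  have "Complex (rotation ?\<alpha> x $ 1) (rotation ?\<alpha> x $ 2) = cis ?\<alpha> * Complex (x $ 1) (x $ 2)"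
    by (simp add: rotation_def vector_2 complex_eq_iff)
  then have "sgn (Complex (rotation ?\<alpha> x $ 1) (rotation ?\<alpha> x $ 2)) ^ n
      = cis ?\<alpha> ^ n * sgn (Complex (x $ 1) (x $ 2)) ^ n"
    by (simp add: sgn_mult power_mult_distrib sgn_cis)
  moreover have "cis ?\<alpha> ^ n = \<i>"
  proof -
    have "cis ?\<alpha> ^ n = cis (real n * ?\<alpha>)" by (rule Complex.DeMoivre)
    also have "real n * ?\<alpha> = pi / 2" using assms by simp
    finally show ?thesis by (simp add: cis_pi_half)
  qed
  ultimately show ?thesis by (simp add: cos_mode_def sin_mode_def)
qed

lemma mode_borel: "cos_mode n \<in> borel_measurable borel" "sin_mode n \<in> borel_measurable borel"
proof (induction n)
  case 0
  { case 1 show ?case by (simp add: mode_0[abs_def]) }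
  { case 2 show ?case by (simp add: mode_0[abs_def]) }
next
  case (Suc n)
  have d: "(\<lambda>x::real^2. x $ i / norm x) \<in> borel_measurable borel" for i
  proof (rule borel_measurable_divide)
    show "(\<lambda>x::real^2. x $ i) \<in> borel_measurable borel" by (intro borel_measurable_continuous_onI continuous_intros)
  qed auto
  { case 1 show ?case unfolding mode_Suc[abs_def] by (intro borel_measurable_diff borel_measurable_times d Suc) }
  { case 2 show ?case unfolding mode_Suc[abs_def] by (intro borel_measurable_add borel_measurable_times d Suc) }
qed

lemma radial_borel:
  assumes "continuous_on UNIV F" shows "(\<lambda>x::real^2. F (ln (norm x))) \<in> borel_measurable borel"
  using measurable_compose[OF _ borel_measurable_continuous_onI[OF assms], of "\<lambda>x::real^2. ln (norm x)" borel]
  by (simp add: borel_measurable_ln)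

lemma bounded_on_annulus:
  fixes F :: "real \<Rightarrow> real"
  assumes "0 < a" "continuous_on UNIV F"
  obtains B where "\<And>x. x \<in> closed_annulus a b \<Longrightarrow> \<bar>F (ln (norm x))\<bar> \<le> B"
proof -
  obtain B where B: "\<And>t. t \<in> {ln a..ln b} \<Longrightarrow> \<bar>F t\<bar> \<le> B"
    using bounded_on_Icc[of F "ln a" "ln b"] assms(2) by auto
  show ?thesis by (rule that[of B]) (rule B[OF closed_annulus_ln(1)[OF assms(1)]])
qed

lemma integrable_radial_times_bounded:
  fixes F :: "real \<Rightarrow> real" and Y :: "real^2 \<Rightarrow> real"
  assumes a: "0 < a" and F: "continuous_on UNIV F" and Y: "Y \<in> borel_measurable borel" "\<And>x. \<bar>Y x\<bar> \<le> 1"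
    and S: "S \<in> sets lebesgue" "S \<subseteq> closed_annulus a b"
  shows "integrable (lebesgue_on S) (\<lambda>x. (F (ln (norm x)) * Y x)\<^sup>2)"
proof -
  obtain B where B: "\<And>x. x \<in> closed_annulus a b \<Longrightarrow> \<bar>F (ln (norm x))\<bar> \<le> B" using bounded_on_annulus[OF a F] by blast
  have m: "(\<lambda>x. F (ln (norm x)) * Y x) \<in> borel_measurable lebesgue"
    using borel_measurable_times[OF radial_borel[OF F] Y(1)] by (simp add: measurable_completion)
  have "S \<in> lmeasurable" using S bounded_subset[OF bounded_closed_annulus S(2)]
      by (simp add: bounded_set_imp_lmeasurable)
  then have "L2_fun (lebesgue_on S) (\<lambda>x. F (ln (norm x)) * Y x)"
  proof (rule L2_fun_bounded)
    show "(\<lambda>x. F (ln (norm x)) * Y x) \<in> borel_measurable (lebesgue_on S)" using m by (rule measurable_restrict_space1)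
    show "\<bar>F (ln (norm x)) * Y x\<bar> \<le> B * 1" if "x \<in> S" for x
      unfolding abs_mult using B[of x] that S(2) Y(2)[of x]
          by (intro mult_mono) (auto intro: order_trans[OF abs_ge_zero])
  qed
  then show ?thesis by (simp add: L2_fun_def)
qed

text \<open>
  A rotation by a quarter of the angular period turns \<open>cos\<^sup>2\<close> into \<open>sin\<^sup>2\<close>, so both contribute the same
  amount, and together they add up to \<open>1\<close>.
\<close>

lemma mass_of_mode:
  assumes a: "0 < a" and F: "continuous_on UNIV F" and n: "n \<ge> 1"
  shows "2 * (\<integral>x. (polar_mode n F x)\<^sup>2 \<partial>lebesgue_on (closed_annulus a b))
      = (\<integral>x. (F (ln (norm x)))\<^sup>2 \<partial>lebesgue_on (closed_annulus a b))"
proof -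
  let ?S = "closed_annulus a b"
  have S: "?S \<in> sets lebesgue" "?S \<in> sets borel" using closed_closed_annulus by auto
  have lb: "(\<integral>x. h x \<partial>lebesgue_on ?S) = (\<integral>x. indicator ?S x * h x \<partial>lborel)"
      if "h \<in> borel_measurable borel" for h :: "real^2 \<Rightarrow> real"
  proof -
    have "(\<integral>x. h x \<partial>lebesgue_on ?S) = (\<integral>x. indicator ?S x *\<^sub>R h x \<partial>lebesgue)" using S
        by (intro integral_restrict_space) auto
    also have "\<dots> = (\<integral>x. indicator ?S x *\<^sub>R h x \<partial>lborel)"
      using that S by (intro integral_completion) (auto intro!: borel_measurable_times borel_measurable_indicator)
    finally show ?thesis by simp
  qed
  define C where "C x = (F (ln (norm x)) * cos_mode n x)\<^sup>2" for x
  define D where "D x = (F (ln (norm x)) * sin_mode n x)\<^sup>2" for x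
  have bm: "C \<in> borel_measurable borel" "D \<in> borel_measurable borel"
    unfolding C_def D_def using radial_borel[OF F] mode_borel
        by (auto intro!: borel_measurable_power borel_measurable_times)
  let ?T = "rotation (pi / (2 * real n))"
  have Tm: "?T \<in> borel_measurable borel"
    using orthogonal_rotation by (intro borel_measurable_continuous_onI linear_continuous_on) (simp add:
        orthogonal_transformation_linear linear_conv_bounded_linear[symmetric])
  have iC: "(\<lambda>x. indicator ?S x * C x) \<in> borel_measurable borel" using bm S
      by (auto intro!: borel_measurable_times borel_measurable_indicator)
  have "(\<integral>x. indicator ?S x * C x \<partial>lborel) = (\<integral>x. indicator ?S x * C x \<partial>distr lborel borel ?T)"
    by (simp only: lborel_distr_orthogonal[OF orthogonal_rotation])
  also have "\<dots> = (\<integral>x. indicator ?S (?T x) * C (?T x) \<partial>lborel)"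
    using Tm iC by (intro integral_distr) auto
  also have "\<dots> = (\<integral>x. indicator ?S x * D x \<partial>lborel)"
  proof (rule Bochner_Integration.integral_cong[OF refl])
    fix x
    have "indicator ?S (?T x) = (indicator ?S x :: real)"
        by (simp add: indicator_def closed_annulus_def norm_rotation)
    then show "indicator ?S (?T x) * C (?T x) = indicator ?S x * D x"
      by (simp add: C_def D_def norm_rotation cos_mode_rotation[OF n])
  qed
  finally have CD: "(\<integral>x. C x \<partial>lebesgue_on ?S) = (\<integral>x. D x \<partial>lebesgue_on ?S)" using lb bm by simp
  have i: "integrable (lebesgue_on ?S) C" "integrable (lebesgue_on ?S) D"
    unfolding C_def D_def by (rule integrable_radial_times_bounded[OF a F mode_borel(1) mode_le_1(1) S(1) order_refl]
        integrable_radial_times_bounded[OF a F mode_borel(2) mode_le_1(2) S(1) order_refl])+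
  have "(\<integral>x. (F (ln (norm x)))\<^sup>2 \<partial>lebesgue_on ?S) = (\<integral>x. C x + D x \<partial>lebesgue_on ?S)"
  proof (rule Bochner_Integration.integral_cong[OF refl])
    fix x assume "x \<in> space (lebesgue_on ?S)"
    then have "x \<noteq> 0" using closed_annulus_nonzero[OF a] by auto
    have "C x + D x = (F (ln (norm x)))\<^sup>2 * ((cos_mode n x)\<^sup>2 + (sin_mode n x)\<^sup>2)"
      by (simp add: C_def D_def power_mult_distrib distrib_left)
    then show "(F (ln (norm x)))\<^sup>2 = C x + D x" unfolding mode_squares[OF \<open>x \<noteq> 0\<close>] by simp
  qed
  also have "\<dots> = 2 * (\<integral>x. C x \<partial>lebesgue_on ?S)" using i CD by simp
  finally show ?thesis by (simp add: C_def polar_mode_def)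
qed

lemma measure_closed_annulus_pos:
  assumes "0 < a" "a < b" shows "measure lebesgue (closed_annulus a b) > 0"
proof -
  have "open_annulus a b \<noteq> {}"
  proof -
    have "norm (((a + b) / 2) *\<^sub>R (axis 1 1 :: real^2)) = (a + b) / 2" using assms by simp
    then have "((a + b) / 2) *\<^sub>R axis 1 1 \<in> open_annulus a b" unfolding open_annulus_def using assms by simp
    then show ?thesis by blast
  qed
  then have "\<not> negligible (open_annulus a b)" using open_not_negligible open_open_annulus by blast
  then have "\<not> negligible (closed_annulus a b)" using negligible_subset open_subset_closed_annulus by blast
  then have "measure lebesgue (closed_annulus a b) \<noteq> 0" using negligible_iff_measure0[OF lmeasurable_closed_annulus]
      by simp
  then show ?thesis using measure_nonneg[of lebesgue "closed_annulus a b"] by linarith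
qed

lemma mass_lower_bound:
  assumes a: "0 < a" and F: "continuous_on UNIV F" and n: "n \<ge> 1" 
    and sub: "a \<le> a'" "b' \<le> b" and v: "\<And>t. t \<in> {ln a'..ln b'} \<Longrightarrow> v \<le> (F t)\<^sup>2"
  shows "v * measure lebesgue (closed_annulus a' b')
      \<le> 2 * (\<integral>x. (polar_mode n F x)\<^sup>2 \<partial>lebesgue_on (closed_annulus a b))"
proof -
  let ?S = "closed_annulus a b" and ?A = "closed_annulus a' b'"
  have AS: "?A \<subseteq> ?S" using sub by (auto simp: closed_annulus_def)
  have S: "?S \<in> sets lebesgue" "?A \<in> sets lebesgue" using closed_closed_annulus by auto
  have int: "integrable (lebesgue_on ?S) (\<lambda>x. (F (ln (norm x)))\<^sup>2)"
    using integrable_radial_times_bounded[OF a F, of "\<lambda>_. 1" ?S b] S by simp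
  have fin: "finite_measure (lebesgue_on ?S)" by (rule finite_measure_lebesgue_on[OF lmeasurable_closed_annulus])
  have "v * measure lebesgue ?A = v * measure (lebesgue_on ?S) ?A"
    using S AS by (simp add: measure_restrict_space)
  also have "\<dots> = (\<integral>x. v * indicator ?A x \<partial>lebesgue_on ?S)"
    using AS S by (simp add: Int_absorb2)
  also have "\<dots> \<le> (\<integral>x. (F (ln (norm x)))\<^sup>2 \<partial>lebesgue_on ?S)"
  proof (rule integral_mono[OF _ int])
    show "integrable (lebesgue_on ?S) (\<lambda>x. v * indicator ?A x)"
      using S AS finite_measure.emeasure_finite[OF fin]
          by (auto intro!: integrable_mult_right integrable_real_indicator simp: sets_restrict_space_iff
          top.not_eq_extremum)
    fix x
    show "v * indicator ?A x \<le> (F (ln (norm x)))\<^sup>2"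
      using v[of "ln (norm x)"] closed_annulus_ln(1)[of a' x b'] a sub by (auto simp: indicator_def)
  qed
  finally show ?thesis unfolding mass_of_mode[OF a F n] .
qed

lemma L2_norm_le_sup:
  assumes a: "0 < a" and F: "continuous_on UNIV F" and S: "S \<in> sets lebesgue" "S \<subseteq> closed_annulus a b"
    and B: "B \<ge> 0" "\<And>x. x \<in> S \<Longrightarrow> (F (ln (norm x)))\<^sup>2 \<le> B"
  shows "(L2_norm (lebesgue_on S) (polar_mode n F))\<^sup>2 \<le> B * measure lebesgue (closed_annulus a b)"
proof -
  let ?M = "closed_annulus a b"
  have Sl: "S \<in> lmeasurable" using S bounded_subset[OF bounded_closed_annulus S(2)]
      by (simp add: bounded_set_imp_lmeasurable)
  interpret finite_measure "lebesgue_on S" by (rule finite_measure_lebesgue_on[OF Sl])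
  have nn: "0 \<le> (\<integral>x. (polar_mode n F x)\<^sup>2 \<partial>lebesgue_on S)" by simp
  have "(\<integral>x. (polar_mode n F x)\<^sup>2 \<partial>lebesgue_on S) \<le> (\<integral>x. B \<partial>lebesgue_on S)"
  proof (rule integral_mono)
    show "integrable (lebesgue_on S) (\<lambda>x. (polar_mode n F x)\<^sup>2)" unfolding polar_mode_def
      by (rule integrable_radial_times_bounded[OF a F mode_borel(1) mode_le_1(1) S])
    show "(polar_mode n F x)\<^sup>2 \<le> B" if "x \<in> space (lebesgue_on S)" for x
    proof -
      have "(cos_mode n x)\<^sup>2 \<le> 1" using mode_le_1(1)[of n x] by (simp add: abs_square_le_1)
      then have "(F (ln (norm x)))\<^sup>2 * (cos_mode n x)\<^sup>2 \<le> B * 1" using B that by (intro mult_mono) auto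
      then show ?thesis by (simp add: polar_mode_def power_mult_distrib)
    qed
  qed simp
  also have "\<dots> = B * measure lebesgue S" using Sl by (simp add: measure_restrict_space)
  also have "\<dots> \<le> B * measure lebesgue ?M"
    using B(1) S(2) Sl lmeasurable_closed_annulus by (intro mult_left_mono measure_mono_fmeasurable) auto
  finally show ?thesis using nn by (simp add: L2_norm_def)
qed

lemma L2_norm_mono_set:
  assumes a: "0 < a" and F: "continuous_on UNIV F" and S: "S \<in> sets lebesgue" "S \<subseteq> closed_annulus a b"
  shows "L2_norm (lebesgue_on S) (polar_mode n F) \<le> L2_norm (lebesgue_on (closed_annulus a b)) (polar_mode n F)"
proof -
  let ?M = "closed_annulus a b" and ?h = "\<lambda>x. (polar_mode n F x)\<^sup>2"
  have M: "?M \<in> sets lebesgue" using closed_closed_annulus by auto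
  have i: "integrable (lebesgue_on T) ?h" if "T \<in> sets lebesgue" "T \<subseteq> ?M" for T
    unfolding polar_mode_def by (rule integrable_radial_times_bounded[OF a F mode_borel(1) mode_le_1(1) that])
  have iT: "integrable lebesgue (\<lambda>x. indicator T x *\<^sub>R ?h x)"
      "(\<integral>x. ?h x \<partial>lebesgue_on T) = (\<integral>x. indicator T x *\<^sub>R ?h x \<partial>lebesgue)"
    if "T \<in> sets lebesgue" "T \<subseteq> ?M" for T
    using i[OF that] that by (simp_all add: integrable_restrict_space integral_restrict_space)
  have "(\<integral>x. ?h x \<partial>lebesgue_on S) \<le> (\<integral>x. ?h x \<partial>lebesgue_on ?M)"
    unfolding iT(2)[OF S] iT(2)[OF M order_refl]
    by (rule integral_mono[OF iT(1)[OF S] iT(1)[OF M order_refl]]) (use S(2) in \<open>auto simp: indicator_def\<close>)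
  then show ?thesis by (simp add: L2_norm_def)
qed

section \<open>Concentration at the interface\<close>

lemma eigenpair_scale:
  assumes "eigenpair a b c cm cp n l f f' g g'"
  shows "eigenpair a b c cm cp n l (\<lambda>t. k * f t) (\<lambda>t. k * f' t) (\<lambda>t. k * g t) (\<lambda>t. k * g' t)"
proof -
  have d: "((\<lambda>t. k * h t) has_real_derivative q * (k * y)) (at t)"
      if "(h has_real_derivative q * y) (at t)" for h :: "real \<Rightarrow> real" and q y t
    using DERIV_cmult[OF that, of k] by (simp add: mult.left_commute)
  show ?thesis using assms unfolding eigenpair_def
      by (auto intro!: DERIV_cmult d simp: mult.left_commute[of cm] mult.left_commute[of cp])
qed

lemma eigenpair_continuous:
  assumes "eigenpair a b c cm cp n l f f' g g'"
  shows "continuous_on UNIV (glue b f g)"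
proof -
  have "continuous_on UNIV f" "continuous_on UNIV g" "f b = g b"
    using assms by (auto simp: eigenpair_def continuous_on_eq_continuous_at intro: DERIV_isCont)
  then show ?thesis
    by (intro continuous_on_cases_le[where h = "\<lambda>t. t"]) (auto intro: continuous_on_subset continuous_on_id)
qed

text \<open>
  The norm is positive: near \<open>ln r0\<close> the solution is positive because its slope there is \<open>1\<close>. The
  equations are linear, so a multiple of it has norm one.
\<close>

lemma eigenpair_normalised:
  assumes R: "0 < r0" "r0 < r1" "r1 < r2" and n: "n \<ge> 1"
    and ep: "eigenpair (ln r0) (ln r1) (ln r2) cm cp n l f f' g g'" and f1: "f' (ln r0) = 1"
  shows "\<exists>f f' g g'. eigenpair (ln r0) (ln r1) (ln r2) cm cp n l f f' g g' \<and>
     L2_norm (lebesgue_on (closed_annulus r0 r2)) (polar_mode n (glue (ln r1) f g)) = 1"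
proof -
  let ?M = "lebesgue_on (closed_annulus r0 r2)"
  let ?F = "glue (ln r1) f g"
  have ln: "ln r0 < ln r1" "ln r1 < ln r2" using R by auto
  have F: "continuous_on UNIV ?F" by (rule eigenpair_continuous[OF ep])
  have f: "(f has_real_derivative f' (ln r0)) (at (ln r0))" "f (ln r0) = 0" using ep by (auto simp: eigenpair_def)
  obtain d where d: "d > 0" "\<And>h. h > 0 \<Longrightarrow> h < d \<Longrightarrow> f (ln r0) < f (ln r0 + h)"
    using DERIV_pos_inc_right[OF f(1)] f1 by auto
  define s where "s = min d (ln r1 - ln r0) / 2"
  have s: "s > 0" "s < d" "ln r0 + s < ln r1" using d(1) ln by (auto simp: s_def min_def field_simps)
  define J where "J = {ln r0 + s / 2..ln r0 + s}"
  have Jpos: "?F t > 0" if "t \<in> J" for t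
    using d(2)[of "t - ln r0"] that s f(2) by (auto simp: J_def)
  have "\<exists>t0\<in>J. \<forall>t\<in>J. (?F t0)\<^sup>2 \<le> (?F t)\<^sup>2"
    by (rule continuous_attains_inf) (use s in \<open>auto simp: J_def intro!: continuous_on_power continuous_on_subset[OF
        F]\<close>)
  then obtain t0 where t0: "t0 \<in> J" "\<And>t. t \<in> J \<Longrightarrow> (?F t0)\<^sup>2 \<le> (?F t)\<^sup>2" by blast
  define v where "v = (?F t0)\<^sup>2"
  have v: "v > 0" unfolding v_def using Jpos[OF t0(1)] by (rule zero_less_power)
  define I where "I = (\<integral>x. (polar_mode n ?F x)\<^sup>2 \<partial>?M)"
  have "v * measure lebesgue (closed_annulus (exp (ln r0 + s / 2)) (exp (ln r0 + s))) \<le> 2 * I"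
    unfolding I_def
  proof (rule mass_lower_bound[OF R(1) F n])
    show "r0 \<le> exp (ln r0 + s / 2)" using s R by (simp add: exp_add)
    have "exp (ln r0 + s) \<le> exp (ln r2)" using s ln by (subst exp_le_cancel_iff) linarith
    then show "exp (ln r0 + s) \<le> r2" using R by simp
    show "v \<le> (?F t)\<^sup>2" if "t \<in> {ln (exp (ln r0 + s / 2))..ln (exp (ln r0 + s))}" for t
      unfolding v_def using that by (intro t0(2)) (simp add: J_def)
  qed
  moreover have "measure lebesgue (closed_annulus (exp (ln r0 + s / 2)) (exp (ln r0 + s))) > 0"
    using s by (intro measure_closed_annulus_pos) auto
  then have "v * measure lebesgue (closed_annulus (exp (ln r0 + s / 2)) (exp (ln r0 + s))) > 0" using v by simp
  ultimately have I: "I > 0" by linarith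
  define k where "k = 1 / sqrt I"
  have "polar_mode n (\<lambda>t. if t \<le> ln r1 then k * f t else k * g t) x = k * polar_mode n ?F x" for x
    by (simp add: polar_mode_def)
  then have "(\<integral>x. (polar_mode n (\<lambda>t. if t \<le> ln r1 then k * f t else k * g t) x)\<^sup>2 \<partial>?M) = k\<^sup>2 * I"
    by (simp add: power_mult_distrib I_def)
  also have "\<dots> = 1" using I by (simp add: k_def power_divide)
  finally have "L2_norm ?M (polar_mode n (\<lambda>t. if t \<le> ln r1 then k * f t else k * g t)) = 1" by (simp add: L2_norm_def)
  then show ?thesis using eigenpair_scale[OF ep, of k] by blast
qed

text \<open>
  A point at distance \<open>\<eta>\<close> from the interface has logarithmic distance at least \<open>3 * \<delta>\<close> from it. In between lies an
  interval of times, at distance between \<open>\<delta>\<close> and \<open>2 * \<delta>\<close> from the interface, on which \<open>F\<^sup>2\<close> is larger by an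
  exponential factor. Since the mass over the corresponding annulus is at most two, \<open>F\<^sup>2\<close> is exponentially small
  at the given point.
\<close>

lemma eigenpair_concentration:
  assumes R: "0 < r0" "r0 < r1" "r1 < r2" and c: "0 < cm" "0 < cp" and gap: "cm / r1\<^sup>2 < cp / r2\<^sup>2"
    and \<eta>: "\<eta> > 0"
  obtains B d \<epsilon> where "B > 0" "d > 0" "\<epsilon> > 0"
    "\<And>n l f f' g g' S. \<lbrakk>n \<ge> 1; eigenpair (ln r0) (ln r1) (ln r2) cm cp n l f f' g g'; l
        \<le> cm / r1\<^sup>2 * (1 + \<epsilon>) * (real n)\<^sup>2;
        L2_norm (lebesgue_on (closed_annulus r0 r2)) (polar_mode n (glue (ln r1) f g)) = 1;
        S \<in> sets lebesgue; S \<subseteq> closed_annulus r0 r2; \<And>x. x \<in> S \<Longrightarrow> \<bar>norm x - r1\<bar> \<ge> \<eta>\<rbrakk>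
     \<Longrightarrow> L2_norm (lebesgue_on S) (polar_mode n (glue (ln r1) f g)) \<le> B * exp (- d * real n)"
proof -
  let ?a = "ln r0" and ?b = "ln r1" and ?c = "ln r2"
  have R12: "0 < r1" "0 < r2" using R by auto
  have ln: "?a < ?b" "?b < ?c" using R by auto
  define \<delta> where "\<delta> = min (?b - ln (max (r1 - \<eta>) r0)) (min (ln (r1 + \<eta>) - ?b) (min (?b - ?a) (?c - ?b))) / 3"
  have "max (r1 - \<eta>) r0 > 0" using R by auto
  then have "ln (max (r1 - \<eta>) r0) < ?b" "ln (r1 + \<eta>) > ?b" using R R12 \<eta> by auto
  then have \<delta>: "\<delta> > 0" using ln by (simp add: \<delta>_def)
  have \<delta>3: "3 * \<delta> \<le> ?b - ln (max (r1 - \<eta>) r0)" "3 * \<delta> \<le> ln (r1 + \<eta>) - ?b" "3 * \<delta> \<le> ?b - ?a" "3 * \<delta> \<le> ?c - ?b"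
    by (simp_all add: \<delta>_def)
  have E: "cm * exp (- 2 * ?b) = cm / r1\<^sup>2" "cp * exp (- 2 * ?c) = cp / r2\<^sup>2"
    using R12 by (simp_all add: exp_minus exp_double divide_inverse)
  obtain \<kappa> \<epsilon> where k: "\<kappa> > 0" "\<epsilon> > 0"
    and kf: "\<And>n l f f' g g' t t'. eigenpair ?a ?b ?c cm cp n l f f' g g' \<Longrightarrow> l \<le> cm / r1\<^sup>2 * (1 + \<epsilon>) * (real n)\<^sup>2 \<Longrightarrow>
       ?a \<le> t \<Longrightarrow> t \<le> t' \<Longrightarrow> t' \<le> ?b - \<delta> \<Longrightarrow> (f t)\<^sup>2 \<le> exp (- (2 * (\<kappa> * real n) * (t' - t))) * (f t')\<^sup>2"
    and kg: "\<And>n l f f' g g' t t'. eigenpair ?a ?b ?c cm cp n l f f' g g' \<Longrightarrow> l \<le> cm / r1\<^sup>2 * (1 + \<epsilon>) * (real n)\<^sup>2 \<Longrightarrow>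
       ?b \<le> t' \<Longrightarrow> t' \<le> t \<Longrightarrow> t \<le> ?c \<Longrightarrow> (g t)\<^sup>2 \<le> exp (- (2 * (\<kappa> * real n) * (t - t'))) * (g t')\<^sup>2"
    by (rule eigenpair_decay[of cm cp ?b ?c \<delta> ?a, unfolded E, OF c gap \<delta>]) blast
  define A where "A = min (measure lebesgue (closed_annulus (exp (?b - 2 * \<delta>)) (exp (?b - \<delta>))))
       (measure lebesgue (closed_annulus (exp (?b + \<delta>)) (exp (?b + 2 * \<delta>))))"
  have A: "A > 0" unfolding A_def using \<delta> by (simp add: measure_closed_annulus_pos)
  define Q where "Q = measure lebesgue (closed_annulus r0 r2)"
  have Q: "Q > 0" unfolding Q_def using R by (intro measure_closed_annulus_pos) auto
  define B where "B = sqrt (2 / A * Q)"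
  show ?thesis
  proof (rule that[of B "\<kappa> * \<delta>" \<epsilon>])
    show "B > 0" using A Q by (simp add: B_def)
    show "\<kappa> * \<delta> > 0" using k \<delta> by simp
    show "\<epsilon> > 0" by (rule k)
    fix n :: nat and l :: real and f f' g g' :: "real \<Rightarrow> real" and S :: "(real^2) set"
    let ?F = "glue ?b f g"
    assume n: "n \<ge> 1" and ep: "eigenpair ?a ?b ?c cm cp n l f f' g g'" and l: "l \<le> cm / r1\<^sup>2 * (1 + \<epsilon>) * (real n)\<^sup>2"
      and norm1: "L2_norm (lebesgue_on (closed_annulus r0 r2)) (polar_mode n ?F) = 1"
      and S: "S \<in> sets lebesgue" "S \<subseteq> closed_annulus r0 r2" and far: "\<And>x. x \<in> S \<Longrightarrow> \<bar>norm x - r1\<bar> \<ge> \<eta>"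
    have F: "continuous_on UNIV ?F" by (rule eigenpair_continuous[OF ep])
    have I: "(\<integral>x. (polar_mode n ?F x)\<^sup>2 \<partial>lebesgue_on (closed_annulus r0 r2)) = 1"
      using norm1 by (simp add: L2_norm_def)
    define \<theta> where "\<theta> = exp (- (2 * (\<kappa> * real n) * \<delta>))"
    have \<theta>: "\<theta> > 0" by (simp add: \<theta>_def)
    \<comment> \<open>values at distance \<open>3 \<delta>\<close> are dominated by those on a whole interval\<close>
    have conc: "(?F t)\<^sup>2 \<le> 2 / A * \<theta>"
      if J: "ln (exp u) = u" "?a \<le> u" "w \<le> ?c" "measure lebesgue (closed_annulus (exp u) (exp w)) \<ge> A"
        and dom: "\<And>t'. t' \<in> {u..w} \<Longrightarrow> (?F t)\<^sup>2 \<le> \<theta> * (?F t')\<^sup>2" for t u w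
    proof -
      have "(?F t)\<^sup>2 / \<theta> * A \<le> (?F t)\<^sup>2 / \<theta> * measure lebesgue (closed_annulus (exp u) (exp w))"
        using J(4) \<theta> by (intro mult_left_mono) auto
      also have "\<dots> \<le> 2 * (\<integral>x. (polar_mode n ?F x)\<^sup>2 \<partial>lebesgue_on (closed_annulus r0 r2))"
      proof (rule mass_lower_bound[OF R(1) F n])
        have "exp ?a \<le> exp u" "exp w \<le> exp ?c" using J(2,3) by auto
        then show "r0 \<le> exp u" "exp w \<le> r2" using R(1) R12 by auto
        show "(?F t)\<^sup>2 / \<theta> \<le> (?F t')\<^sup>2" if "t' \<in> {ln (exp u)..ln (exp w)}" for t'
          using dom[of t'] that \<theta> by (simp add: pos_divide_le_eq mult.commute)
      qed
      finally show ?thesis unfolding I using A \<theta> by (simp add: field_simps)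
    qed
    have bound: "(?F (ln (norm x)))\<^sup>2 \<le> 2 / A * \<theta>" if x: "x \<in> S" for x
    proof -
      let ?t = "ln (norm x)"
      have xM: "x \<in> closed_annulus r0 r2" using x S by blast
      have t: "?a \<le> ?t" "?t \<le> ?c" using closed_annulus_ln(1)[OF R(1) xM] by auto
      have nx: "norm x > 0" "norm x \<ge> r0" using closed_annulus_ln(2)[OF R(1) xM] xM by (auto simp: closed_annulus_def)
      have decay: "exp (- (2 * (\<kappa> * real n) * r)) \<le> \<theta>" if "r \<ge> \<delta>" for r
        unfolding \<theta>_def using that k(1) by (auto intro!: mult_left_mono)
      show ?thesis
      proof (cases "norm x < r1")
        case True
        then have "norm x \<le> max (r1 - \<eta>) r0" using far[OF x] by auto
        then have "?t \<le> ln (max (r1 - \<eta>) r0)" using nx R(1) by (subst ln_le_cancel_iff) auto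
        then have tb: "?t \<le> ?b - 3 * \<delta>" using \<delta>3(1) by linarith
        show ?thesis
        proof (rule conc[of "?b - 2 * \<delta>" "?b - \<delta>"])
          show "A \<le> measure lebesgue (closed_annulus (exp (?b - 2 * \<delta>)) (exp (?b - \<delta>)))" by (simp add: A_def)
          fix t' assume t': "t' \<in> {?b - 2 * \<delta>..?b - \<delta>}"
          have "(f ?t)\<^sup>2 \<le> exp (- (2 * (\<kappa> * real n) * (t' - ?t))) * (f t')\<^sup>2"
            using t' tb \<delta> by (intro kf[OF ep l t(1)]) auto
          also have "\<dots> \<le> \<theta> * (f t')\<^sup>2" using t' tb by (intro mult_right_mono decay) auto
          finally show "(?F ?t)\<^sup>2 \<le> \<theta> * (?F t')\<^sup>2" using t' tb \<delta> by simp
        qed (use \<delta> \<delta>3 ln in auto)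
      next
        case False
        then have "norm x \<ge> r1 + \<eta>" using far[OF x] by linarith
        then have "ln (r1 + \<eta>) \<le> ?t" using R12 \<eta> by (subst ln_le_cancel_iff) auto
        then have tb: "?t \<ge> ?b + 3 * \<delta>" using \<delta>3(2) by linarith
        show ?thesis
        proof (rule conc[of "?b + \<delta>" "?b + 2 * \<delta>"])
          show "A \<le> measure lebesgue (closed_annulus (exp (?b + \<delta>)) (exp (?b + 2 * \<delta>)))" by (simp add: A_def)
          fix t' assume t': "t' \<in> {?b + \<delta>..?b + 2 * \<delta>}"
          have "(g ?t)\<^sup>2 \<le> exp (- (2 * (\<kappa> * real n) * (?t - t'))) * (g t')\<^sup>2"
            using t' tb \<delta> t(2) by (intro kg[OF ep l]) auto
          also have "\<dots> \<le> \<theta> * (g t')\<^sup>2" using t' tb by (intro mult_right_mono decay) auto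
          finally show "(?F ?t)\<^sup>2 \<le> \<theta> * (?F t')\<^sup>2" using t' tb \<delta> by simp
        qed (use \<delta> \<delta>3 ln in auto)
      qed
    qed
    have "(L2_norm (lebesgue_on S) (polar_mode n ?F))\<^sup>2 \<le> 2 / A * \<theta> * Q"
      unfolding Q_def using A \<theta> by (intro L2_norm_le_sup[OF R(1) F S _ bound]) auto
    also have "\<dots> = (B * exp (- (\<kappa> * \<delta>) * real n))\<^sup>2"
    proof -
      have "\<theta> = (exp (- (\<kappa> * \<delta>) * real n))\<^sup>2" unfolding \<theta>_def power2_eq_square by (simp flip: exp_add)
      moreover have "B\<^sup>2 = 2 / A * Q" using A Q by (simp add: B_def)
      ultimately show ?thesis by (simp add: power_mult_distrib)
    qed
    finally show "L2_norm (lebesgue_on S) (polar_mode n ?F) \<le> B * exp (- (\<kappa> * \<delta>) * real n)"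
      by (rule power2_le_imp_le) (use \<open>B > 0\<close> in simp)
  qed
qed

text \<open>
  To have one sequence that serves every \<open>\<epsilon>\<close>, the eigenvalue is chosen within \<open>1\<close> of the infimum of the
  eigenvalues above \<open>E * n\<^sup>2\<close>; an error of \<open>1\<close> is negligible compared with \<open>n\<^sup>2\<close>. For the finitely many \<open>n\<close> that are
  too small for an eigenvalue to be available, the mode is replaced by the first admissible one, which affects
  only the constant \<open>C\<close>.
\<close>

theorem theorem2p5:
  fixes R\<^sub>0 R\<^sub>1 R\<^sub>2 c\<^sub>m c\<^sub>p :: real
  assumes "0 < R\<^sub>0" and "R\<^sub>0 < R\<^sub>1" and "R\<^sub>1 < R\<^sub>2"
    and "0 < c\<^sub>m" and "c\<^sub>m < c\<^sub>p"
    and "c\<^sub>m / R\<^sub>1\<^sup>2 < c\<^sub>p / R\<^sub>2\<^sup>2"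
  shows "\<exists>(lam :: nat \<Rightarrow> real) (u :: nat \<Rightarrow> real^2 \<Rightarrow> real) (E\<^sub>0 :: real).
    E\<^sub>0 > 0 \<and>
    (\<forall>n. u n \<in> op_domain R\<^sub>0 R\<^sub>1 R\<^sub>2 c\<^sub>m c\<^sub>p) \<and>
    (\<forall>n. neg_div_grad (interior (closed_annulus R\<^sub>0 R\<^sub>2)) (jump_coeff R\<^sub>0 R\<^sub>1 R\<^sub>2 c\<^sub>m c\<^sub>p)
           (u n) (\<lambda>x. lam n * u n x)) \<and>
    lam \<sim>[at_top] (\<lambda>n. E\<^sub>0 * (real n)\<^sup>2) \<and>
    (\<forall>n. L2_norm (lebesgue_on (closed_annulus R\<^sub>0 R\<^sub>2)) (u n) = 1) \<and>
    (\<forall>\<omega>. \<omega> \<in> sets lebesgue \<and> \<omega> \<subseteq> closed_annulus R\<^sub>0 R\<^sub>2 \<and>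
           (\<omega> = {} \<or> setdist (closure \<omega>) (sphere 0 R\<^sub>1) > 0) \<longrightarrow>
       (\<exists>C>0. \<exists>d>0. \<forall>n. L2_norm (lebesgue_on \<omega>) (u n) \<le> C * exp (- d * real n)))"
proof -
  note R = assms(1-3)
  have c: "0 < c\<^sub>m" "0 < c\<^sub>p" using assms(4,5) by auto
  have R12: "0 < R\<^sub>1" "0 < R\<^sub>2" using R by auto
  define E where "E = c\<^sub>m / R\<^sub>1\<^sup>2"
  have E0: "E > 0" using c R12 by (simp add: E_def)
  have E: "c\<^sub>m * exp (- 2 * ln R\<^sub>1) = E" "c\<^sub>p * exp (- 2 * ln R\<^sub>2) = c\<^sub>p / R\<^sub>2\<^sup>2"
    using R12 by (simp_all add: E_def exp_minus exp_double divide_inverse)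
  define P where "P n l \<longleftrightarrow> (\<exists>f f' g g'. eigenpair (ln R\<^sub>0) (ln R\<^sub>1) (ln R\<^sub>2) c\<^sub>m c\<^sub>p n l f f' g g' \<and> f' (ln R\<^sub>0) = 1)"
      for n l
  have bottom: "\<exists>N. \<forall>n\<ge>N. \<exists>l. E * (real n)\<^sup>2 \<le> l \<and> l \<le> E * (1 + \<epsilon>) * (real n)\<^sup>2 \<and> P n l" if "\<epsilon> > 0" for \<epsilon>
  proof -
    have "ln R\<^sub>0 < ln R\<^sub>1" "ln R\<^sub>1 < ln R\<^sub>2" using R by auto
    from eigenpair_near_bottom[OF c this, unfolded E, unfolded E_def, OF assms(6) that]
    show ?thesis unfolding P_def E_def by blast
  qed
  obtain N1 where N1: "\<And>n. n \<ge> N1 \<Longrightarrow> \<exists>l. E * (real n)\<^sup>2 \<le> l \<and> P n l" using bottom[OF zero_less_one] by blast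
  \<comment> \<open>Below \<open>N1\<close> there need not be an eigenvalue; these \<open>n\<close> all get the mode \<open>max 1 N1\<close>.\<close>
  define m where "m n = max 1 (max n N1)" for n :: nat
  have m1: "m n \<ge> 1" for n by (simp add: m_def)
  define S where "S n = {l. E * (real (m n))\<^sup>2 \<le> l \<and> P (m n) l}" for n
  have "\<exists>l. l \<in> S n \<and> (\<forall>l'\<in>S n. l < l' + 1)" for n
  proof -
    have ne: "S n \<noteq> {}" using N1[of "m n"] by (auto simp: S_def m_def)
    have bb: "bdd_below (S n)" by (rule bdd_belowI[of _ "E * (real (m n))\<^sup>2"]) (simp add: S_def)
    have "Inf (S n) < Inf (S n) + 1" by simp
    then obtain l where l: "l \<in> S n" "l < Inf (S n) + 1" using cInf_lessD[OF ne] by blast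
    have "l < l' + 1" if "l' \<in> S n" for l' using l(2) cInf_lower[OF that bb] by linarith
    with l(1) show ?thesis by blast
  qed
  then have "\<exists>lam. \<forall>n. lam n \<in> S n \<and> (\<forall>l'\<in>S n. lam n < l' + 1)" by (rule choice[OF allI])
  then obtain lam where lam: "\<And>n. lam n \<in> S n" "\<And>n l'. l' \<in> S n \<Longrightarrow> lam n < l' + 1" by blast
  have "\<exists>u. \<exists>f f' g g'. eigenpair (ln R\<^sub>0) (ln R\<^sub>1) (ln R\<^sub>2) c\<^sub>m c\<^sub>p (m n) (lam n) f f' g g' \<and>
      u = polar_mode (m n) (glue (ln R\<^sub>1) f g) \<and> L2_norm (lebesgue_on (closed_annulus R\<^sub>0 R\<^sub>2)) u = 1" for n
  proof -
    obtain f f' g g' where "eigenpair (ln R\<^sub>0) (ln R\<^sub>1) (ln R\<^sub>2) c\<^sub>m c\<^sub>p (m n) (lam n) f f' g g'" "f' (ln R\<^sub>0) = 1"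
      using lam(1)[of n] unfolding S_def P_def by blast
    from eigenpair_normalised[OF R m1 this] show ?thesis by blast
  qed
  then have "\<exists>u. \<forall>n. \<exists>f f' g g'. eigenpair (ln R\<^sub>0) (ln R\<^sub>1) (ln R\<^sub>2) c\<^sub>m c\<^sub>p (m n) (lam n) f f' g g' \<and>
      u n = polar_mode (m n) (glue (ln R\<^sub>1) f g) \<and> L2_norm (lebesgue_on (closed_annulus R\<^sub>0 R\<^sub>2)) (u n) = 1"
    by (rule choice[OF allI])
  then obtain u where u: "\<And>n. \<exists>f f' g g'. eigenpair (ln R\<^sub>0) (ln R\<^sub>1) (ln R\<^sub>2) c\<^sub>m c\<^sub>p (m n) (lam n) f f' g g' \<and>
      u n = polar_mode (m n) (glue (ln R\<^sub>1) f g) \<and> L2_norm (lebesgue_on (closed_annulus R\<^sub>0 R\<^sub>2)) (u n) = 1"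
    by blast
  have near: "\<exists>N. \<forall>n\<ge>N. m n = n \<and> lam n \<le> E * (1 + \<epsilon>) * (real n)\<^sup>2" if \<epsilon>: "\<epsilon> > 0" for \<epsilon>
  proof -
    have "\<epsilon> / 2 > 0" using \<epsilon> by simp
    from bottom[OF this] obtain N2 where N2: "\<And>n. n \<ge> N2 \<Longrightarrow>
        \<exists>l. E * (real n)\<^sup>2 \<le> l \<and> l \<le> E * (1 + \<epsilon> / 2) * (real n)\<^sup>2 \<and> P n l"
      by blast
    obtain N3 :: nat where N3: "real N3 \<ge> 2 / (E * \<epsilon>)" using real_arch_simple by blast
    have "m n = n \<and> lam n \<le> E * (1 + \<epsilon>) * (real n)\<^sup>2" if n: "n \<ge> max (max 1 N1) (max N2 N3)" for n
    proof
      show mn: "m n = n" using n by (simp add: m_def)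
      obtain l where l: "E * (real n)\<^sup>2 \<le> l" "l \<le> E * (1 + \<epsilon> / 2) * (real n)\<^sup>2" "P n l" using N2[of n] n by auto
      then have "lam n < l + 1" by (intro lam(2)) (simp add: S_def mn)
      moreover have "1 \<le> E * \<epsilon> / 2 * (real n)\<^sup>2"
      proof -
        have "2 / (E * \<epsilon>) \<le> real n" using N3 n by linarith
        then have "2 \<le> real n * (E * \<epsilon>)" using E0 \<epsilon> by (simp add: pos_divide_le_eq)
        then have "1 \<le> E * \<epsilon> / 2 * real n" by (simp add: mult_ac)
        also have "\<dots> \<le> E * \<epsilon> / 2 * (real n)\<^sup>2"
        proof (rule mult_left_mono)
          have "1 \<le> real n" using n by simp
          then show "real n \<le> (real n)\<^sup>2" by (simp add: power2_eq_square)
        qed (use E0 \<epsilon> in simp)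
        finally show ?thesis .
      qed
      moreover have "E * (1 + \<epsilon> / 2) * (real n)\<^sup>2 + E * \<epsilon> / 2 * (real n)\<^sup>2 = E * (1 + \<epsilon>) * (real n)\<^sup>2"
          by (simp add: algebra_simps)
      ultimately show "lam n \<le> E * (1 + \<epsilon>) * (real n)\<^sup>2" using l(2) by linarith
    qed
    then show ?thesis by blast
  qed
  have in_dom: "u n \<in> op_domain R\<^sub>0 R\<^sub>1 R\<^sub>2 c\<^sub>m c\<^sub>p \<and>
      neg_div_grad (interior (closed_annulus R\<^sub>0 R\<^sub>2)) (jump_coeff R\<^sub>0 R\<^sub>1 R\<^sub>2 c\<^sub>m c\<^sub>p) (u n) (\<lambda>x. lam n * u n x)"
          for n
  proof -
    obtain f f' g g' where ep: "eigenpair (ln R\<^sub>0) (ln R\<^sub>1) (ln R\<^sub>2) c\<^sub>m c\<^sub>p (m n) (lam n) f f' g g'"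
      and un: "u n = polar_mode (m n) (glue (ln R\<^sub>1) f g)" using u[of n] by blast
    show ?thesis unfolding un using eigenpair_in_op_domain[OF R c m1 ep] by blast
  qed
  have norm1: "L2_norm (lebesgue_on (closed_annulus R\<^sub>0 R\<^sub>2)) (u n) = 1" for n using u[of n] by blast
  have asym: "lam \<sim>[at_top] (\<lambda>n. E * (real n)\<^sup>2)"
  proof (rule asymp_equivI')
    show "(\<lambda>n. lam n / (E * (real n)\<^sup>2)) \<longlonglongrightarrow> 1"
    proof (rule LIMSEQ_I)
      fix r :: real assume r: "r > 0"
      then have "r / 2 > 0" by simp
      then obtain N where N: "\<And>n. n \<ge> N \<Longrightarrow> m n = n \<and> lam n \<le> E * (1 + r / 2) * (real n)\<^sup>2" using near by blast
      have "norm (lam n / (E * (real n)\<^sup>2) - 1) < r" if n: "n \<ge> max 1 N" for n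
      proof -
        have p: "E * (real n)\<^sup>2 > 0" using E0 n by simp
        have "m n = n" using N n by simp
        then have "E * (real n)\<^sup>2 \<le> lam n" using lam(1)[of n] by (simp add: S_def)
        moreover have "lam n \<le> (1 + r / 2) * (E * (real n)\<^sup>2)" using N[of n] n by (simp add: mult_ac)
        ultimately have "1 \<le> lam n / (E * (real n)\<^sup>2)" "lam n / (E * (real n)\<^sup>2) \<le> 1 + r / 2"
          using p by (simp_all add: pos_le_divide_eq pos_divide_le_eq)
        then show ?thesis using r by simp
      qed
      then show "\<exists>no. \<forall>n\<ge>no. norm (lam n / (E * (real n)\<^sup>2) - 1) < r" by blast
    qed
  qed
  have decay: "\<exists>C>0. \<exists>d>0. \<forall>n. L2_norm (lebesgue_on \<omega>) (u n) \<le> C * exp (- d * real n)"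
    if \<omega>: "\<omega> \<in> sets lebesgue" "\<omega> \<subseteq> closed_annulus R\<^sub>0 R\<^sub>2" "\<omega> = {} \<or> setdist (closure \<omega>) (sphere 0 R\<^sub>1) > 0" for \<omega>
  proof -
    have "\<exists>\<eta>>0. \<forall>x\<in>\<omega>. \<eta> \<le> \<bar>norm x - R\<^sub>1\<bar>"
    proof (cases "\<omega> = {}")
      case False
      then have pos: "setdist (closure \<omega>) (sphere 0 R\<^sub>1) > 0" using \<omega>(3) by blast
      have "setdist (closure \<omega>) (sphere 0 R\<^sub>1) \<le> \<bar>norm x - R\<^sub>1\<bar>" if x: "x \<in> \<omega>" for x
      proof -
        have x0: "x \<noteq> 0" using closed_annulus_nonzero[OF R(1)] \<omega>(2) x by blast
        have "R\<^sub>1 *\<^sub>R sgn x \<in> sphere 0 R\<^sub>1" using x0 R12 by (simp add: norm_sgn)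
        then have "setdist (closure \<omega>) (sphere 0 R\<^sub>1) \<le> dist x (R\<^sub>1 *\<^sub>R sgn x)"
          using x closure_subset by (intro setdist_le_dist) auto
        also have "x - R\<^sub>1 *\<^sub>R sgn x = (norm x - R\<^sub>1) *\<^sub>R sgn x" using x0 by (simp add: sgn_div_norm algebra_simps)
        then have "dist x (R\<^sub>1 *\<^sub>R sgn x) = \<bar>norm x - R\<^sub>1\<bar>" using x0 by (simp add: dist_norm norm_sgn)
        finally show ?thesis .
      qed
      then show ?thesis using pos by blast
    qed (auto intro: exI[of _ 1])
    then obtain \<eta> where \<eta>: "\<eta> > 0" "\<And>x. x \<in> \<omega> \<Longrightarrow> \<eta> \<le> \<bar>norm x - R\<^sub>1\<bar>" by blast
    obtain B d \<epsilon> where B: "B > 0" "d > 0" "\<epsilon> > 0" and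
      conc: "\<And>n l f f' g g' S. \<lbrakk>n \<ge> 1; eigenpair (ln R\<^sub>0) (ln R\<^sub>1) (ln R\<^sub>2) c\<^sub>m c\<^sub>p n l f f' g g'; l
          \<le> c\<^sub>m / R\<^sub>1\<^sup>2 * (1 + \<epsilon>) * (real n)\<^sup>2;
        L2_norm (lebesgue_on (closed_annulus R\<^sub>0 R\<^sub>2)) (polar_mode n (glue (ln R\<^sub>1) f g)) = 1;
        S \<in> sets lebesgue; S \<subseteq> closed_annulus R\<^sub>0 R\<^sub>2; \<And>x. x \<in> S \<Longrightarrow> \<bar>norm x - R\<^sub>1\<bar> \<ge> \<eta>\<rbrakk>
      \<Longrightarrow> L2_norm (lebesgue_on S) (polar_mode n (glue (ln R\<^sub>1) f g)) \<le> B * exp (- d * real n)"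
      by (rule eigenpair_concentration[OF R c assms(6) \<eta>(1)]) blast
    obtain N where N: "\<And>n. n \<ge> N \<Longrightarrow> m n = n \<and> lam n \<le> E * (1 + \<epsilon>) * (real n)\<^sup>2" using near[OF B(3)] by blast
    have large: "L2_norm (lebesgue_on \<omega>) (u n) \<le> B * exp (- d * real n)" if n: "n \<ge> N" for n
    proof -
      obtain f f' g g' where ep: "eigenpair (ln R\<^sub>0) (ln R\<^sub>1) (ln R\<^sub>2) c\<^sub>m c\<^sub>p (m n) (lam n) f f' g g'"
        and un: "u n = polar_mode (m n) (glue (ln R\<^sub>1) f g)" using u[of n] by blast
      have mn: "m n = n" and ln: "lam n \<le> c\<^sub>m / R\<^sub>1\<^sup>2 * (1 + \<epsilon>) * (real n)\<^sup>2" using N[OF n] by (auto simp: E_def)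
      show ?thesis unfolding un mn
        by (rule conc[OF _ ep[unfolded mn] ln norm1[of n, unfolded un mn] \<omega>(1,2) \<eta>(2)]) (use m1[of n] mn in auto)
    qed
    have small: "L2_norm (lebesgue_on \<omega>) (u n) \<le> 1" for n
    proof -
      obtain f f' g g' where ep: "eigenpair (ln R\<^sub>0) (ln R\<^sub>1) (ln R\<^sub>2) c\<^sub>m c\<^sub>p (m n) (lam n) f f' g g'"
        and un: "u n = polar_mode (m n) (glue (ln R\<^sub>1) f g)" using u[of n] by blast
      show ?thesis
        using L2_norm_mono_set[OF R(1) eigenpair_continuous[OF ep] \<omega>(1,2), of "m n"] norm1[of n] unfolding un by simp
    qed
    have "L2_norm (lebesgue_on \<omega>) (u n) \<le> max B (exp (d * real N)) * exp (- d * real n)" for n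
    proof (cases "n \<ge> N")
      case True
      have "B * exp (- d * real n) \<le> max B (exp (d * real N)) * exp (- d * real n)" by (intro mult_right_mono) auto
      then show ?thesis using large[OF True] by linarith
    next
      case False
      then have "d * real n \<le> d * real N" using B(2) by simp
      then have "1 \<le> exp (d * real N) * exp (- d * real n)" by (simp flip: exp_add)
      also have "\<dots> \<le> max B (exp (d * real N)) * exp (- d * real n)" by (intro mult_right_mono) auto
      finally show ?thesis using small[of n] by linarith
    qed
    moreover have "max B (exp (d * real N)) > 0" using B(1) by simp
    ultimately show ?thesis using B(2) by blast
  qed
  show ?thesis
  proof (rule exI[of _ lam], rule exI[of _ u], rule exI[of _ E], intro conjI allI impI)
    show "u n \<in> op_domain R\<^sub>0 R\<^sub>1 R\<^sub>2 c\<^sub>m c\<^sub>p" for n using in_dom[of n] ..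
    show "neg_div_grad (interior (closed_annulus R\<^sub>0 R\<^sub>2)) (jump_coeff R\<^sub>0 R\<^sub>1 R\<^sub>2 c\<^sub>m c\<^sub>p) (u n) (\<lambda>x. lam n * u n x)"
        for n
      using in_dom[of n] ..
    show "\<exists>C>0. \<exists>d>0. \<forall>n. L2_norm (lebesgue_on \<omega>) (u n) \<le> C * exp (- d * real n)"
      if "\<omega> \<in> sets lebesgue \<and> \<omega> \<subseteq> closed_annulus R\<^sub>0 R\<^sub>2 \<and> (\<omega> = {} \<or> setdist (closure \<omega>) (sphere 0 R\<^sub>1) > 0)" for \<omega>
      using that by (elim conjE) (rule decay)
  qed (rule E0 asym norm1)+
qed

end
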